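(* Consider the elliptic curve $$E_t:\ y^2=f_t(x):=x^3-3(t^2+1)x^2+3x-1,\qquad \Delta(E_t)=-432\,t^4(9+4t^2)\neq 0.$$ For any $t\in\mathbb{Q}\setminus\{0\}$, one has $|\widetilde{E}_{t,p}(\mathbb{F}_p)|\equiv 0 \mod 3$ for all primes $p\neq 2,3$ such that $\nu_p(t(9+4t^2))=0$. Moreover, there are infinitely many rational values of $t$ such that $|\widetilde{E}_{t,p}(\mathbb{F}_p)|\equiv 0 \mod 6$ for all primes $p$ in a set $S$ of primes of density at least $2/3$, and $|\widetilde{E}_{t,p}(\mathbb{F}_p)|\equiv 0\mod 12$ for at least half of the primes in $S$.
   Context: For a rational number $t$ with $\Delta(E_t)\ne 0$ and a prime $p$ of good reduction of $E_t$, $\widetilde{E}_{t,p}$ denotes the reduction modulo $p$ of the elliptic curve $E_t$ over $\mathbb{Q}$. $\nu_p$ is the $p$-adic valuation on $\mathbb{Q}$. $\Delta(E_t)$ is the discriminant of the Weierstrass equation. Density means natural density of a set of rational primes, and "at least half of the primes in $S$" is meant in the sense of density relative to $S$. *)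

theory Defs
  imports Complex_Main "HOL-Number_Theory.Number_Theory" "HOL-Number_Theory.Modular_Inverse"
begin

text \<open>
  The value at \<open>q = 0\<close>, where the valuation is infinite, is junk: uses of
  \<open>rat_val\<close> have to treat \<open>0\<close> separately.
\<close>
definition rat_val :: "nat \<Rightarrow> rat \<Rightarrow> int" where
  "rat_val p q = int (multiplicity (int p) (fst (quotient_of q)))
               - int (multiplicity (int p) (snd (quotient_of q)))"

definition p_integral :: "nat \<Rightarrow> rat \<Rightarrow> bool" where
  "p_integral p q \<longleftrightarrow> q = 0 \<or> rat_val p q \<ge> 0"

text \<open>
  The residue map from the \<open>p\<close>-integral rationals to the field with \<open>p\<close> elements, the latter
  being represented by \<open>{0..<p}\<close>.
\<close>
definition rat_mod :: "nat \<Rightarrow> rat \<Rightarrow> int" where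
  "rat_mod p q =
     fst (quotient_of q) * modular_inverse (int p) (snd (quotient_of q)) mod int p"

text \<open>
  The Weierstrass equation
  \<open>y\<^sup>2 + a\<^sub>1 x y + a\<^sub>3 y = x\<^sup>3 + a\<^sub>2 x\<^sup>2 + a\<^sub>4 x + a\<^sub>6\<close>.
\<close>
datatype 'a weierstrass =
  Weierstrass (cf1: 'a) (cf2: 'a) (cf3: 'a) (cf4: 'a) (cf6: 'a)

definition discriminant :: "'a :: comm_ring_1 weierstrass \<Rightarrow> 'a" where
  "discriminant W =
    (let b2 = cf1 W ^ 2 + 4 * cf2 W;
         b4 = 2 * cf4 W + cf1 W * cf3 W;
         b6 = cf3 W ^ 2 + 4 * cf6 W;
         b8 = cf1 W ^ 2 * cf6 W + 4 * cf2 W * cf6 W - cf1 W * cf3 W * cf4 W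
              + cf2 W * cf3 W ^ 2 - cf4 W ^ 2
     in - (b2 ^ 2) * b8 - 8 * b4 ^ 3 - 27 * b6 ^ 2 + 9 * b2 * b4 * b6)"

text \<open>
  \<open>W'\<close> arises from \<open>W\<close> by the admissible change of variables
  \<open>x = u\<^sup>2 x' + r\<close>, \<open>y = u\<^sup>3 y' + u\<^sup>2 s x' + w\<close> with \<open>u \<noteq> 0\<close>.
\<close>
definition weierstrass_iso :: "'a :: field weierstrass \<Rightarrow> 'a weierstrass \<Rightarrow> bool" where
  "weierstrass_iso W W' \<longleftrightarrow> (\<exists>u r s w. u \<noteq> 0 \<and>
     u * cf1 W' = cf1 W + 2 * s \<and>
     u ^ 2 * cf2 W' = cf2 W - s * cf1 W + 3 * r - s ^ 2 \<and>
     u ^ 3 * cf3 W' = cf3 W + r * cf1 W + 2 * w \<and>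
     u ^ 4 * cf4 W' = cf4 W - s * cf3 W + 2 * r * cf2 W - (w + r * s) * cf1 W
                      + 3 * r ^ 2 - 2 * s * w \<and>
     u ^ 6 * cf6 W' = cf6 W + r * cf4 W + r ^ 2 * cf2 W + r ^ 3
                      - w * cf3 W - w ^ 2 - r * w * cf1 W)"

text \<open>
  \<open>None\<close> is the point at infinity; affine coordinates and coefficients are representatives
  in \<open>{0..<p}\<close>.
\<close>
definition points_mod :: "nat \<Rightarrow> int weierstrass \<Rightarrow> (int \<times> int) option set" where
  "points_mod p W = insert None (Some ` {(x, y). x \<in> {0..<int p} \<and> y \<in> {0..<int p} \<and>
     [y ^ 2 + cf1 W * x * y + cf3 W * y = x ^ 3 + cf2 W * x ^ 2 + cf4 W * x + cf6 W] (mod int p)})"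

definition good_model :: "nat \<Rightarrow> rat weierstrass \<Rightarrow> rat weierstrass \<Rightarrow> bool" where
  "good_model p E W \<longleftrightarrow> weierstrass_iso E W \<and>
     (\<forall>c \<in> set_weierstrass W. p_integral p c) \<and>
     discriminant W \<noteq> 0 \<and> rat_val p (discriminant W) = 0"

definition good_reduction :: "rat weierstrass \<Rightarrow> nat \<Rightarrow> bool" where
  "good_reduction E p \<longleftrightarrow> (\<exists>W. good_model p E W)"

text \<open>
  Any two \<open>p\<close>-integral models over the rationals with discriminant a \<open>p\<close>-adic unit have
  isomorphic reductions, so for a prime \<open>p\<close> of good reduction the number of points of
  \<open>reduction E p\<close> does not depend on the choice of the model.
\<close>
definition reduction :: "rat weierstrass \<Rightarrow> nat \<Rightarrow> int weierstrass" where
  "reduction E p = map_weierstrass (rat_mod p) (SOME W. good_model p E W)"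

definition E_fam :: "rat \<Rightarrow> rat weierstrass" where
  "E_fam t = Weierstrass 0 (- 3 * (t ^ 2 + 1)) 0 3 (- 1)"

definition reduction_card :: "rat \<Rightarrow> nat \<Rightarrow> nat" where
  "reduction_card t p = card (points_mod p (reduction (E_fam t) p))"

definition has_relative_density :: "nat set \<Rightarrow> nat set \<Rightarrow> real \<Rightarrow> bool" where
  "has_relative_density A S d \<longleftrightarrow>
     (\<lambda>n. real (card {p \<in> A \<inter> S. p \<le> n}) / real (card {p \<in> S. p \<le> n})) \<longlonglongrightarrow> d"

definition has_prime_density :: "nat set \<Rightarrow> real \<Rightarrow> bool" where
  "has_prime_density A d \<longleftrightarrow> has_relative_density A {p. prime p} d"

end

theory Submission
  imports Defs "HOL-Real_Asymp.Real_Asymp" "HOL-Computational_Algebra.Squarefree"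
begin

text \<open>
  The cubic is \<open>f\<^sub>t(x) = (x - 1)\<^sup>3 - 3 (t x)\<^sup>2\<close>, so the two points with \<open>x = 1\<close>, \<open>y = \<plusminus>t sqrt (-3)\<close>
  and the point at infinity form a subgroup of order three that is rational over the base field. The quadratic twist by
  \<open>-3\<close> therefore has a rational point of order three, and its number of points modulo \<open>p\<close> is divisible by \<open>3\<close>.
  This is seen directly on the model \<open>(U + V + W)\<^sup>3 = - 12 t\<^sup>2 U V W\<close>, where translation by that point permutes
  the coordinates cyclically and has no fixed points. Modulo a prime \<open>p\<close> the curve either is isomorphic to its twist
  (if \<open>p mod 3 = 1\<close>) or has \<open>2 p + 2\<close> points together with it (if \<open>p mod 3 = 2\<close>); in both cases its own
  number of points is divisible by \<open>3\<close> as well (\<open>three_dvd_points\<close>). The reduction is formed from an unspecified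
  good model, but two good models are related by a change of variables that reduces modulo \<open>p\<close>
  (\<open>reduction_card_eq\<close>).

  For the second part take \<open>t = 3 k\<^sup>3 / (1 + 3 k\<^sup>2)\<close>. Then \<open>f\<^sub>t\<close> has the rational root \<open>1 + 3 k\<^sup>2\<close>, and
  the curve becomes \<open>y\<^sup>2 = x (x\<^sup>2 + a x + b)\<close>. Its number of points is divisible by \<open>4\<close> at every \<open>p\<close> for
  which \<open>b\<close> or \<open>a\<^sup>2 - 4 b\<close> is a square (\<open>four_dvd_points\<close>). Up to squares these numbers are
  \<open>3 (1 + k\<^sup>2) (1 + 3 k\<^sup>2)\<close> and \<open>- 3 (1 + 4 k\<^sup>2)\<close>. For \<open>k\<close> congruent to \<open>2\<close> modulo \<open>50\<close> neither
  they nor their product is a square, so one of them is a square modulo \<open>p\<close> for three quarters of all primes. The set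
  \<open>S\<close> of these primes has density \<open>3 / 4\<close>, and at each of its members the number of points is divisible by
  \<open>12\<close>; both divisibility claims hold on all of \<open>S\<close>.

  The density statement rests on \<open>Legendre_prime_average\<close>: the Legendre symbols \<open>(D / p)\<close> have mean \<open>0\<close> over
  the primes \<open>p\<close> if \<open>D\<close> is odd and exactly divisible by some prime \<open>l > 2\<close>. By quadratic
  reciprocity they are, at almost all primes, the values of a nonprincipal real Dirichlet character \<open>\<chi>\<close>, and the mean is computed by the elementary method of Selberg and Erdos. The hyperbola method gives \<open>L(1, \<chi>) \<noteq> 0\<close>
  (\<open>L1_nonzero\<close>), hence bounded sums of \<open>\<mu>(n) \<chi>(n) / n\<close>. Selberg's formula gives a recursive inequality for the
  summatory function \<open>mertens\<close> of \<open>\<mu> \<chi>\<close>, in which any eventual bound \<open>\<bar>mertens n\<bar> \<le> \<beta> n\<close> can be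
  improved (\<open>limsup_contraction\<close>), so that \<open>mertens n = o(n)\<close>. From there convolution identities and partial
  summation lead to the sum of \<open>\<chi>\<close> over primes, which is compared with the number of primes by Chebyshev's lower
  bound.
\<close>

section \<open>Dirichlet convolution and the Moebius function\<close>

definition dconv :: "(nat \<Rightarrow> real) \<Rightarrow> (nat \<Rightarrow> real) \<Rightarrow> nat \<Rightarrow> real" where
  "dconv f g n = (\<Sum>d | d dvd n. f d * g (n div d))"

lemma dconv_0 [simp]: "dconv f g 0 = 0"
  by (simp add: dconv_def)

lemma dconv_commute: "dconv f g = dconv g f"
proof
  fix n
  show "dconv f g n = dconv g f n"
  proof (cases "n = 0")
    case False
    then show ?thesis
      unfolding dconv_def
      by (intro sum.reindex_bij_witness[of _ "\<lambda>d. n div d" "\<lambda>d. n div d"]) (auto simp: mult.commute)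
  qed simp
qed

lemma dconv_assoc: "dconv (dconv f g) h = dconv f (dconv g h)"
proof
  fix n
  show "dconv (dconv f g) h n = dconv f (dconv g h) n"
  proof (cases "n = 0")
    case False
    have "dconv (dconv f g) h n =
      (\<Sum>(d, e) \<in> (SIGMA d:{d. d dvd n}. {e. e dvd d}). f e * g (d div e) * h (n div d))"
      using False by (simp add: dconv_def sum_distrib_right sum.Sigma dvd_pos_nat finite_divisors_nat)
    also have "\<dots> = (\<Sum>(e, d) \<in> (SIGMA e:{e. e dvd n}. {d. d dvd n div e}).
        f e * (g d * h (n div e div d)))"
    proof (intro sum.reindex_bij_witness[of _ "\<lambda>(e, d). (e * d, e)" "\<lambda>(d, e). (e, d div e)"])
      fix a assume "a \<in> (SIGMA d:{d. d dvd n}. {e. e dvd d})"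
      then obtain e d' m where a: "a = (e * d', e)" and n: "n = e * d' * m" by (auto simp: dvd_def)
      have pos: "e > 0" "d' > 0" using n False by auto
      have "n div e = d' * m" "n div (e * d') = m" using n pos by auto
      then show "(case a of (d, e) \<Rightarrow> (e, d div e)) \<in> (SIGMA e:{e. e dvd n}. {d. d dvd n div e})"
        "(case (case a of (d, e) \<Rightarrow> (e, d div e)) of (e, d) \<Rightarrow> (e * d, e)) = a"
        "(case (case a of (d, e) \<Rightarrow> (e, d div e)) of (e, d) \<Rightarrow> f e * (g d * h (n div e div d)))
          = (case a of (d, e) \<Rightarrow> f e * g (d div e) * h (n div d))"
        using pos n by (simp_all add: a)
    next
      fix a assume "a \<in> (SIGMA e:{e. e dvd n}. {d. d dvd n div e})"
      then obtain e d where a: "a = (e, d)" and ed: "e dvd n" "d dvd n div e" by auto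
      have "e * d dvd n" using ed by (metis dvd_mult_div_cancel mult_dvd_mono dvd_refl)
      moreover have "e \<noteq> 0" using ed False by auto
      ultimately show "(case a of (e, d) \<Rightarrow> (e * d, e)) \<in> (SIGMA d:{d. d dvd n}. {e. e dvd d})"
        "(case (case a of (e, d) \<Rightarrow> (e * d, e)) of (d, e) \<Rightarrow> (e, d div e)) = a"
        by (simp_all add: a)
    qed
    also have "\<dots> = dconv f (dconv g h) n"
    proof -
      have "\<forall>e\<in>{e. e dvd n}. finite {d. d dvd n div e}"
        using False by (auto intro!: finite_divisors_nat simp: dvd_div_eq_0_iff intro: Nat.gr0I)
      then show ?thesis
        using False by (simp add: dconv_def sum_distrib_left sum.Sigma)
    qed
    finally show ?thesis .
  qed simp
qed

lemma dconv_add_left: "dconv (\<lambda>n. f n + g n) h n = dconv f h n + dconv g h n"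
  by (simp add: dconv_def algebra_simps sum.distrib)

lemma dconv_diff_left: "dconv (\<lambda>n. f n - g n) h n = dconv f h n - dconv g h n"
  by (simp add: dconv_def algebra_simps sum_subtractf)

lemma dconv_uminus_left: "dconv (\<lambda>n. - f n) h n = - dconv f h n"
  by (simp add: dconv_def sum_negf)

text \<open>
  Both sides run over the pairs \<open>(d, m)\<close> with \<open>d * m \<le> x\<close>.
\<close>

lemma sum_divisors_swap:
  fixes F :: "nat \<Rightarrow> nat \<Rightarrow> 'a :: comm_monoid_add"
  shows "(\<Sum>n=1..x. \<Sum>d | d dvd n. F d (n div d)) = (\<Sum>d=1..x. \<Sum>m=1..x div d. F d m)"
proof -
  have "(\<Sum>n=1..x. \<Sum>d | d dvd n. F d (n div d)) =
      (\<Sum>(n, d) \<in> (SIGMA n:{1..x}. {d. d dvd n}). F d (n div d))"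
    by (subst sum.Sigma) (auto intro!: finite_divisors_nat)
  also have "\<dots> = (\<Sum>(d, m) \<in> (SIGMA d:{1..x}. {1..x div d}). F d m)"
  proof (intro sum.reindex_bij_witness[of _ "\<lambda>(d, m). (d * m, d)" "\<lambda>(n, d). (d, n div d)"])
    fix a assume a: "a \<in> (SIGMA n:{1..x}. {d. d dvd n})"
    obtain n d where [simp]: "a = (n, d)" by (cases a)
    from a have "0 < n" "n \<le> x" "d dvd n" by auto
    then show "(case a of (n, d) \<Rightarrow> (d, n div d)) \<in> (SIGMA d:{1..x}. {1..x div d})"
      by (auto intro: div_le_mono dvd_imp_le dvd_pos_nat simp: Suc_le_eq dvd_div_eq_0_iff
        intro!: Nat.gr0I dest: dvd_imp_le)
  next
    fix b assume b: "b \<in> (SIGMA d:{1..x}. {1..x div d})"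
    obtain d m where [simp]: "b = (d, m)" by (cases b)
    from b have "0 < d" "0 < m" "m \<le> x div d" by auto
    then show "(case b of (d, m) \<Rightarrow> (d * m, d)) \<in> (SIGMA n:{1..x}. {d. d dvd n})"
      by (auto simp: less_eq_div_iff_mult_less_eq mult.commute)
  qed auto
  also have "\<dots> = (\<Sum>d=1..x. \<Sum>m=1..x div d. F d m)"
    by (subst sum.Sigma) auto
  finally show ?thesis .
qed

lemma sum_dconv:
  "(\<Sum>n=1..x. dconv f g n) = (\<Sum>d=1..x. f d * (\<Sum>m=1..x div d. g m))"
  using sum_divisors_swap[of "\<lambda>d m. f d * g m" x] by (simp add: dconv_def sum_distrib_left)

text \<open>
  Since \<open>ln (d * m) = ln d + ln m\<close>, multiplication by \<open>ln\<close> is a derivation for the convolution;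
  it stands for differentiating a Dirichlet series.
\<close>

lemma dconv_ln:
  "ln (real n) * dconv f g n = dconv (\<lambda>d. ln (real d) * f d) g n + dconv f (\<lambda>d. ln (real d) * g d) n"
proof (cases "n = 0")
  case False
  have "ln (real n) * (f d * g (n div d)) =
      ln (real d) * f d * g (n div d) + f d * (ln (real (n div d)) * g (n div d))" if "d dvd n" for d
  proof -
    from that obtain e where e: "n = d * e" by auto
    with False show ?thesis by (simp add: ln_mult algebra_simps)
  qed
  then show ?thesis
    by (simp add: dconv_def sum_distrib_left sum.distrib [symmetric])
qed simp

definition moebius_mu :: "nat \<Rightarrow> real" where
  "moebius_mu n = (if squarefree n then (- 1) ^ card (prime_factors n) else 0)"

lemma abs_moebius_mu_le: "\<bar>moebius_mu n\<bar> \<le> 1"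
  by (simp add: moebius_mu_def power_abs)

lemma moebius_mu_1 [simp]: "moebius_mu (Suc 0) = 1"
  by (simp add: moebius_mu_def)

lemma moebius_mu_prime_times:
  assumes "prime p" "\<not> p dvd d"
  shows "moebius_mu (p * d) = - moebius_mu d"
proof -
  have d: "d \<noteq> 0" using assms by (metis dvd_0_right)
  have cop: "coprime p d" using assms by (simp add: prime_imp_coprime)
  have "squarefree (p * d) \<longleftrightarrow> squarefree d"
    using assms cop by (metis squarefree_mult_coprime squarefree_multD(2) squarefree_prime)
  moreover have "prime_factors (p * d) = insert p (prime_factors d)"
    using assms d by (subst prime_factors_product) (auto simp: prime_prime_factors)
  moreover have "p \<notin> prime_factors d" using assms by auto
  ultimately show ?thesis by (simp add: moebius_mu_def)
qed

lemma sum_moebius_mu: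
  assumes "n > 0"
  shows "(\<Sum>d | d dvd n. moebius_mu d) = (if n = 1 then 1 else 0)"
proof (cases "n = 1")
  case False
  then obtain p where p: "prime p" "p dvd n" using prime_factor_nat by blast
  let ?A = "{d. d dvd n \<and> \<not> p dvd d}" and ?B = "{d. d dvd n \<and> p dvd d}"
  \<comment> \<open>Squarefree divisors come in pairs \<open>d\<close>, \<open>p * d\<close> with opposite signs.\<close>
  have "(\<Sum>d\<in>?B. moebius_mu d) = (\<Sum>d\<in>(*) p ` ?A. moebius_mu d)"
  proof (rule sum.mono_neutral_right)
    show "finite ?B" using assms by simp
    show "(*) p ` ?A \<subseteq> ?B"
      using p by (auto intro!: divides_mult prime_imp_coprime)
    show "\<forall>d\<in>?B - (*) p ` ?A. moebius_mu d = 0"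
    proof safe
      fix d assume d: "d dvd n" "p dvd d" "d \<notin> (*) p ` ?A"
      then obtain e where e: "d = p * e" by auto
      have "e dvd n" using d(1) e by (meson dvd_mult_right)
      with d e have "p dvd e" by auto
      then have "p ^ 2 dvd d" unfolding e by (auto simp: power2_eq_square)
      then have "\<not> squarefree d" using p(1) not_prime_unit unfolding squarefree_def by metis
      then show "moebius_mu d = 0" by (simp add: moebius_mu_def)
    qed
  qed
  also have "\<dots> = (\<Sum>d\<in>?A. moebius_mu (p * d))"
    using p by (subst sum.reindex) (auto simp: inj_on_def)
  also have "\<dots> = - (\<Sum>d\<in>?A. moebius_mu d)"
    using p by (simp add: moebius_mu_prime_times sum_negf)
  finally have "(\<Sum>d\<in>?A. moebius_mu d) + (\<Sum>d\<in>?B. moebius_mu d) = 0" by simp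
  moreover have "(\<Sum>d | d dvd n. moebius_mu d) = (\<Sum>d\<in>?A \<union> ?B. moebius_mu d)"
    by (rule sum.cong) auto
  moreover have "\<dots> = (\<Sum>d\<in>?A. moebius_mu d) + (\<Sum>d\<in>?B. moebius_mu d)"
    using assms by (intro sum.union_disjoint) auto
  ultimately show ?thesis using False by simp
qed simp

text \<open>
  The neutral element of the convolution.
\<close>

definition dirichlet_one :: "nat \<Rightarrow> real" where
  "dirichlet_one n = (if n = 1 then 1 else 0)"

lemma dconv_dirichlet_one: "n > 0 \<Longrightarrow> dconv dirichlet_one f n = f n"
  by (simp add: dconv_def dirichlet_one_def if_distribR if_distrib [of "\<lambda>x. x * _"] sum.delta cong: if_cong)

section \<open>Selberg's formula\<close>

text \<open>
  On each unit interval the mean value theorem compares the increment of the primitive \<open>F\<close> with the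
  values of \<open>f\<close> at the two ends.
\<close>

lemma sum_increasing_bounds:
  fixes f F :: "real \<Rightarrow> real"
  assumes deriv: "\<And>x. x \<ge> 1 \<Longrightarrow> (F has_real_derivative f x) (at x)"
    and mono: "\<And>x y. 1 \<le> x \<Longrightarrow> x \<le> y \<Longrightarrow> f x \<le> f y"
    and n: "n \<ge> 1"
  shows "F n - F 1 + f 1 \<le> (\<Sum>m=1..n. f (real m))"
    and "(\<Sum>m=1..n. f (real m)) \<le> F n - F 1 + f n"
proof -
  have incr: "f k \<le> F (Suc k) - F k \<and> F (Suc k) - F k \<le> f (Suc k)" if "k \<ge> 1" for k
  proof -
    have "\<exists>z>real k. z < real (Suc k) \<and>
        F (real (Suc k)) - F (real k) = (real (Suc k) - real k) * f z"
      using that by (intro MVT2) (auto intro!: deriv)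
    then obtain z where "real k < z" "z < real (Suc k)" "F (real (Suc k)) - F (real k) = f z"
      by auto
    then show ?thesis using that by (auto intro!: mono)
  qed
  have "F n - F 1 + f 1 \<le> (\<Sum>m=1..n. f (real m)) \<and> (\<Sum>m=1..n. f (real m)) \<le> F n - F 1 + f n"
    using n
  proof (induction n rule: dec_induct)
    case (step k)
    with incr[of k] show ?case by auto
  qed auto
  then show "F n - F 1 + f 1 \<le> (\<Sum>m=1..n. f (real m))"
    and "(\<Sum>m=1..n. f (real m)) \<le> F n - F 1 + f n" by auto
qed

text \<open>
  The steps of \<open>a\<close> are absolutely summable because those of \<open>b\<close> telescope, and the steps after \<open>n\<close>
  add up to at most \<open>b n\<close>. The constants in the asymptotic expansions of the elementary sums below all
  come from this lemma.
\<close>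

lemma telescoping_limit:
  fixes a b :: "nat \<Rightarrow> real"
  assumes step: "\<And>n. n \<ge> 1 \<Longrightarrow> \<bar>a (Suc n) - a n\<bar> \<le> b n - b (Suc n)"
    and lim: "b \<longlonglongrightarrow> 0"
  shows "\<exists>c. \<forall>n\<ge>1. \<bar>a n - c\<bar> \<le> b n"
proof -
  have diff: "\<bar>a m - a n\<bar> \<le> b n - b m" if "1 \<le> n" "n \<le> m" for m n
    using that(2)
  proof (induction m rule: dec_induct)
    case (step k)
    then show ?case using assms(1)[of k] that(1) by auto
  qed auto
  have "Cauchy a"
  proof (rule CauchyI)
    fix e :: real assume "e > 0"
    then obtain N where N: "\<And>n. n \<ge> N \<Longrightarrow> \<bar>b n\<bar> < e / 2"
      using lim[unfolded LIMSEQ_iff, rule_format, of "e / 2"] by auto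
    have "norm (a m - a n) < e" if "m \<ge> max 1 N" "n \<ge> max 1 N" for m n
    proof (cases "m \<le> n")
      case True
      then show ?thesis using diff[of m n] N[of m] N[of n] that by (auto simp: abs_minus_commute)
    next
      case False
      then show ?thesis using diff[of n m] N[of m] N[of n] that by (auto simp: abs_minus_commute)
    qed
    then show "\<exists>M. \<forall>m\<ge>M. \<forall>n\<ge>M. norm (a m - a n) < e" by blast
  qed
  then obtain c where c: "a \<longlonglongrightarrow> c" by (auto simp: Cauchy_convergent_iff convergent_def)
  have "\<bar>a n - c\<bar> \<le> b n" if "n \<ge> 1" for n
  proof (rule tendsto_le[OF trivial_limit_sequentially])
    show "(\<lambda>m. b n - b m) \<longlonglongrightarrow> b n" using tendsto_diff[OF tendsto_const lim] by simp
    show "(\<lambda>m. \<bar>a n - a m\<bar>) \<longlonglongrightarrow> \<bar>a n - c\<bar>" by (intro tendsto_intros c)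
    show "\<forall>\<^sub>F m in sequentially. \<bar>a n - a m\<bar> \<le> b n - b m"
      using eventually_ge_at_top[of n] by eventually_elim (use diff[OF that] in \<open>simp add: abs_minus_commute\<close>)
  qed
  then show ?thesis by blast
qed

lemma ln_le_sqrt: "y > 0 \<Longrightarrow> ln y \<le> 2 * sqrt y"
  using ln_le_minus_one[of "sqrt y"] by (simp add: ln_sqrt)

lemma ln_squared_le_sqrt:
  assumes "y \<ge> 1" shows "(ln y)\<^sup>2 \<le> 16 * sqrt y"
proof -
  have "ln y \<le> 4 * sqrt (sqrt y)" "ln y \<ge> 0"
    using ln_le_sqrt[of "sqrt y"] assms by (auto simp: ln_sqrt)
  then have "(ln y)\<^sup>2 \<le> (4 * sqrt (sqrt y))\<^sup>2" by (intro power_mono)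
  then show ?thesis using assms by (simp add: power_mult_distrib)
qed

lemma ln_Suc_diff_bounds:
  assumes "n \<ge> 1"
  shows "1 / real (Suc n) \<le> ln (real (Suc n)) - ln (real n)"
    and "ln (real (Suc n)) - ln (real n) \<le> 1 / real n"
proof -
  have "ln (real n) - ln (real (Suc n)) = ln (real n / real (Suc n))"
    using assms by (simp add: ln_div)
  also have "\<dots> \<le> real n / real (Suc n) - 1" using assms by (intro ln_le_minus_one) auto
  also have "\<dots> = - (1 / real (Suc n))" by (simp add: field_simps)
  finally show "1 / real (Suc n) \<le> ln (real (Suc n)) - ln (real n)" by simp
  have "ln (real (Suc n)) - ln (real n) = ln (real (Suc n) / real n)"
    using assms by (simp add: ln_div)
  also have "\<dots> \<le> real (Suc n) / real n - 1" using assms by (intro ln_le_minus_one) auto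
  also have "\<dots> = 1 / real n" using assms by (simp add: field_simps)
  finally show "ln (real (Suc n)) - ln (real n) \<le> 1 / real n" .
qed

lemma harmonic_asymp:
  "\<exists>g. \<forall>n\<ge>1. \<bar>(\<Sum>m=1..n. 1 / real m) - ln n - g\<bar> \<le> 1 / real n"
proof -
  have "\<exists>c. \<forall>n\<ge>1. \<bar>((\<Sum>m=1..n. 1 / real m) - ln n) - c\<bar> \<le> 1 / real n"
  proof (rule telescoping_limit)
    fix n :: nat assume n: "n \<ge> 1"
    show "\<bar>(\<Sum>m=1..Suc n. 1 / real m) - ln (Suc n) - ((\<Sum>m=1..n. 1 / real m) - ln n)\<bar>
        \<le> 1 / real n - 1 / real (Suc n)"
      using ln_Suc_diff_bounds[OF n] by simp
  qed (rule lim_1_over_n)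
  then show ?thesis by simp
qed

lemma sum_ln_over_asymp:
  "\<exists>g. \<forall>n\<ge>1. \<bar>(\<Sum>m=1..n. ln (real m) / real m) - (ln n)\<^sup>2 / 2 - g\<bar> \<le> 6 / sqrt (real n)"
proof -
  have "\<exists>c. \<forall>n\<ge>1. \<bar>((\<Sum>m=1..n. ln (real m) / real m) - (ln n)\<^sup>2 / 2) - c\<bar> \<le> 6 / sqrt (real n)"
  proof (rule telescoping_limit)
    fix n :: nat assume n: "n \<ge> 1"
    define A B s t where "A = ln (real (Suc n))" and "B = ln (real n)"
      and "s = sqrt (real n)" and "t = sqrt (real (Suc n))"
    have s: "s \<ge> 1" "t > s" "s\<^sup>2 = n" "t\<^sup>2 = n + 1" using n by (auto simp: s_def t_def)
    have AB: "1 / (n + 1) \<le> A - B" "A - B \<le> 1 / n" "0 \<le> B" "0 \<le> A" "B \<le> A"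
      using ln_Suc_diff_bounds[OF n] n by (auto simp: A_def B_def)
    have eq: "(A\<^sup>2 - B\<^sup>2) / 2 = (A + B) / 2 * (A - B)" by (simp add: power2_eq_square algebra_simps)
    have "(A + B) / 2 * (A - B) \<le> A * (1 / n)"
      using AB n by (intro mult_mono) (auto intro: order_trans[rotated])
    moreover have "B * (1 / (n + 1)) \<le> (A + B) / 2 * (A - B)"
      using AB n by (intro mult_mono) (auto intro: order_trans[rotated])
    ultimately have "\<bar>A / (n + 1) - (A\<^sup>2 - B\<^sup>2) / 2\<bar> \<le> max (A / n - A / (n + 1)) (A / (n + 1) - B / (n + 1))"
      unfolding eq by (simp only: abs_le_iff le_max_iff_disj) argo
    also have "A / n - A / (n + 1) = A / (n * (n + 1))"
      using n by (simp add: field_simps)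
    also have "A / (n + 1) - B / (n + 1) = (A - B) / (n + 1)" by (simp add: diff_divide_distrib)
    also have "\<dots> \<le> (1 / n) / (n + 1)" using AB by (intro divide_right_mono) auto
    also have "\<dots> = 1 / (n * (n + 1))" by (simp add: algebra_simps)
    also have "max (A / (n * (n + 1))) (1 / (n * (n + 1))) \<le> (A + 1) / (n * (n + 1))"
      using AB n by (auto intro!: divide_right_mono)
    finally have 1: "\<bar>A / (n + 1) - (A\<^sup>2 - B\<^sup>2) / 2\<bar> \<le> (A + 1) / (n * (n + 1))"
      by (simp add: max_def split: if_splits)
    have "A \<le> 2 * (t - 1)"
      using ln_le_minus_one[of t] s by (simp add: A_def t_def ln_sqrt)
    also have "t \<le> s + 1" using s by (intro power2_le_imp_le[of t "s + 1"]) (auto simp: power2_sum)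
    finally have "A + 1 \<le> 3 * s" using s by simp
    then have "(A + 1) / (n * (n + 1)) \<le> 3 * s / (n * (n + 1))"
      by (intro divide_right_mono) auto
    also have "\<dots> = 3 / (s * t\<^sup>2)"
    proof -
      have eq: "real n * (real n + 1) = s * (s * t\<^sup>2)"
        unfolding s(4) using s(3) by (simp add: power2_eq_square mult.assoc [symmetric])
      have "s \<noteq> 0" using s by simp
      then show ?thesis unfolding of_nat_mult of_nat_add of_nat_1 eq by simp
    qed
    also have "\<dots> \<le> 6 / (s * t * (s + t))"
    proof -
      have "s * t * (s + t) \<le> s * t * (t + t)" using s(1,2) by (intro mult_left_mono) auto
      also have "\<dots> = 2 * (s * t\<^sup>2)" by (simp add: power2_eq_square)
      finally have "6 / (2 * (s * t\<^sup>2)) \<le> 6 / (s * t * (s + t))"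
        using s(1,2) by (intro divide_left_mono) auto
      then show ?thesis by simp
    qed
    also have "\<dots> = 6 / s - 6 / t"
    proof -
      have "6 / s - 6 / t = 6 * (t - s) / (s * t)" using s by (simp add: field_simps)
      also have "\<dots> = 6 * ((t - s) * (s + t)) / (s * t * (s + t))" using s by simp
      also have "(t - s) * (s + t) = 1" using s(3,4) by (simp add: power2_eq_square algebra_simps)
      finally show ?thesis by simp
    qed
    finally have 2: "(A + 1) / (n * (n + 1)) \<le> 6 / s - 6 / t" .
    have "(\<Sum>m=1..Suc n. ln (real m) / real m) - A\<^sup>2 / 2 - ((\<Sum>m=1..n. ln (real m) / real m) - B\<^sup>2 / 2)
        = A / (n + 1) - (A\<^sup>2 - B\<^sup>2) / 2"
      by (simp add: A_def diff_divide_distrib add.commute)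
    then show "\<bar>(\<Sum>m=1..Suc n. ln (real m) / real m) - (ln (Suc n))\<^sup>2 / 2 -
          ((\<Sum>m=1..n. ln (real m) / real m) - (ln n)\<^sup>2 / 2)\<bar> \<le> 6 / sqrt (real n) - 6 / sqrt (real (Suc n))"
      using order_trans[OF 1 2] unfolding A_def [symmetric] B_def [symmetric] s_def [symmetric] t_def [symmetric]
      by (simp only:)
  qed real_asymp
  then show ?thesis by simp
qed

lemma sum_ln_bounds:
  assumes "n \<ge> 1"
  shows "\<bar>(\<Sum>m=1..n. ln (real m)) - (n * ln n - n)\<bar> \<le> 1 + ln n"
proof -
  have d: "((\<lambda>x::real. x * ln x - x) has_real_derivative ln x) (at x)" if "x \<ge> 1" for x :: real
    using that by (auto intro!: derivative_eq_intros)
  show ?thesis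
    using sum_increasing_bounds[OF d, of n] assms by auto
qed

lemma sum_ln_squared_bounds:
  assumes "n \<ge> 1" "real n \<le> y" "y \<le> real n + 1"
  shows "\<bar>(\<Sum>m=1..n. (ln (real m))\<^sup>2) - (y * (ln y)\<^sup>2 - 2 * y * ln y + 2 * y)\<bar> \<le> 34 * sqrt y"
proof -
  define F where "F = (\<lambda>y::real. y * (ln y)\<^sup>2 - 2 * y * ln y + 2 * y)"
  have d: "(F has_real_derivative (ln x)\<^sup>2) (at x)" if "x \<ge> 1" for x :: real
    unfolding F_def using that by (auto intro!: derivative_eq_intros simp: power2_eq_square)
  have m: "(ln x)\<^sup>2 \<le> (ln z)\<^sup>2" if "1 \<le> x" "x \<le> z" for x z :: real
    using that by (intro power_mono) auto
  have 1: "\<bar>(\<Sum>m=1..n. (ln (real m))\<^sup>2) - F n\<bar> \<le> 2 + (ln n)\<^sup>2"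
    using sum_increasing_bounds[OF d m, of n] assms(1) by (simp add: F_def)
  have 2: "\<bar>F y - F n\<bar> \<le> (ln y)\<^sup>2"
  proof (cases "real n = y")
    case False
    with assms have "real n < y" by simp
    then have "\<exists>z>real n. z < y \<and> F y - F n = (y - n) * (ln z)\<^sup>2"
      using assms by (intro MVT2 d) auto
    then obtain z where z: "real n < z" "z < y" "F y - F n = (y - n) * (ln z)\<^sup>2" by auto
    have "(y - n) * (ln z)\<^sup>2 \<le> 1 * (ln y)\<^sup>2"
      using assms z by (intro mult_mono m) auto
    then show ?thesis using z assms by simp
  qed auto
  have "(ln n)\<^sup>2 \<le> (ln y)\<^sup>2" using assms by (intro m) auto
  moreover have "(ln y)\<^sup>2 \<le> 16 * sqrt y" using assms by (intro ln_squared_le_sqrt) auto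
  moreover have "sqrt y \<ge> 1" using assms by simp
  ultimately show ?thesis using 1 2 unfolding F_def by linarith
qed

lemma sum_inverse_sqrt_le:
  "(\<Sum>m=1..n. 1 / sqrt (real m)) \<le> 2 * sqrt (real n)"
proof (induction n)
  case (Suc n)
  have "1 / sqrt (real (Suc n)) \<le> 2 * (sqrt (real (Suc n)) - sqrt (real n))"
  proof -
    define s t where "s = sqrt (real n)" and "t = sqrt (real (Suc n))"
    have st: "0 \<le> s" "s \<le> t" "t > 0" "t\<^sup>2 - s\<^sup>2 = 1" by (auto simp: s_def t_def)
    have "1 = (t - s) * (t + s)" using st(4) by (simp add: power2_eq_square algebra_simps)
    also have "\<dots> \<le> (t - s) * (2 * t)" using st by (intro mult_left_mono) auto
    finally have "1 \<le> 2 * (t - s) * t" by (simp add: mult_ac)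
    then have "1 / t \<le> 2 * (t - s)" using st by (simp add: divide_le_eq)
    then show ?thesis by (simp add: s_def t_def)
  qed
  then show ?case using Suc by simp
qed simp

abbreviation Lam :: "nat \<Rightarrow> real" where "Lam \<equiv> mangoldt"

text \<open>
  The coefficients of the Dirichlet series \<open>\<zeta>'' / \<zeta>\<close>. They are nonnegative, and their convolution with
  \<open>1\<close> is \<open>ln\<^sup>2\<close>.
\<close>

definition lambda2 :: "nat \<Rightarrow> real" where
  "lambda2 n = ln (real n) * Lam n + dconv Lam Lam n"

lemma lambda2_nonneg: "lambda2 n \<ge> 0"
  unfolding lambda2_def dconv_def
  by (cases "n = 0") (auto intro!: add_nonneg_nonneg mult_nonneg_nonneg sum_nonneg mangoldt_nonneg)

lemma dconv_cong:
  assumes "n > 0" "\<And>m. m > 0 \<Longrightarrow> f m = f' m" "\<And>m. m > 0 \<Longrightarrow> g m = g' m"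
  shows "dconv f g n = dconv f' g' n"
  unfolding dconv_def
proof (intro sum.cong refl)
  fix d assume "d \<in> {d. d dvd n}"
  with assms(1) have "d > 0" "n div d > 0" by (auto simp: dvd_div_eq_0_iff dvd_pos_nat intro: Nat.gr0I)
  with assms show "f d * g (n div d) = f' d * g' (n div d)" by simp
qed

lemma dconv_Lam_one: "n > 0 \<Longrightarrow> dconv Lam (\<lambda>_. 1) n = ln (real n)"
  using mangoldt_sum[of n, where ?'a = real] by (simp add: dconv_def)

lemma dconv_mu_one: "n > 0 \<Longrightarrow> dconv moebius_mu (\<lambda>_. 1) n = dirichlet_one n"
  using sum_moebius_mu[of n] by (simp add: dconv_def dirichlet_one_def)

lemma dconv_lambda2_one:
  assumes "n > 0" shows "dconv lambda2 (\<lambda>_. 1) n = (ln (real n))\<^sup>2"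
proof -
  have "(ln (real n))\<^sup>2 = ln (real n) * dconv Lam (\<lambda>_. 1) n"
    using assms by (simp add: dconv_Lam_one power2_eq_square)
  also have "\<dots> = dconv (\<lambda>d. ln (real d) * Lam d) (\<lambda>_. 1) n + dconv Lam (\<lambda>d. ln (real d) * 1) n"
    by (rule dconv_ln)
  also have "dconv Lam (\<lambda>d. ln (real d) * 1) n = dconv Lam (dconv Lam (\<lambda>_. 1)) n"
    using assms by (intro dconv_cong) (auto simp: dconv_Lam_one)
  also have "\<dots> = dconv (dconv Lam Lam) (\<lambda>_. 1) n" by (simp add: dconv_assoc)
  also have "dconv (\<lambda>d. ln (real d) * Lam d) (\<lambda>_. 1) n + \<dots> = dconv lambda2 (\<lambda>_. 1) n"
    unfolding lambda2_def by (rule dconv_add_left [symmetric])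
  finally show ?thesis ..
qed

lemma dconv_mu_cancel:
  assumes "n > 0" shows "dconv moebius_mu (dconv (\<lambda>_. 1) f) n = f n"
proof -
  have "dconv moebius_mu (dconv (\<lambda>_. 1) f) n = dconv (dconv moebius_mu (\<lambda>_. 1)) f n"
    by (simp add: dconv_assoc)
  also have "\<dots> = dconv dirichlet_one f n"
    using assms by (intro dconv_cong) (auto simp: dconv_mu_one)
  finally show ?thesis using assms by (simp add: dconv_dirichlet_one)
qed

lemma lambda2_eq: "n > 0 \<Longrightarrow> lambda2 n = dconv moebius_mu (\<lambda>m. (ln (real m))\<^sup>2) n"
  using dconv_mu_cancel[of n lambda2] dconv_lambda2_one
  by (subst dconv_cong[of n moebius_mu moebius_mu "\<lambda>m. (ln (real m))\<^sup>2" "dconv (\<lambda>_. 1) lambda2"])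
    (auto simp: dconv_commute[of _ lambda2])

text \<open>
  Grouped by \<open>n = d * m\<close>, the terms with \<open>n > 1\<close> cancel.
\<close>

lemma moebius_inversion_sum:
  fixes F :: "real \<Rightarrow> real"
  assumes "x \<ge> 1"
  shows "(\<Sum>d=1..x. moebius_mu d * (\<Sum>m=1..x div d. F (real x / real d / real m))) = F x"
proof -
  have "(\<Sum>d=1..x. moebius_mu d * (\<Sum>m=1..x div d. F (real x / real d / real m))) =
      (\<Sum>d=1..x. \<Sum>m=1..x div d. moebius_mu d * F (real x / (real (d * m))))"
    by (simp add: sum_distrib_left)
  also have "\<dots> = (\<Sum>n=1..x. \<Sum>d | d dvd n. moebius_mu d * F (real x / real (d * (n div d))))"
    by (rule sum_divisors_swap [symmetric])
  also have "\<dots> = (\<Sum>n=1..x. (\<Sum>d | d dvd n. moebius_mu d) * F (real x / real n))"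
    by (simp add: sum_distrib_right)
  also have "\<dots> = (\<Sum>n=1..x. if n = 1 then F x else 0)"
    by (intro sum.cong refl) (auto simp: sum_moebius_mu)
  finally show ?thesis using assms by simp
qed

text \<open>
  Both sums have an expansion in \<open>y ln\<^sup>2 y\<close>, \<open>y ln y\<close>, \<open>y\<close> with error \<open>O(sqrt y)\<close>. The
  coefficient \<open>2\<close> matches the leading terms, and \<open>c1\<close>, \<open>c2\<close> are solved for so that the other two agree
  as well. The second sum has the shape to which \<open>moebius_inversion_sum\<close> applies.
\<close>

lemma selberg_kernel:
  "\<exists>c1 c2 C. \<forall>n\<ge>1. \<forall>y. real n \<le> y \<and> y \<le> real n + 1 \<longrightarrow>
     \<bar>(\<Sum>m=1..n. (ln (real m))\<^sup>2) -
       (\<Sum>m=1..n. 2 * (y / real m) * ln (y / real m) + c1 * (y / real m) + c2)\<bar> \<le> C * sqrt y"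
proof -
  obtain g where g: "\<And>n. n \<ge> 1 \<Longrightarrow> \<bar>(\<Sum>m=1..n. 1 / real m) - ln n - g\<bar> \<le> 1 / real n"
    using harmonic_asymp by blast
  obtain g1 where g1: "\<And>n. n \<ge> 1 \<Longrightarrow>
      \<bar>(\<Sum>m=1..n. ln (real m) / real m) - (ln n)\<^sup>2 / 2 - g1\<bar> \<le> 6 / sqrt (real n)"
    using sum_ln_over_asymp by blast
  define c1 where "c1 = - 2 - 2 * g"
  define c2 where "c2 = 2 + 2 * g1 - c1 * g"
  have main: "\<bar>(\<Sum>m=1..n. (ln (real m))\<^sup>2) -
       (\<Sum>m=1..n. 2 * (y / real m) * ln (y / real m) + c1 * (y / real m) + c2)\<bar>
       \<le> (82 + 4 * \<bar>c1\<bar> + \<bar>c2\<bar>) * sqrt y"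
    if n: "n \<ge> 1" and y: "real n \<le> y" "y \<le> real n + 1" for n y
  proof -
    define H1 H2 L where "H1 = (\<Sum>m=1..n. 1 / real m)"
      and "H2 = (\<Sum>m=1..n. ln (real m) / real m)" and "L = ln y"
    have y1: "y \<ge> 1" using n y by simp
    have Ln: "0 \<le> ln (real n)" "ln (real n) \<le> L" "L - ln n \<le> 1 / n" "0 \<le> L"
    proof -
      have "L - ln n = ln (y / n)" using y1 n by (simp add: ln_div L_def)
      also have "\<dots> \<le> y / n - 1" using n y by (intro ln_le_minus_one) auto
      also have "y / n - 1 = (y - n) / n" using n by (simp add: field_simps)
      also have "\<dots> \<le> 1 / n" using y by (intro divide_right_mono) auto
      finally show "L - ln n \<le> 1 / n" .
    qed (use n y in \<open>auto simp: L_def\<close>)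
    have sq: "sqrt y \<ge> 1" "sqrt y * sqrt y = y" using y1 by auto
    have y2n: "y / n \<le> 2" using n y by (simp add: field_simps)
    define e1 where "e1 = H1 - L - g"
    have "\<bar>e1\<bar> \<le> 1 / n + 1 / n"
      using g[OF n] Ln unfolding e1_def H1_def by linarith
    then have "\<bar>e1\<bar> * y \<le> (1 / n + 1 / n) * y" using y1 by (intro mult_right_mono) auto
    also have "\<dots> = 2 * (y / n)" by (simp add: field_simps)
    also have "\<dots> \<le> 4" using y2n by simp
    finally have ye1: "\<bar>y * e1\<bar> \<le> 4" using y1 by (simp add: abs_mult mult.commute)
    have L_le: "L \<le> 2 * sqrt y" using y1 by (simp add: L_def ln_le_sqrt)
    have "\<bar>y * e1\<bar> * L \<le> 4 * L" using ye1 Ln by (intro mult_right_mono) auto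
    then have yLe1: "\<bar>y * L * e1\<bar> \<le> 8 * sqrt y" using L_le Ln by (simp add: abs_mult mult_ac)
    define e2 where "e2 = H2 - L\<^sup>2 / 2 - g1"
    have "(L\<^sup>2 - (ln n)\<^sup>2) / 2 = ((L + ln n) / 2) * (L - ln n)"
      by (simp add: power2_eq_square algebra_simps)
    also have "\<dots> \<le> L * (1 / n)" using Ln by (intro mult_mono) auto
    also have "\<dots> = L / n" by simp
    finally have dL: "(L\<^sup>2 - (ln n)\<^sup>2) / 2 \<le> L / n" .
    have "\<bar>e2\<bar> \<le> 6 / sqrt n + L / n"
    proof -
      have aux: "\<bar>S - b / 2 - c\<bar> \<le> p + q"
        if "\<bar>S - a / 2 - c\<bar> \<le> p" "(b - a) / 2 \<le> q" "a \<le> b" for S a b c p q :: real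
        using that unfolding abs_le_iff by (simp add: field_simps)
      show ?thesis
        unfolding e2_def H2_def using power_mono[OF Ln(2,1), of 2] dL by (intro aux[OF g1[OF n]])
    qed
    then have "y * \<bar>e2\<bar> \<le> y * (6 / sqrt n + L / n)" using y1 by (intro mult_left_mono) auto
    also have "\<dots> = 6 * (sqrt y * sqrt (y / n)) + L * (y / n)"
      using sq(2) by (simp add: real_sqrt_divide field_simps)
    also have "\<dots> \<le> 6 * (sqrt y * 2) + L * 2"
    proof -
      have "sqrt (y / n) \<le> sqrt 4" using y2n by (intro real_sqrt_le_mono) auto
      then show ?thesis using y2n Ln sq by (intro add_mono mult_left_mono) auto
    qed
    finally have ye2: "\<bar>y * e2\<bar> \<le> 16 * sqrt y" using L_le y1 by (simp add: abs_mult)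
    have P: "\<bar>(\<Sum>m=1..n. (ln (real m))\<^sup>2) - (y * L\<^sup>2 - 2 * y * L + 2 * y)\<bar> \<le> 34 * sqrt y"
      unfolding L_def by (rule sum_ln_squared_bounds[OF n y])
    have "(\<Sum>m=1..n. 2 * (y / real m) * ln (y / real m) + c1 * (y / real m) + c2) =
        (\<Sum>m=1..n. 2 * y * L * (1 / real m) - 2 * y * (ln (real m) / real m) + c1 * y * (1 / real m) + c2)"
      using y1 by (intro sum.cong refl) (auto simp: ln_div L_def field_simps)
    also have "\<dots> = 2 * y * L * H1 - 2 * y * H2 + c1 * y * H1 + c2 * n"
      by (simp only: sum.distrib sum_subtractf sum_distrib_left [symmetric] H1_def H2_def) simp
    also have "\<dots> = (y * L\<^sup>2 - 2 * y * L + 2 * y) + 2 * (y * L * e1) - 2 * (y * e2) + c1 * (y * e1)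
        - c2 * (y - n)"
    proof -
      have h: "H1 = L + g + e1" "H2 = L\<^sup>2 / 2 + g1 + e2" by (simp_all add: e1_def e2_def)
      show ?thesis unfolding h c2_def c1_def by (simp add: power2_eq_square algebra_simps)
    qed
    finally have "\<bar>(\<Sum>m=1..n. (ln (real m))\<^sup>2) -
        (\<Sum>m=1..n. 2 * (y / real m) * ln (y / real m) + c1 * (y / real m) + c2)\<bar>
        \<le> 34 * sqrt y + 2 * \<bar>y * L * e1\<bar> + 2 * \<bar>y * e2\<bar> + \<bar>c1 * (y * e1)\<bar> + \<bar>c2 * (y - n)\<bar>"
      using P by linarith
    also have "\<bar>c1 * (y * e1)\<bar> \<le> \<bar>c1\<bar> * (4 * sqrt y)"
      unfolding abs_mult[of c1] using ye1 sq(1) by (intro mult_left_mono) linarith+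
    also have "\<bar>c2 * (y - n)\<bar> \<le> \<bar>c2\<bar> * sqrt y"
      unfolding abs_mult[of c2] using y sq(1) by (intro mult_left_mono) linarith+
    finally show ?thesis using yLe1 ye2 by (simp add: algebra_simps)
  qed
  then show ?thesis by blast
qed

lemma real_div_bounds:
  assumes "d \<ge> 1" "d \<le> x"
  shows "x div d \<ge> 1" "real (x div d) \<le> real x / real d" "real x / real d \<le> real (x div d) + 1"
proof -
  show "x div d \<ge> 1" using assms by (simp add: Suc_le_eq div_greater_zero_iff)
  show "real (x div d) \<le> real x / real d" by (rule of_nat_div_le_of_nat)
  have "x \<le> (x div d + 1) * d" using assms
    by (metis Suc_eq_plus1 add_mult_distrib div_mult_mod_eq less_imp_le mod_less_divisor mult_1
      nat_add_left_cancel_le order_less_le_trans zero_less_one)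
  then have "real x \<le> (real (x div d) + 1) * real d"
    by (metis of_nat_1 of_nat_add of_nat_le_iff of_nat_mult)
  then show "real x / real d \<le> real (x div d) + 1" using assms by (simp add: divide_le_eq)
qed

lemma sum_sqrt_div_le: "(\<Sum>d=1..x. sqrt (real x / real d)) \<le> 2 * real x"
proof -
  have "(\<Sum>d=1..x. sqrt (real x / real d)) = sqrt (real x) * (\<Sum>d=1..x. 1 / sqrt (real d))"
    by (simp add: sum_distrib_left real_sqrt_divide)
  also have "\<dots> \<le> sqrt (real x) * (2 * sqrt (real x))"
    by (intro mult_left_mono sum_inverse_sqrt_le) auto
  also have "\<dots> = 2 * (sqrt (real x) * sqrt (real x))" by (simp only: mult_ac)
  also have "\<dots> = 2 * real x" by simp
  finally show ?thesis .
qed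

text \<open>
  By inversion \<open>lambda2 = \<mu> * ln\<^sup>2\<close>, so the sum of \<open>lambda2\<close> is a sum of \<open>\<mu>(d)\<close> against sums of
  \<open>ln\<^sup>2\<close> up to \<open>x / d\<close>. Replacing the latter by the kernel costs \<open>O(sqrt (x / d))\<close> for each \<open>d\<close>,
  which adds up to \<open>O(x)\<close>, and the kernel sums collapse to \<open>2 x ln x + O(x)\<close> by Moebius inversion.
\<close>

theorem selberg_formula:
  "\<exists>C. \<forall>x\<ge>1. \<bar>(\<Sum>n=1..x. lambda2 n) - (\<Sum>n=1..x. 2 * ln (real n))\<bar> \<le> C * real x"
proof -
  obtain c1 c2 C where C: "\<And>n y. n \<ge> 1 \<Longrightarrow> real n \<le> y \<Longrightarrow> y \<le> real n + 1 \<Longrightarrow>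
     \<bar>(\<Sum>m=1..n. (ln (real m))\<^sup>2) -
       (\<Sum>m=1..n. 2 * (y / real m) * ln (y / real m) + c1 * (y / real m) + c2)\<bar> \<le> C * sqrt y"
    using selberg_kernel by blast
  define F where "F = (\<lambda>y. 2 * y * ln y + c1 * y + c2)"
  have main: "\<bar>(\<Sum>n=1..x. lambda2 n) - (\<Sum>n=1..x. 2 * ln (real n))\<bar>
      \<le> (2 * C + \<bar>c1\<bar> + \<bar>c2\<bar> + 6) * real x" if x: "x \<ge> 1" for x
  proof -
    have "(\<Sum>n=1..x. lambda2 n) = (\<Sum>n=1..x. dconv moebius_mu (\<lambda>m. (ln (real m))\<^sup>2) n)"
      by (intro sum.cong) (auto simp: lambda2_eq)
    also have "\<dots> = (\<Sum>d=1..x. moebius_mu d * (\<Sum>m=1..x div d. (ln (real m))\<^sup>2))"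
      by (rule sum_dconv)
    finally have "(\<Sum>n=1..x. lambda2 n) - F x =
        (\<Sum>d=1..x. moebius_mu d * ((\<Sum>m=1..x div d. (ln (real m))\<^sup>2) -
          (\<Sum>m=1..x div d. F (real x / real d / real m))))"
      using moebius_inversion_sum[OF x, of F] by (simp add: right_diff_distrib sum_subtractf)
    also have "\<bar>\<dots>\<bar> \<le> (\<Sum>d=1..x. C * sqrt (real x / real d))"
    proof (intro order_trans[OF sum_abs] sum_mono)
      fix d assume "d \<in> {1..x}"
      then have d: "d \<ge> 1" "d \<le> x" by auto
      have "\<bar>moebius_mu d\<bar> * \<bar>(\<Sum>m=1..x div d. (ln (real m))\<^sup>2) -
          (\<Sum>m=1..x div d. F (real x / real d / real m))\<bar> \<le> 1 * (C * sqrt (real x / real d))"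
        using C[OF real_div_bounds[OF d]] by (intro mult_mono abs_moebius_mu_le) (auto simp: F_def)
      then show "\<bar>moebius_mu d * ((\<Sum>m=1..x div d. (ln (real m))\<^sup>2) -
          (\<Sum>m=1..x div d. F (real x / real d / real m)))\<bar> \<le> C * sqrt (real x / real d)"
        by (simp add: abs_mult)
    qed
    also have "\<dots> \<le> C * (2 * real x)"
    proof -
      \<comment> \<open>At \<open>y = 1\<close> the kernel estimate shows that \<open>C\<close> is nonnegative.\<close>
      have "\<bar>- (c1 + c2)\<bar> \<le> C" using C[of 1 1] by simp
      then have "C \<ge> 0" by linarith
      then show ?thesis using sum_sqrt_div_le[of x]
        by (simp only: sum_distrib_left [symmetric]) (intro mult_left_mono, auto)
    qed
    finally have 1: "\<bar>(\<Sum>n=1..x. lambda2 n) - F x\<bar> \<le> 2 * C * real x" by simp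
    have x1: "real x \<ge> 1" using x by simp
    have 2: "\<bar>(\<Sum>n=1..x. 2 * ln (real n)) - 2 * (x * ln x - x)\<bar> \<le> 2 * (1 + ln x)"
    proof -
      have "(\<Sum>n=1..x. 2 * ln (real n)) - 2 * (x * ln x - x)
          = 2 * ((\<Sum>n=1..x. ln (real n)) - (x * ln x - x))"
        by (simp add: sum_distrib_left)
      then show ?thesis using sum_ln_bounds[OF x] by (simp add: abs_mult)
    qed
    have 3: "ln (real x) \<le> real x - 1" using x by (intro ln_le_minus_one) auto
    have 4: "\<bar>c1 * x + c2\<bar> \<le> (\<bar>c1\<bar> + \<bar>c2\<bar>) * x"
    proof -
      have "\<bar>c1 * x + c2\<bar> \<le> \<bar>c1\<bar> * x + \<bar>c2\<bar> * 1" by (simp add: abs_mult abs_triangle_ineq[THEN order_trans])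
      also have "\<dots> \<le> \<bar>c1\<bar> * x + \<bar>c2\<bar> * x" using x1 by (intro add_left_mono mult_left_mono) auto
      finally show ?thesis by (simp add: algebra_simps)
    qed
    show ?thesis using 1 2 3 4 x1 unfolding F_def by (simp add: algebra_simps abs_le_iff)
  qed
  then show ?thesis by blast
qed

section \<open>Real characters and the non-vanishing of L(1)\<close>

text \<open>
  The hyperbola method: the pairs with \<open>d \<le> N\<close> are summed over \<open>m\<close> first, the remaining ones over
  \<open>d\<close> first.
\<close>

lemma sum_hyperbola:
  fixes F :: "nat \<Rightarrow> nat \<Rightarrow> 'a :: comm_monoid_add"
  assumes "N \<le> x"
  shows "(\<Sum>d=1..x. \<Sum>m=1..x div d. F d m) =
    (\<Sum>d=1..N. \<Sum>m=1..x div d. F d m) + (\<Sum>m=1..x div Suc N. \<Sum>d=Suc N..x div m. F d m)"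
proof -
  have "(\<Sum>d=1..x. \<Sum>m=1..x div d. F d m) =
      (\<Sum>d=1..N. \<Sum>m=1..x div d. F d m) + (\<Sum>d=Suc N..x. \<Sum>m=1..x div d. F d m)"
  proof -
    have "{1..x} = {1..N} \<union> {Suc N..x}" using assms by auto
    then show ?thesis by (simp add: sum.union_disjoint)
  qed
  also have "(\<Sum>d=Suc N..x. \<Sum>m=1..x div d. F d m) =
      (\<Sum>(d, m) \<in> (SIGMA d:{Suc N..x}. {1..x div d}). F d m)"
    by (subst sum.Sigma) auto
  also have "\<dots> = (\<Sum>(m, d) \<in> (SIGMA m:{1..x div Suc N}. {Suc N..x div m}). F d m)"
  proof (intro sum.reindex_bij_witness[of _ "\<lambda>(m, d). (d, m)" "\<lambda>(d, m). (m, d)"])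
    fix a assume "a \<in> (SIGMA d:{Suc N..x}. {1..x div d})"
    then obtain d m where a: "a = (d, m)" "Suc N \<le> d" "d \<le> x" "1 \<le> m" "m \<le> x div d" by auto
    then have "m * d \<le> x" by (simp add: less_eq_div_iff_mult_less_eq)
    moreover have "m * Suc N \<le> m * d" using a by (intro mult_le_mono) auto
    ultimately have "m * Suc N \<le> x" by linarith
    then show "(case a of (d, m) \<Rightarrow> (m, d)) \<in> (SIGMA m:{1..x div Suc N}. {Suc N..x div m})"
      using a \<open>m * d \<le> x\<close>
      by (auto simp: less_eq_div_iff_mult_less_eq mult.commute simp del: mult_Suc_right mult_Suc)
  next
    fix a assume "a \<in> (SIGMA m:{1..x div Suc N}. {Suc N..x div m})"
    then obtain d m where a: "a = (m, d)" "Suc N \<le> d" "d \<le> x div m" "1 \<le> m" by auto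
    then have "d * m \<le> x" by (simp add: less_eq_div_iff_mult_less_eq)
    moreover have "d \<le> d * m" using a by simp
    ultimately have "d \<le> x" by linarith
    with \<open>d * m \<le> x\<close> show "(case a of (m, d) \<Rightarrow> (d, m)) \<in> (SIGMA d:{Suc N..x}. {1..x div d})"
      using a by (auto simp: less_eq_div_iff_mult_less_eq mult.commute)
  qed auto
  also have "\<dots> = (\<Sum>m=1..x div Suc N. \<Sum>d=Suc N..x div m. F d m)"
    by (subst sum.Sigma) auto
  finally show ?thesis .
qed

text \<open>
  What the analysis needs to know of a nonprincipal real Dirichlet character: periodicity enters only
  through the boundedness of the partial sums.
\<close>

locale bounded_real_character =
  fixes \<chi> :: "nat \<Rightarrow> real" and K :: real
  assumes mult: "\<chi> (m * n) = \<chi> m * \<chi> n"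
    and one: "\<chi> 1 = 1"
    and vals: "\<chi> n \<in> {-1, 0, 1}"
    and sums: "\<bar>\<Sum>n=1..N. \<chi> n\<bar> \<le> K"
begin

lemma abs_le_1: "\<bar>\<chi> n\<bar> \<le> 1" using vals[of n] by auto

lemma one' [simp]: "\<chi> (Suc 0) = 1" using one by simp

lemma K_nonneg: "K \<ge> 0" using sums[of 0] by simp

lemma sum_bound: "\<bar>\<Sum>n=Suc a..b. \<chi> n\<bar> \<le> 2 * K"
proof (cases "a \<le> b")
  case True
  then have "{1..b} = {1..a} \<union> {Suc a..b}" by auto
  then have "(\<Sum>n=1..b. \<chi> n) = (\<Sum>n=1..a. \<chi> n) + (\<Sum>n=Suc a..b. \<chi> n)"
    by (simp add: sum.union_disjoint)
  then show ?thesis using sums[of a] sums[of b] by linarith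
qed (use K_nonneg in simp)

text \<open>
  Partial summation against decreasing weights.
\<close>

lemma abel_bound:
  fixes w :: "nat \<Rightarrow> real"
  assumes dec: "\<And>n. n > a \<Longrightarrow> w (Suc n) \<le> w n" and nonneg: "\<And>n. n > a \<Longrightarrow> w n \<ge> 0"
  shows "\<bar>\<Sum>n=Suc a..b. \<chi> n * w n\<bar> \<le> 2 * K * w (Suc a)"
proof (cases "b > a")
  case True
  define S where "S = (\<lambda>b. \<Sum>n=Suc a..b. \<chi> n)"
  have "\<bar>(\<Sum>n=Suc a..b. \<chi> n * w n) - S b * w b\<bar> \<le> 2 * K * (w (Suc a) - w b)"
    using Suc_leI[OF True]
  proof (induction b rule: dec_induct)
    case base
    then show ?case by (simp add: S_def)
  next
    case (step b)
    have "\<bar>S b * (w b - w (Suc b))\<bar> \<le> 2 * K * (w b - w (Suc b))"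
      using sum_bound[of a b] dec[of b] step.hyps
      unfolding abs_mult S_def by (intro mult_mono) auto
    moreover have "(\<Sum>n=Suc a..Suc b. \<chi> n * w n) - S (Suc b) * w (Suc b) =
        ((\<Sum>n=Suc a..b. \<chi> n * w n) - S b * w b) + S b * (w b - w (Suc b))"
      using step.hyps by (simp add: S_def algebra_simps)
    moreover have "2 * K * (w (Suc a) - w (Suc b)) = 2 * K * (w (Suc a) - w b) + 2 * K * (w b - w (Suc b))"
      by (simp add: algebra_simps)
    ultimately show ?case using step.IH by linarith
  qed
  moreover have "\<bar>S b * w b\<bar> \<le> 2 * K * w b"
    using sum_bound[of a b] nonneg[of b] True unfolding abs_mult S_def by (intro mult_mono) auto
  ultimately show ?thesis by (simp add: algebra_simps)
next
  case False
  then show ?thesis using K_nonneg nonneg[of "Suc a"] by simp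
qed

text \<open>
  The value \<open>L(1, \<chi>)\<close>.
\<close>

definition L1 :: real where "L1 = lim (\<lambda>N. \<Sum>n=1..N. \<chi> n / real n)"

lemma sum_over_n_tail: "\<bar>\<Sum>n=Suc a..b. \<chi> n / real n\<bar> \<le> 2 * K / real (Suc a)"
  using abel_bound[of a "\<lambda>n. 1 / real n" b] by (simp add: frac_le)

lemma sum_over_sqrt_tail: "\<bar>\<Sum>n=Suc a..b. \<chi> n / sqrt (real n)\<bar> \<le> 2 * K / sqrt (real (Suc a))"
  using abel_bound[of a "\<lambda>n. 1 / sqrt (real n)" b] by (simp add: frac_le)

lemma L1_approx: "\<bar>(\<Sum>n=1..N. \<chi> n / real n) - L1\<bar> \<le> 2 * K / real (Suc N)"
proof -
  define s where "s = (\<lambda>N. \<Sum>n=1..N. \<chi> n / real n)"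
  have s_diff: "\<bar>s b - s a\<bar> \<le> 2 * K / real (Suc a)" if "a \<le> b" for a b
  proof -
    have "{1..b} = {1..a} \<union> {Suc a..b}" using that by auto
    then have "s b = s a + (\<Sum>n=Suc a..b. \<chi> n / real n)"
      by (simp add: sum.union_disjoint s_def)
    then show ?thesis using sum_over_n_tail[of a b] by simp
  qed
  have lim0: "(\<lambda>a. 2 * K / real (Suc a)) \<longlonglongrightarrow> 0" by real_asymp
  have "Cauchy s"
  proof (rule CauchyI')
    fix e :: real assume "e > 0"
    then obtain M where "\<And>n. n \<ge> M \<Longrightarrow> \<bar>2 * K / real (Suc n)\<bar> < e"
      using lim0[unfolded LIMSEQ_iff] by auto
    then have "dist (s m) (s n) < e" if "m \<ge> M" "n > m" for m n
      using s_diff[of m n] that K_nonneg by (fastforce simp: dist_real_def abs_minus_commute)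
    then show "\<exists>M. \<forall>m\<ge>M. \<forall>n>m. dist (s m) (s n) < e" by blast
  qed
  then have "convergent s" by (simp add: Cauchy_convergent_iff)
  then have lim: "s \<longlonglongrightarrow> L1" unfolding L1_def s_def [symmetric] by (simp add: convergent_LIMSEQ_iff)
  have "\<bar>L1 - s N\<bar> \<le> 2 * K / real (Suc N)"
  proof (rule tendsto_upperbound)
    show "(\<lambda>b. \<bar>s b - s N\<bar>) \<longlonglongrightarrow> \<bar>L1 - s N\<bar>" by (intro tendsto_intros lim)
    show "\<forall>\<^sub>F b in sequentially. \<bar>s b - s N\<bar> \<le> 2 * K / real (Suc N)"
      using eventually_ge_at_top[of N] by eventually_elim (rule s_diff)
  qed simp
  then show ?thesis by (simp add: s_def abs_minus_commute)
qed

lemma power: "\<chi> (n ^ k) = \<chi> n ^ k"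
  by (induction k) (auto simp: mult)

lemma sum_divisors_prime_power:
  assumes p: "prime p" "\<not> p dvd m" and m: "m > 0"
  shows "(\<Sum>d | d dvd p ^ k * m. \<chi> d) = (\<Sum>i\<le>k. \<chi> p ^ i) * (\<Sum>d | d dvd m. \<chi> d)"
proof (induction k)
  case (Suc k)
  have split: "{d. d dvd p ^ Suc k * m} = {d. d dvd p ^ k * m} \<union> (*) (p ^ Suc k) ` {d. d dvd m}"
  proof (intro equalityI subsetI)
    fix d assume "d \<in> {d. d dvd p ^ Suc k * m}"
    then have "d dvd p ^ Suc k * m" by simp
    then obtain a b where ab: "d = a * b" "a dvd p ^ Suc k" "b dvd m" by (rule dvd_productE)
    from ab(2) p obtain i where i: "i \<le> Suc k" "a = p ^ i" by (metis divides_primepow_nat)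
    show "d \<in> {d. d dvd p ^ k * m} \<union> (*) (p ^ Suc k) ` {d. d dvd m}"
    proof (cases "i = Suc k")
      case True
      then show ?thesis using ab i by auto
    next
      case False
      then have "a dvd p ^ k" using i by (auto intro: le_imp_power_dvd)
      then show ?thesis using ab by (auto intro: mult_dvd_mono)
    qed
  qed (auto intro: mult_dvd_mono dvd_trans[OF _ dvd_triv_right] simp: mult.assoc)
  have disj: "{d. d dvd p ^ k * m} \<inter> (*) (p ^ Suc k) ` {d. d dvd m} = {}"
  proof safe
    fix d assume "p ^ Suc k * d dvd p ^ k * m" "d dvd m"
    then have "p * d dvd m" using p(1) by (simp add: mult.assoc mult.left_commute prime_gt_0_nat)
    then show "p ^ Suc k * d \<in> {}" using p(2) dvd_mult_left by blast
  qed
  have "(\<Sum>d | d dvd p ^ Suc k * m. \<chi> d) =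
      (\<Sum>d | d dvd p ^ k * m. \<chi> d) + (\<Sum>d\<in>(*) (p ^ Suc k) ` {d. d dvd m}. \<chi> d)"
    unfolding split using disj m p by (intro sum.union_disjoint) (auto simp: prime_gt_0_nat)
  also have "(\<Sum>d\<in>(*) (p ^ Suc k) ` {d. d dvd m}. \<chi> d) = (\<Sum>d | d dvd m. \<chi> (p ^ Suc k * d))"
    using p by (subst sum.reindex) (auto simp: inj_on_def prime_gt_0_nat)
  also have "\<dots> = \<chi> p ^ Suc k * (\<Sum>d | d dvd m. \<chi> d)"
    by (simp add: mult power sum_distrib_left mult.assoc)
  finally show ?case using Suc.IH by (simp add: algebra_simps)
qed simp

lemma geometric_chi:
  "(\<Sum>i\<le>k. \<chi> p ^ i) \<ge> 0" "even k \<Longrightarrow> (\<Sum>i\<le>k. \<chi> p ^ i) \<ge> 1"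
proof -
  have "(\<Sum>i\<le>k. (-1::real) ^ i) = (if even k then 1 else 0)" by (induction k) auto
  moreover have "(\<Sum>i\<le>k. (0::real) ^ i) = 1" by (induction k) auto
  ultimately show "(\<Sum>i\<le>k. \<chi> p ^ i) \<ge> 0" "even k \<Longrightarrow> (\<Sum>i\<le>k. \<chi> p ^ i) \<ge> 1"
    using vals[of p] by auto
qed

text \<open>
  The function \<open>\<chi> * 1\<close> is multiplicative, and at a prime power \<open>p ^ k\<close> it is the geometric sum
  \<open>1 + \<chi> p + \<dots> + \<chi> p ^ k\<close> with \<open>\<chi> p \<in> {-1, 0, 1}\<close>.
\<close>

lemma sum_divisors_nonneg_and_square:
  assumes "n > 0"
  shows "(\<Sum>d | d dvd n. \<chi> d) \<ge> 0 \<and> ((\<exists>s. n = s\<^sup>2) \<longrightarrow> (\<Sum>d | d dvd n. \<chi> d) \<ge> 1)"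
  using assms
proof (induction n rule: less_induct)
  case (less n)
  show ?case
  proof (cases "n = 1")
    case False
    then obtain p where p: "prime p" "p dvd n" using prime_factor_nat by blast
    obtain m where m: "n = p ^ multiplicity p n * m" "\<not> p dvd m"
      using multiplicity_decompose'[of n p] less.prems p by (metis neq0_conv not_prime_unit)
    define k where "k = multiplicity p n"
    have n: "n = p ^ k * m" using m by (simp add: k_def)
    have m0: "m > 0" using less.prems n by (auto intro: Nat.gr0I)
    have "k > 0" using p less.prems by (simp add: k_def prime_multiplicity_gt_zero_iff)
    then have "p ^ k > 1" using p by (metis one_less_power prime_gt_1_nat)
    then have "m < n" using m0 n by simp
    note IH = less.IH[OF this m0]
    have eq: "(\<Sum>d | d dvd n. \<chi> d) = (\<Sum>i\<le>k. \<chi> p ^ i) * (\<Sum>d | d dvd m. \<chi> d)"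
      unfolding n by (rule sum_divisors_prime_power[OF p(1) m(2) m0])
    have "(\<Sum>d | d dvd n. \<chi> d) \<ge> 1" if "n = s\<^sup>2" for s
    proof -
      have s: "s \<noteq> 0" using that less.prems by auto
      have k2: "k = 2 * multiplicity p s" unfolding k_def that using p s
        by (simp add: prime_elem_multiplicity_power_distrib)
      moreover obtain t where t: "s = p ^ multiplicity p s * t" "\<not> p dvd t"
        using multiplicity_decompose'[of s p] s p by (metis not_prime_unit)
      ultimately have "p ^ k * m = p ^ k * t\<^sup>2"
        using that n k2 by (metis power_mult power_mult_distrib mult.commute)
      then have "m = t\<^sup>2" using p by (simp add: prime_gt_0_nat)
      then have "(\<Sum>d | d dvd m. \<chi> d) \<ge> 1" using IH by blast
      moreover have "(\<Sum>i\<le>k. \<chi> p ^ i) \<ge> 1" using k2 by (intro geometric_chi) auto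
      ultimately show ?thesis unfolding eq by (metis mult_mono' mult_1 zero_le_one order_trans)
    qed
    then show ?thesis using IH geometric_chi(1)[of p k] unfolding eq by auto
  qed simp
qed

lemma sum_inverse_sqrt_asymp:
  "\<exists>c. \<forall>n\<ge>1. \<bar>(\<Sum>m=1..n. 1 / sqrt (real m)) - 2 * sqrt n - c\<bar> \<le> 1 / sqrt (real n)"
proof -
  have "\<exists>c. \<forall>n\<ge>1. \<bar>((\<Sum>m=1..n. 1 / sqrt (real m)) - 2 * sqrt n) - c\<bar> \<le> 1 / sqrt (real n)"
  proof (rule telescoping_limit)
    fix n :: nat assume n: "n \<ge> 1"
    define s t where "s = sqrt (real n)" and "t = sqrt (real (Suc n))"
    have st: "0 < s" "s \<le> t" "t > 0" "t\<^sup>2 - s\<^sup>2 = 1" using n by (auto simp: s_def t_def)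
    have eq: "(t - s) * (t + s) = 1" using st(4) by (simp add: power2_eq_square algebra_simps)
    have "(t - s) * (t + s) \<le> (t - s) * (2 * t)" "(t - s) * (2 * s) \<le> (t - s) * (t + s)"
      using st by (auto intro!: mult_left_mono)
    then have "1 / t \<le> 2 * (t - s)" "2 * (t - s) \<le> 1 / s"
      using st unfolding eq by (simp_all add: field_simps)
    then have "\<bar>1 / t - 2 * (t - s)\<bar> \<le> 1 / s - 1 / t" by linarith
    then show "\<bar>(\<Sum>m=1..Suc n. 1 / sqrt (real m)) - 2 * sqrt (real (Suc n)) -
        ((\<Sum>m=1..n. 1 / sqrt (real m)) - 2 * sqrt n)\<bar> \<le> 1 / sqrt (real n) - 1 / sqrt (real (Suc n))"
      by (simp add: s_def t_def algebra_simps)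
  qed real_asymp
  then show ?thesis by simp
qed

lemma ln_Suc_le_harmonic: "ln (real (Suc n)) \<le> (\<Sum>m=1..n. 1 / real m)"
proof (induction n)
  case (Suc n)
  then show ?case using ln_Suc_diff_bounds(2)[of "Suc n"] by simp
qed simp

text \<open>
  Let \<open>r = \<chi> * 1\<close> and \<open>x = N\<^sup>2\<close>. As \<open>r \<ge> 0\<close> everywhere and \<open>r \<ge> 1\<close> at squares, the sum
  of \<open>r n / sqrt n\<close> up to \<open>x\<close> is at least the harmonic sum up to \<open>N\<close>. The hyperbola method evaluates
  it as \<open>2 N L(1) + O(1)\<close>, which would stay bounded if \<open>L(1)\<close> vanished.
\<close>

lemma L1_nonzero: "L1 \<noteq> 0"
proof
  assume L1: "L1 = 0"
  obtain c where c: "\<And>n. n \<ge> 1 \<Longrightarrow>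
      \<bar>(\<Sum>m=1..n. 1 / sqrt (real m)) - 2 * sqrt n - c\<bar> \<le> 1 / sqrt (real n)"
    using sum_inverse_sqrt_asymp by blast
  define H where "H = (\<lambda>n. \<Sum>m=1..n. 1 / sqrt (real m))"
  define r where "r = (\<lambda>n. \<Sum>d | d dvd n. \<chi> d)"
  define B where "B = 4 * K + 2 * K * \<bar>c\<bar> + 5 + 4 * K"
  have bound: "ln (real (Suc N)) \<le> B" if N: "N \<ge> 1" for N :: nat
  proof -
    define x where "x = N\<^sup>2"
    have Nx: "N \<le> x" using N by (simp add: x_def power2_eq_square)
    have sx: "sqrt (real x) = N" by (simp add: x_def)
    define F where "F = (\<lambda>d m. \<chi> d / sqrt (real d) * (1 / sqrt (real m)))"
    have "(\<Sum>m=1..N. 1 / real m) = (\<Sum>n\<in>(\<lambda>s. s\<^sup>2) ` {1..N}. 1 / sqrt (real n))"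
      by (subst sum.reindex) (auto simp: inj_on_def)
    also have "\<dots> \<le> (\<Sum>n\<in>(\<lambda>s. s\<^sup>2) ` {1..N}. r n / sqrt (real n))"
    proof (rule sum_mono)
      fix n assume "n \<in> (\<lambda>s. s\<^sup>2) ` {1..N}"
      then obtain s where "n = s\<^sup>2" "s \<ge> 1" by auto
      then have "r n \<ge> 1" using sum_divisors_nonneg_and_square[of n] by (auto simp: r_def)
      then show "1 / sqrt (real n) \<le> r n / sqrt (real n)" by (intro divide_right_mono) auto
    qed
    also have "\<dots> \<le> (\<Sum>n=1..x. r n / sqrt (real n))"
    proof (rule sum_mono2)
      show "(\<lambda>s. s\<^sup>2) ` {1..N} \<subseteq> {1..x}" by (auto simp: x_def intro: power_mono)
      show "0 \<le> r n / sqrt (real n)" if "n \<in> {1..x} - (\<lambda>s. s\<^sup>2) ` {1..N}" for n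
        using sum_divisors_nonneg_and_square[of n] that by (auto simp: r_def)
    qed simp
    also have "\<dots> = (\<Sum>n=1..x. \<Sum>d | d dvd n. F d (n div d))"
    proof (intro sum.cong refl)
      fix n assume "n \<in> {1..x}"
      then have "F d (n div d) = \<chi> d / sqrt (real n)" if "d dvd n" for d
        using that by (auto simp: F_def real_sqrt_mult elim!: dvdE)
      then show "r n / sqrt (real n) = (\<Sum>d | d dvd n. F d (n div d))"
        by (simp add: r_def sum_divide_distrib)
    qed
    also have "\<dots> = (\<Sum>d=1..x. \<Sum>m=1..x div d. F d m)" by (rule sum_divisors_swap)
    also have "\<dots> = (\<Sum>d=1..N. \<Sum>m=1..x div d. F d m) +
        (\<Sum>m=1..x div Suc N. \<Sum>d=Suc N..x div m. F d m)" by (rule sum_hyperbola[OF Nx])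
    also have "(\<Sum>d=1..N. \<Sum>m=1..x div d. F d m) = (\<Sum>d=1..N. \<chi> d / sqrt (real d) * H (x div d))"
      by (simp add: F_def H_def sum_distrib_left)
    also have "\<dots> = (\<Sum>d=1..N. 2 * N * (\<chi> d / real d) + c * (\<chi> d / sqrt (real d)) +
        \<chi> d / sqrt (real d) * (H (x div d) - 2 * sqrt (real x / real d) - c))"
      by (intro sum.cong refl) (auto simp: real_sqrt_divide sx field_simps)
    also have "\<dots> = 2 * N * (\<Sum>d=1..N. \<chi> d / real d) + c * (\<Sum>d=1..N. \<chi> d / sqrt (real d)) +
        (\<Sum>d=1..N. \<chi> d / sqrt (real d) * (H (x div d) - 2 * sqrt (real x / real d) - c))"
      by (simp add: sum.distrib sum_distrib_left)
    also have "\<dots> \<le> 4 * K + 2 * K * \<bar>c\<bar> + 5"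
    proof (intro add_mono)
      have "\<bar>\<Sum>d=1..N. \<chi> d / real d\<bar> \<le> 2 * K / real (Suc N)" using L1_approx[of N] L1 by simp
      then have "2 * N * (\<Sum>d=1..N. \<chi> d / real d) \<le> 2 * N * (2 * K / real (Suc N))"
        by (intro mult_left_mono) auto
      also have "\<dots> = 4 * K * (N / real (Suc N))" by simp
      also have "\<dots> \<le> 4 * K * 1" using K_nonneg by (intro mult_left_mono) auto
      finally show "2 * N * (\<Sum>d=1..N. \<chi> d / real d) \<le> 4 * K" by simp
      have "\<bar>c * (\<Sum>d=1..N. \<chi> d / sqrt (real d))\<bar> \<le> \<bar>c\<bar> * (2 * K)"
        using sum_over_sqrt_tail[of 0 N] unfolding abs_mult by (intro mult_left_mono) auto
      then show "c * (\<Sum>d=1..N. \<chi> d / sqrt (real d)) \<le> 2 * K * \<bar>c\<bar>" by (simp add: mult_ac abs_le_iff)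
      have "(\<Sum>d=1..N. \<chi> d / sqrt (real d) * (H (x div d) - 2 * sqrt (real x / real d) - c)) \<le> (\<Sum>d=1..N. 5 / N)"
      proof (rule sum_mono)
        fix d assume "d \<in> {1..N}"
        then have d: "d \<ge> 1" "d \<le> x" using Nx by auto
        define n y where "n = x div d" and "y = real x / real d"
        have n: "n \<ge> 1" "real n \<le> y" "y \<le> real n + 1"
          using real_div_bounds[OF d] by (auto simp: n_def y_def)
        have sn: "sqrt n \<ge> 1" "sqrt n \<le> sqrt y" using n by auto
        have "(sqrt y - sqrt n) * (sqrt y + sqrt n) = y - n" using n by (simp add: algebra_simps)
        then have "(sqrt y - sqrt n) * (sqrt y + sqrt n) \<le> 1" using n by simp
        moreover have "(sqrt y - sqrt n) * (2 * sqrt n) \<le> (sqrt y - sqrt n) * (sqrt y + sqrt n)"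
          using sn by (intro mult_left_mono) auto
        ultimately have "(sqrt y - sqrt n) * (2 * sqrt n) \<le> 1" by linarith
        then have "2 * sqrt y - 2 * sqrt n \<le> 1 / sqrt n"
        using sn by (subst pos_le_divide_eq) (auto simp: algebra_simps)
        moreover have "2 * sqrt y - 2 * sqrt n \<ge> 0" using sn by simp
        ultimately have "\<bar>H n - 2 * sqrt y - c\<bar> \<le> 2 * (1 / sqrt n)"
          using c[OF n(1)] unfolding H_def by linarith
        also have "1 / sqrt n \<le> 1 / (sqrt y / 2)"
        proof -
          have "sqrt y \<le> sqrt (4 * n)" using n by (intro real_sqrt_le_mono) auto
          then have "sqrt y / 2 \<le> sqrt n" by (simp add: real_sqrt_mult)
          moreover have "sqrt y > 0" using sn by linarith
          ultimately show ?thesis using n(1) by (intro divide_left_mono) auto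
        qed
        also have "2 * (1 / (sqrt y / 2)) = 4 * sqrt d / N"
          using d by (simp add: y_def real_sqrt_divide sx)
        finally have h: "\<bar>H n - 2 * sqrt y - c\<bar> \<le> 4 * sqrt d / N" by simp
        have "\<bar>\<chi> d / sqrt (real d) * (H n - 2 * sqrt y - c)\<bar> \<le> (1 / sqrt d) * (4 * sqrt d / N)"
          using h abs_le_1[of d] unfolding abs_mult by (intro mult_mono) (auto intro!: divide_right_mono)
        also have "\<dots> = 4 / N" using d by simp
        also have "\<dots> \<le> 5 / N" by (intro divide_right_mono) auto
        finally show "\<chi> d / sqrt (real d) * (H (x div d) - 2 * sqrt (real x / real d) - c) \<le> 5 / N"
          unfolding n_def y_def by linarith
      qed
      then show "(\<Sum>d=1..N. \<chi> d / sqrt (real d) * (H (x div d) - 2 * sqrt (real x / real d) - c)) \<le> 5"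
        using N by simp
    qed
    also have "(\<Sum>m=1..x div Suc N. \<Sum>d=Suc N..x div m. F d m) \<le> 4 * K"
    proof -
      have "(\<Sum>m=1..x div Suc N. \<Sum>d=Suc N..x div m. F d m) \<le>
          (\<Sum>m=1..x div Suc N. 1 / sqrt (real m) * (2 * K / sqrt (real (Suc N))))"
      proof (rule sum_mono)
        fix m
        have "(\<Sum>d=Suc N..x div m. F d m) = 1 / sqrt (real m) * (\<Sum>d=Suc N..x div m. \<chi> d / sqrt (real d))"
          by (simp add: F_def sum_distrib_left mult.commute)
        also have "\<dots> \<le> 1 / sqrt (real m) * (2 * K / sqrt (real (Suc N)))"
          using sum_over_sqrt_tail[of N "x div m"] by (intro mult_left_mono) (auto simp: abs_le_iff)
        finally show "(\<Sum>d=Suc N..x div m. F d m) \<le> 1 / sqrt (real m) * (2 * K / sqrt (real (Suc N)))" .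
      qed
      also have "\<dots> = (2 * K / sqrt (real (Suc N))) * (\<Sum>m=1..x div Suc N. 1 / sqrt (real m))"
        by (simp add: sum_distrib_left mult.commute)
      also have "\<dots> \<le> (2 * K / sqrt (real (Suc N))) * (2 * sqrt (real (Suc N)))"
      proof (intro mult_left_mono)
        have "x div Suc N \<le> Suc N" unfolding x_def power2_eq_square
          by (metis div_le_mono div_mult_self1_is_m le_SucI mult_le_mono order_refl zero_less_Suc)
        then have "2 * sqrt (real (x div Suc N)) \<le> 2 * sqrt (real (Suc N))" by simp
        with sum_inverse_sqrt_le[of "x div Suc N"]
        show "(\<Sum>m=1..x div Suc N. 1 / sqrt (real m)) \<le> 2 * sqrt (real (Suc N))" by linarith
      qed (use K_nonneg in auto)
      also have "\<dots> = 4 * K" by simp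
      finally show ?thesis .
    qed
    finally show ?thesis using ln_Suc_le_harmonic[of N] unfolding B_def by linarith
  qed
  obtain N :: nat where N: "real N > exp (B + 1)" using reals_Archimedean2 by blast
  have "N \<ge> 1" using N exp_gt_zero[of "B + 1"] by (cases N) auto
  moreover have "B + 1 < ln (real (Suc N))"
    using N by (subst ln_exp [symmetric], subst ln_less_cancel_iff) (auto simp: less_trans)
  ultimately show False using bound[of N] by simp
qed

end

section \<open>Sums of the twisted Moebius function\<close>

context bounded_real_character
begin

text \<open>
  The Mertens function twisted by \<open>\<chi>\<close>.
\<close>

definition mertens :: "nat \<Rightarrow> real" where "mertens x = (\<Sum>n=1..x. moebius_mu n * \<chi> n)"

lemma abs_term_le_1: "\<bar>moebius_mu n * \<chi> n\<bar> \<le> 1"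
  using mult_mono[OF abs_moebius_mu_le[of n] abs_le_1[of n]] by (simp add: abs_mult)

lemma mertens_diff: "a \<le> b \<Longrightarrow> \<bar>mertens b - mertens a\<bar> \<le> real (b - a)"
proof (induction b rule: dec_induct)
  case (step b)
  have "mertens (Suc b) = mertens b + moebius_mu (Suc b) * \<chi> (Suc b)" by (simp add: mertens_def)
  then show ?case using step abs_term_le_1[of "Suc b"] by (simp add: Suc_diff_le)
qed simp

lemma mertens_0 [simp]: "mertens 0 = 0" by (simp add: mertens_def)

lemma abs_mertens_le: "\<bar>mertens x\<bar> \<le> real x"
  using mertens_diff[of 0 x] by simp

text \<open>
  Summing \<open>\<chi> n / n\<close> against \<open>\<mu> * 1\<close> leaves the single term \<open>1\<close>, while summing over the multiples of
  each \<open>d\<close> first gives the sum in question times \<open>L(1)\<close>, up to a bounded error. Non-vanishing of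
  \<open>L(1)\<close> allows the division.
\<close>

lemma sum_twist_mu_over_n:
  "\<exists>A. \<forall>x. \<bar>\<Sum>n=1..x. moebius_mu n * \<chi> n / real n\<bar> \<le> A"
proof -
  have "\<bar>\<Sum>n=1..x. moebius_mu n * \<chi> n / real n\<bar> \<le> (1 + 2 * K) / \<bar>L1\<bar>" for x
  proof (cases "x = 0")
    case False
    define s where "s = (\<lambda>N. \<Sum>m=1..N. \<chi> m / real m)"
    define g where "g = (\<lambda>n. moebius_mu n * \<chi> n)"
    have "1 = (\<Sum>n=1..x. if n = 1 then 1 else 0 :: real)" using False by simp
    also have "\<dots> = (\<Sum>n=1..x. (\<Sum>d | d dvd n. moebius_mu d) * (\<chi> n / real n))"
      by (intro sum.cong refl) (auto simp: sum_moebius_mu)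
    also have "\<dots> = (\<Sum>n=1..x. \<Sum>d | d dvd n. moebius_mu d * (\<chi> (d * (n div d)) / real (d * (n div d))))"
      by (simp add: sum_distrib_right sum_divide_distrib)
    also have "\<dots> = (\<Sum>d=1..x. \<Sum>m=1..x div d. moebius_mu d * (\<chi> (d * m) / real (d * m)))"
      by (rule sum_divisors_swap)
    also have "\<dots> = (\<Sum>d=1..x. g d / real d * s (x div d))"
      by (simp add: s_def g_def mult sum_distrib_left mult_ac)
    also have "\<dots> = (\<Sum>d=1..x. g d / real d * L1 + g d / real d * (s (x div d) - L1))"
      by (simp add: algebra_simps)
    also have "\<dots> = (\<Sum>d=1..x. g d / real d) * L1 + (\<Sum>d=1..x. g d / real d * (s (x div d) - L1))"
      by (simp add: sum.distrib sum_distrib_right)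
    finally have eq: "(\<Sum>d=1..x. g d / real d) * L1 = 1 - (\<Sum>d=1..x. g d / real d * (s (x div d) - L1))"
      by linarith
    have "\<bar>\<Sum>d=1..x. g d / real d * (s (x div d) - L1)\<bar> \<le> (\<Sum>d=1..x. 2 * K / real x)"
    proof (intro order_trans[OF sum_abs] sum_mono)
      fix d assume "d \<in> {1..x}"
      then have d: "d \<ge> 1" "d \<le> x" by auto
      have gd: "\<bar>g d\<bar> \<le> 1" unfolding g_def by (rule abs_term_le_1)
      have "\<bar>s (x div d) - L1\<bar> \<le> 2 * K / (real (x div d) + 1)"
        using L1_approx[of "x div d"] by (simp add: s_def add.commute)
      also have "\<dots> \<le> 2 * K / (real x / real d)"
        using real_div_bounds[OF d] d K_nonneg by (intro divide_left_mono) auto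
      finally have "\<bar>g d / real d * (s (x div d) - L1)\<bar> \<le> (1 / d) * (2 * K / (real x / real d))"
        using gd d unfolding abs_mult
        by (intro mult_mono) (auto intro!: divide_right_mono)
      also have "\<dots> = 2 * K / real x" using d by simp
      finally show "\<bar>g d / real d * (s (x div d) - L1)\<bar> \<le> 2 * K / real x" .
    qed
    also have "\<dots> = 2 * K" using False by simp
    finally have "\<bar>(\<Sum>d=1..x. g d / real d) * L1\<bar> \<le> 1 + 2 * K" unfolding eq by linarith
    then show ?thesis using L1_nonzero by (simp add: g_def abs_mult pos_le_divide_eq)
  qed (use K_nonneg in simp)
  then show ?thesis by blast
qed

text \<open>
  Complete multiplicativity of \<open>\<chi>\<close> makes twisting an endomorphism of the convolution, so the identities
  between \<open>\<mu>\<close>, \<open>Lam\<close> and \<open>ln\<close> carry over to their twists.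
\<close>

lemma twist_dconv: "n > 0 \<Longrightarrow> \<chi> n * dconv f h n = dconv (\<lambda>d. f d * \<chi> d) (\<lambda>d. h d * \<chi> d) n"
  unfolding dconv_def sum_distrib_left
proof (intro sum.cong refl)
  fix d assume "d \<in> {d. d dvd n}"
  then have "n = d * (n div d)" by simp
  then have "\<chi> n = \<chi> d * \<chi> (n div d)" using mult by metis
  then show "\<chi> n * (f d * h (n div d)) = f d * \<chi> d * (h (n div d) * \<chi> (n div d))" by simp
qed

lemma ln_mu_eq: "ln (real n) * moebius_mu n = - dconv moebius_mu Lam n"
proof (cases "n = 0")
  case False
  let ?D = "\<lambda>d. ln (real d) * moebius_mu d"
  \<comment> \<open>Differentiating \<open>\<mu> * 1 = 1\<close>, where \<open>f \<mapsto> ln \<sqdot> f\<close> is a derivation for the convolution.\<close>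
  have zero: "dconv ?D (\<lambda>_. 1) m = - dconv (dconv moebius_mu Lam) (\<lambda>_. 1) m" if "m > 0" for m
  proof -
    have "0 = ln (real m) * dconv moebius_mu (\<lambda>_. 1) m"
      using that by (simp add: dconv_mu_one dirichlet_one_def)
    also have "\<dots> = dconv ?D (\<lambda>_. 1) m + dconv moebius_mu (\<lambda>d. ln (real d) * 1) m"
      by (rule dconv_ln)
    also have "dconv moebius_mu (\<lambda>d. ln (real d) * 1) m = dconv moebius_mu (dconv Lam (\<lambda>_. 1)) m"
      using that by (intro dconv_cong) (auto simp: dconv_Lam_one)
    finally show ?thesis by (simp add: dconv_assoc)
  qed
  have "?D n = dconv moebius_mu (dconv (\<lambda>_. 1) ?D) n" using False by (simp add: dconv_mu_cancel)
  also have "\<dots> = dconv moebius_mu (\<lambda>m. - dconv (\<lambda>_. 1) (dconv moebius_mu Lam) m) n"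
    using False zero by (intro dconv_cong) (auto simp: dconv_commute[of "\<lambda>_. 1"])
  also have "\<dots> = - dconv moebius_mu (dconv (\<lambda>_. 1) (dconv moebius_mu Lam)) n"
    by (simp add: dconv_def sum_negf)
  finally show ?thesis using False by (simp add: dconv_mu_cancel)
qed simp

text \<open>
  The coefficients of \<open>\<zeta> (1 / \<zeta>)''\<close>, which \<open>lambda2\<close> dominates.
\<close>

definition lambda2' :: "nat \<Rightarrow> real" where
  "lambda2' n = dconv Lam Lam n - ln (real n) * Lam n"

lemma abs_lambda2'_le: "\<bar>lambda2' n\<bar> \<le> lambda2 n"
proof -
  have "dconv Lam Lam n \<ge> 0" unfolding dconv_def
    by (intro sum_nonneg mult_nonneg_nonneg mangoldt_nonneg)
  moreover have "ln (real n) * Lam n \<ge> 0"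
    by (cases "n = 0") (auto intro!: mult_nonneg_nonneg mangoldt_nonneg)
  ultimately show ?thesis by (simp add: lambda2'_def lambda2_def)
qed

lemma ln_squared_mu_eq: "(ln (real n))\<^sup>2 * moebius_mu n = dconv moebius_mu lambda2' n"
proof (cases "n = 0")
  case False
  have "(ln (real n))\<^sup>2 * moebius_mu n = - (ln (real n) * dconv moebius_mu Lam n)"
    using ln_mu_eq[of n] by (simp add: power2_eq_square mult.assoc)
  also have "\<dots> = - (dconv (\<lambda>d. ln (real d) * moebius_mu d) Lam n + dconv moebius_mu (\<lambda>d. ln (real d) * Lam d) n)"
    by (simp add: dconv_ln)
  also have "dconv (\<lambda>d. ln (real d) * moebius_mu d) Lam n = - dconv (dconv moebius_mu Lam) Lam n"
    by (simp add: ln_mu_eq dconv_uminus_left)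
  also have "dconv (dconv moebius_mu Lam) Lam n = dconv (dconv Lam Lam) moebius_mu n"
    by (simp add: dconv_assoc dconv_commute[of _ moebius_mu])
  also have "- (- dconv (dconv Lam Lam) moebius_mu n + dconv moebius_mu (\<lambda>d. ln (real d) * Lam d) n)
      = dconv moebius_mu lambda2' n"
    unfolding dconv_commute[of moebius_mu] lambda2'_def by (simp add: dconv_diff_left)
  finally show ?thesis .
qed simp

text \<open>
  Partial summation in which the increments of \<open>u\<close> are dominated by those of the decreasing function
  \<open>v\<close>.
\<close>

lemma sum_abel_majorant:
  fixes e u v :: "nat \<Rightarrow> real"
  assumes E: "\<And>n. n \<ge> 1 \<Longrightarrow> \<bar>\<Sum>d=1..n. e d\<bar> \<le> C * real n"
    and u: "\<And>d. \<bar>u d\<bar> \<le> v d" and du: "\<And>d. d \<ge> 1 \<Longrightarrow> \<bar>u d - u (Suc d)\<bar> \<le> v d - v (Suc d)"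
    and N: "N \<ge> 1"
  shows "\<bar>\<Sum>d=1..N. e d * u d\<bar> \<le> C * (\<Sum>d=1..N. v d)"
proof -
  define S where "S = (\<lambda>n. \<Sum>d=1..n. e d)"
  have C: "C \<ge> 0" using E[of 1] by auto
  have "\<bar>(\<Sum>d=1..N. e d * u d) - S N * u N\<bar> \<le> C * ((\<Sum>d=1..N. v d) - N * v N)"
    using N
  proof (induction N rule: dec_induct)
    case (step N)
    have "\<bar>S N * (u N - u (Suc N))\<bar> \<le> (C * N) * (v N - v (Suc N))"
      using E[of N] du[of N] step.hyps C unfolding abs_mult S_def by (intro mult_mono) auto
    moreover have "(\<Sum>d=1..Suc N. e d * u d) - S (Suc N) * u (Suc N)
        = ((\<Sum>d=1..N. e d * u d) - S N * u N) + S N * (u N - u (Suc N))"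
      by (simp add: S_def algebra_simps)
    moreover have "C * ((\<Sum>d=1..Suc N. v d) - Suc N * v (Suc N))
        = C * ((\<Sum>d=1..N. v d) - N * v N) + (C * N) * (v N - v (Suc N))"
      by (simp add: algebra_simps)
    ultimately show ?case using step.IH by linarith
  qed (simp add: S_def)
  moreover have "\<bar>S N * u N\<bar> \<le> (C * N) * v N"
    using E[OF N] u[of N] C unfolding abs_mult S_def by (intro mult_mono) auto
  ultimately show ?thesis by (simp add: algebra_simps)
qed

lemma harmonic_le: "n \<ge> 1 \<Longrightarrow> (\<Sum>m=1..n. 1 / real m) \<le> 1 + ln n"
proof (induction n rule: dec_induct)
  case (step n)
  then show ?case using ln_Suc_diff_bounds(1)[of n] by simp
qed simp

text \<open>
  From \<open>ln\<^sup>2 \<sqdot> \<mu> = \<mu> * lambda2'\<close> one gets a bound for \<open>\<bar>mertens x\<bar> (ln x)\<^sup>2\<close> by the sum of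
  \<open>lambda2 d * \<bar>mertens (x div d)\<bar>\<close>. By Selberg's formula \<open>lambda2\<close> is \<open>2 ln\<close> on average. It may be
  replaced by this average since \<open>\<bar>mertens\<bar>\<close> is Lipschitz with constant \<open>1\<close>, so that the variation of
  \<open>\<bar>mertens (x div d)\<bar>\<close> in \<open>d\<close> is controlled by that of \<open>x div d\<close>.
\<close>

lemma mertens_recursion:
  "\<exists>C. \<forall>x\<ge>1. \<bar>mertens x\<bar> * (ln x)\<^sup>2 \<le> 2 * (\<Sum>d=1..x. ln (real d) * \<bar>mertens (x div d)\<bar>) + C * x * (1 + ln x)"
proof -
  obtain C where C: "\<And>x. x \<ge> 1 \<Longrightarrow>
      \<bar>(\<Sum>n=1..x. lambda2 n) - (\<Sum>n=1..x. 2 * ln (real n))\<bar> \<le> C * real x"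
    using selberg_formula by blast
  have "C \<ge> 0" using C[of 1] by auto
  have "\<bar>mertens x\<bar> * (ln x)\<^sup>2 \<le> 2 * (\<Sum>d=1..x. ln (real d) * \<bar>mertens (x div d)\<bar>) + (C + 2) * x * (1 + ln x)"
    if x: "x \<ge> 1" for x :: nat
  proof -
    define P where "P = (\<Sum>n=1..x. (ln (real n))\<^sup>2 * (moebius_mu n * \<chi> n))"
    have "P = (\<Sum>n=1..x. dconv (\<lambda>d. lambda2' d * \<chi> d) (\<lambda>d. moebius_mu d * \<chi> d) n)"
      unfolding P_def
    proof (intro sum.cong refl)
      fix n assume n: "n \<in> {1..x}"
      have pos: "n > 0" using n by simp
      have "(ln (real n))\<^sup>2 * (moebius_mu n * \<chi> n) = \<chi> n * dconv lambda2' moebius_mu n"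
        using ln_squared_mu_eq[of n] by (simp add: dconv_commute[of _ moebius_mu] mult_ac)
      then show "(ln (real n))\<^sup>2 * (moebius_mu n * \<chi> n) =
          dconv (\<lambda>d. lambda2' d * \<chi> d) (\<lambda>d. moebius_mu d * \<chi> d) n"
        using twist_dconv[OF pos, of lambda2' moebius_mu] by (rule trans)
    qed
    also have "\<dots> = (\<Sum>d=1..x. lambda2' d * \<chi> d * mertens (x div d))"
      unfolding mertens_def by (rule sum_dconv)
    finally have "\<bar>P\<bar> \<le> (\<Sum>d=1..x. \<bar>lambda2' d * \<chi> d * mertens (x div d)\<bar>)" by simp
    also have "\<dots> \<le> (\<Sum>d=1..x. lambda2 d * \<bar>mertens (x div d)\<bar>)"
    proof (rule sum_mono)
      fix d
      have "\<bar>lambda2' d\<bar> * \<bar>\<chi> d\<bar> \<le> lambda2 d * 1"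
        using abs_lambda2'_le abs_le_1 by (intro mult_mono) (auto simp: lambda2_nonneg)
      then show "\<bar>lambda2' d * \<chi> d * mertens (x div d)\<bar> \<le> lambda2 d * \<bar>mertens (x div d)\<bar>"
        unfolding abs_mult by (intro mult_right_mono) auto
    qed
    also have "\<dots> = (\<Sum>d=1..x. 2 * ln (real d) * \<bar>mertens (x div d)\<bar>) +
        (\<Sum>d=1..x. (lambda2 d - 2 * ln (real d)) * \<bar>mertens (x div d)\<bar>)"
      by (simp add: sum.distrib [symmetric] algebra_simps)
    also have "(\<Sum>d=1..x. (lambda2 d - 2 * ln (real d)) * \<bar>mertens (x div d)\<bar>) \<le> C * (\<Sum>d=1..x. real (x div d))"
    proof (rule order_trans[OF abs_ge_self sum_abel_majorant])
      show "\<bar>\<Sum>d=1..n. lambda2 d - 2 * ln (real d)\<bar> \<le> C * real n" if "n \<ge> 1" for n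
        using C[OF that] by (simp add: sum_subtractf)
      show "\<bar>\<bar>mertens (x div d)\<bar>\<bar> \<le> real (x div d)" for d using abs_mertens_le by simp
      show "\<bar>\<bar>mertens (x div d)\<bar> - \<bar>mertens (x div Suc d)\<bar>\<bar> \<le> real (x div d) - real (x div Suc d)" if "d \<ge> 1" for d
      proof -
        have le: "x div Suc d \<le> x div d" using that by (intro div_le_mono2) auto
        have "\<bar>\<bar>mertens (x div d)\<bar> - \<bar>mertens (x div Suc d)\<bar>\<bar> \<le> \<bar>mertens (x div d) - mertens (x div Suc d)\<bar>" by linarith
        also have "\<dots> \<le> real (x div d - x div Suc d)" by (rule mertens_diff[OF le])
        finally show ?thesis using le by (simp add: of_nat_diff)
      qed
    qed (rule x)
    also have "(\<Sum>d=1..x. real (x div d)) \<le> (\<Sum>d=1..x. real x * (1 / real d))"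
      by (intro sum_mono) (use of_nat_div_le_of_nat in auto)
    also have "\<dots> \<le> real x * (1 + ln x)"
      unfolding sum_distrib_left [symmetric] using harmonic_le[OF x] by (intro mult_left_mono) auto
    finally have P: "\<bar>P\<bar> \<le> 2 * (\<Sum>d=1..x. ln (real d) * \<bar>mertens (x div d)\<bar>) + C * (real x * (1 + ln x))"
      using \<open>C \<ge> 0\<close> by (simp add: sum_distrib_left mult.assoc mult_left_mono)
    have "\<bar>mertens x * (ln x)\<^sup>2 - P\<bar> = \<bar>\<Sum>n=1..x. ((ln (real x))\<^sup>2 - (ln (real n))\<^sup>2) * (moebius_mu n * \<chi> n)\<bar>"
      by (simp add: mertens_def P_def left_diff_distrib sum_subtractf sum_distrib_left mult.commute[of "sum _ _"])
    also have "\<dots> \<le> (\<Sum>n=1..x. ((ln (real x))\<^sup>2 - (ln (real n))\<^sup>2) * 1)"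
    proof (intro order_trans[OF sum_abs] sum_mono)
      fix n assume "n \<in> {1..x}"
      then have "(ln (real n))\<^sup>2 \<le> (ln (real x))\<^sup>2" by (intro power_mono) auto
      then show "\<bar>((ln (real x))\<^sup>2 - (ln (real n))\<^sup>2) * (moebius_mu n * \<chi> n)\<bar>
          \<le> ((ln (real x))\<^sup>2 - (ln (real n))\<^sup>2) * 1"
        using abs_term_le_1[of n] unfolding abs_mult by (intro mult_mono) auto
    qed
    also have "\<dots> = real x * (ln x)\<^sup>2 - (\<Sum>n=1..x. (ln (real n))\<^sup>2)" by (simp add: sum_subtractf)
    also have "\<dots> \<le> 2 * x * (1 + ln x)"
    proof -
      have d: "((\<lambda>y::real. y * (ln y)\<^sup>2 - 2 * y * ln y + 2 * y) has_real_derivative (ln y)\<^sup>2) (at y)"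
        if "y \<ge> 1" for y :: real
        using that by (auto intro!: derivative_eq_intros simp: power2_eq_square)
      have m: "(ln y)\<^sup>2 \<le> (ln z)\<^sup>2" if "1 \<le> y" "y \<le> z" for y z :: real
        using that by (intro power_mono) auto
      show ?thesis using sum_increasing_bounds(1)[OF d m x] x by (simp add: algebra_simps)
    qed
    finally have "\<bar>mertens x * (ln x)\<^sup>2\<bar> \<le> \<bar>P\<bar> + 2 * x * (1 + ln x)" by linarith
    then show ?thesis using P by (simp add: abs_mult algebra_simps)
  qed
  then show ?thesis by blast
qed

text \<open>
  Partial summation turns the bound on the sums of \<open>\<mu>(n) \<chi>(n) / n\<close> into one on the sums of
  \<open>mertens n / (n (n + 1))\<close>.
\<close>

lemma sum_mertens_over_square:
  "\<exists>A. \<forall>a b. \<bar>\<Sum>n=Suc a..b. mertens n * (1 / real n - 1 / real (Suc n))\<bar> \<le> A"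
proof -
  obtain A where A: "\<And>x. \<bar>\<Sum>n=1..x. moebius_mu n * \<chi> n / real n\<bar> \<le> A"
    using sum_twist_mu_over_n by blast
  define T where "T = (\<lambda>x. \<Sum>n=1..x. mertens n * (1 / real n - 1 / real (Suc n)))"
  have T_eq: "T x = (\<Sum>n=1..x. moebius_mu n * \<chi> n / real n) - mertens x / real (Suc x)" for x
  proof (induction x)
    case (Suc x)
    have "mertens (Suc x) = mertens x + moebius_mu (Suc x) * \<chi> (Suc x)" by (simp add: mertens_def)
    then have "moebius_mu (Suc x) * \<chi> (Suc x) = mertens (Suc x) - mertens x" by simp
    then show ?case using Suc by (simp add: T_def diff_divide_distrib right_diff_distrib)
  qed (simp add: T_def)
  have T: "\<bar>T x\<bar> \<le> A + 1" for x
  proof -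
    have "\<bar>mertens x / real (Suc x)\<bar> \<le> 1" using abs_mertens_le[of x] by (simp add: divide_le_eq)
    then show ?thesis using A[of x] unfolding T_eq by linarith
  qed
  have "\<bar>\<Sum>n=Suc a..b. mertens n * (1 / real n - 1 / real (Suc n))\<bar> \<le> 2 * (A + 1)" (is "\<bar>?U\<bar> \<le> _") for a b
  proof (cases "a \<le> b")
    case True
    then have "{1..b} = {1..a} \<union> {Suc a..b}" by auto
    then have "?U = T b - T a"
      by (simp add: sum.union_disjoint T_def)
    moreover have "\<bar>T b - T a\<bar> \<le> 2 * (A + 1)"
    proof -
      have "\<bar>T b - T a\<bar> \<le> \<bar>T b\<bar> + \<bar>T a\<bar>" by (rule abs_triangle_ineq4)
      also have "\<dots> \<le> (A + 1) + (A + 1)" by (intro add_mono T)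
      finally show ?thesis by simp
    qed
    ultimately show ?thesis by simp
  qed (use T[of 0] in auto)
  then show ?thesis by blast
qed

text \<open>
  If \<open>\<bar>mertens n\<bar> > \<alpha> n\<close> throughout the window from \<open>y\<close> to \<open>B * y\<close>, then \<open>mertens\<close> has a
  constant sign there, for it moves by steps of at most \<open>1\<close>. Its sum against \<open>1 / (n (n + 1))\<close> is then at
  least about \<open>\<alpha> ln B\<close> in absolute value, more than \<open>sum_mertens_over_square\<close> permits for large \<open>B\<close>.
\<close>

lemma mertens_small_somewhere:
  assumes "\<alpha> > 0"
  shows "\<exists>B\<ge>1. \<exists>y1\<ge>1. \<forall>y\<ge>y1. \<exists>n\<ge>y. n < B * y \<and> \<bar>mertens n\<bar> \<le> \<alpha> * real n"
proof -
  obtain A where A: "\<And>a b. \<bar>\<Sum>n=Suc a..b. mertens n * (1 / real n - 1 / real (Suc n))\<bar> \<le> A"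
    using sum_mertens_over_square by blast
  obtain B :: nat where B: "real B > 2 * exp (A / \<alpha>) + 2" using reals_Archimedean2 by blast
  obtain y1 :: nat where y1: "real y1 > 2 / \<alpha> + 1" using reals_Archimedean2 by blast
  have B1: "B \<ge> 1" "real B > 2" using B exp_gt_zero[of "A / \<alpha>"] by linarith+
  have "2 / \<alpha> > 0" using assms by simp
  then have "real y1 > 0" using y1 by linarith
  then have y1': "y1 \<ge> 1" by simp
  have "\<exists>n\<ge>y. n < B * y \<and> \<bar>mertens n\<bar> \<le> \<alpha> * real n" if y: "y \<ge> y1" for y
  proof (rule ccontr)
    assume "\<not> ?thesis"
    then have big: "\<bar>mertens n\<bar> > \<alpha> * real n" if "n \<ge> y" "n < B * y" for n using that by (auto simp: not_le)
    have big1: "\<bar>mertens n\<bar> > 2" if "n \<ge> y" "n < B * y" for n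
    proof -
      have "2 / \<alpha> < real n" using that y y1 by (simp add: less_eq_real_def flip: of_nat_le_iff)
      then have "2 < \<alpha> * real n" using assms by (simp add: divide_less_eq mult.commute)
      with big[OF that] show ?thesis by simp
    qed
    have sgn: "sgn (mertens n) = sgn (mertens y)" if "n \<ge> y" "n < B * y" for n
      using that
    proof (induction n rule: dec_induct)
      case (step n)
      have "\<bar>mertens (Suc n) - mertens n\<bar> \<le> 1" using mertens_diff[of n "Suc n"] by simp
      moreover have "\<bar>mertens n\<bar> > 2" using big1 step by auto
      moreover have "\<bar>mertens (Suc n)\<bar> > 2" using big1 step by auto
      ultimately have "sgn (mertens (Suc n)) = sgn (mertens n)" by (auto simp: sgn_if)
      then show ?case using step by simp
    qed simp
    define b where "b = B * y - 1"
    have y0: "y \<ge> 1" using y y1' by simp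
    have "y \<le> B * y" using B1 by simp
    have By: "B * y = Suc b" using B1 y0 by (simp add: b_def)
    have yb: "y \<le> b"
    proof -
      have "2 * real y < real B * real y" using B1 y0 by simp
      then have "2 * y < B * y" by (metis of_nat_less_iff of_nat_mult of_nat_numeral)
      then show ?thesis using y0 By by simp
    qed
    have "\<alpha> * (ln (real (Suc (Suc b))) - ln (real (Suc y))) \<le> (\<Sum>n=y..b. \<alpha> * (1 / real (Suc n)))"
    proof -
      have "ln (real (Suc (Suc b))) - ln (real (Suc y)) \<le> (\<Sum>n=y..b. 1 / real (Suc n))"
        using yb
      proof (induction b rule: dec_induct)
        case base
        show ?case using ln_Suc_diff_bounds(2)[of "Suc y"] by simp
      next
        case (step b)
        then show ?case using ln_Suc_diff_bounds(2)[of "Suc (Suc b)"] by simp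
      qed
      then show ?thesis
        unfolding sum_distrib_left [symmetric] using assms by (intro mult_left_mono) auto
    qed
    also have "\<dots> \<le> (\<Sum>n=y..b. sgn (mertens y) * (mertens n * (1 / real n - 1 / real (Suc n))))"
    proof (rule sum_mono)
      fix n assume "n \<in> {y..b}"
      then have n: "n \<ge> y" "n < B * y" using By by auto
      have n0: "n > 0" using n y0 by simp
      have "\<alpha> * (1 / real (Suc n)) = (\<alpha> * real n) * (1 / real n - 1 / real (Suc n))"
      proof -
        have "1 - real n / real (Suc n) = 1 / real (Suc n)" by (simp add: field_simps)
        then have "real n * (1 / real n - 1 / real (Suc n)) = 1 / real (Suc n)"
          using n0 by (simp add: right_diff_distrib)
        then show ?thesis by (simp only: mult.assoc)
      qed
      also have "\<dots> \<le> \<bar>mertens n\<bar> * (1 / real n - 1 / real (Suc n))"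
        using big[OF n] n0 by (intro mult_right_mono) (auto simp: frac_le)
      also have "\<bar>mertens n\<bar> = sgn (mertens y) * mertens n" unfolding sgn[OF n, symmetric] by (simp add: sgn_mult_self_eq abs_sgn mult.commute)
      finally show "\<alpha> * (1 / real (Suc n)) \<le> sgn (mertens y) * (mertens n * (1 / real n - 1 / real (Suc n)))"
        by (simp only: mult.assoc)
    qed
    also have "\<dots> = sgn (mertens y) * (\<Sum>n=Suc (y - 1)..b. mertens n * (1 / real n - 1 / real (Suc n)))"
      using y0 by (simp add: sum_distrib_left)
    also have "\<dots> \<le> \<bar>sgn (mertens y)\<bar> * \<bar>\<Sum>n=Suc (y - 1)..b. mertens n * (1 / real n - 1 / real (Suc n))\<bar>"
      unfolding abs_mult [symmetric] by (rule abs_ge_self)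
    also have "\<dots> \<le> 1 * A" using A[of "y - 1" b] by (intro mult_mono) (auto simp: sgn_if)
    finally have "\<alpha> * (ln (real (Suc (Suc b))) - ln (real (Suc y))) \<le> A" by simp
    then have "ln (real (Suc (Suc b))) - ln (real (Suc y)) \<le> A / \<alpha>"
      using assms by (simp add: pos_le_divide_eq mult.commute)
    moreover have "ln (real (Suc (Suc b))) - ln (real (Suc y)) = ln (real (Suc (Suc b)) / real (Suc y))"
      by (simp add: ln_div)
    ultimately have "ln (real (Suc (Suc b)) / real (Suc y)) \<le> A / \<alpha>" by simp
    then have "exp (ln (real (Suc (Suc b)) / real (Suc y))) \<le> exp (A / \<alpha>)"
      by (simp only: exp_le_cancel_iff)
    then have "real (Suc (Suc b)) / real (Suc y) \<le> exp (A / \<alpha>)"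
      by (subst (asm) exp_ln) auto
    moreover have "real B / 2 \<le> real (Suc (Suc b)) / real (Suc y)"
    proof -
      have "real (Suc b) = real B * real y" using By by (metis of_nat_mult)
      then have "real (Suc (Suc b)) = real B * real y + 1" by simp
      moreover have "real B * real (Suc y) \<le> 2 * (real B * real y)" using y0 B1 by (simp add: algebra_simps)
      ultimately show ?thesis by (simp add: field_simps)
    qed
    ultimately have "real B / 2 \<le> exp (A / \<alpha>)" by (rule order_trans[rotated])
    then show False using B by linarith
  qed
  with B1 y1' show ?thesis by blast
qed

text \<open>
  An interval \<open>[a, b]\<close> contains at least \<open>b - a - 1\<close> integers.
\<close>

lemma sum_inverse_interval_ge:
  fixes a b c :: real
  assumes "0 < a" "a \<le> b" and P: "\<And>d. a \<le> real d \<Longrightarrow> real d \<le> b \<Longrightarrow> d \<in> G"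
    and f: "\<And>d. a \<le> real d \<Longrightarrow> real d \<le> b \<Longrightarrow> f d \<ge> c" and c: "c \<ge> 0"
    and nonneg: "\<And>d. d \<in> G \<Longrightarrow> f d \<ge> 0" and fin: "finite G"
  shows "sum f G \<ge> (b - a - 1) * c"
proof -
  define I where "I = {nat \<lceil>a\<rceil>..nat \<lfloor>b\<rfloor>}"
  have I: "a \<le> real d \<and> real d \<le> b" if "d \<in> I" for d
    using that assms(1,2) by (auto simp: I_def nat_le_iff le_nat_iff ceiling_le_iff le_floor_iff)
  have "b - a - 1 \<le> real (card I)" using assms(1,2) unfolding I_def by (simp; linarith)
  then have "(b - a - 1) * c \<le> real (card I) * c" using c by (intro mult_right_mono) auto
  also have "\<dots> = (\<Sum>d\<in>I. c)" by simp
  also have "\<dots> \<le> sum f I" using I f by (intro sum_mono) auto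
  also have "\<dots> \<le> sum f G" using I P nonneg fin by (intro sum_mono2) auto
  finally show ?thesis .
qed

text \<open>
  Insert the bound \<open>\<beta>\<close> into the recursion: the weights \<open>ln d / d\<close> with \<open>d \<le> x\<close> have total mass about
  \<open>(ln x)\<^sup>2 / 2\<close>, which reproduces \<open>\<beta>\<close>. There is a gain from the small values \<open>\<nu> j\<close>, one in each
  window \<open>[B ^ j, B ^ (j + 1)]\<close>: by the Lipschitz property the bound is \<open>\<alpha> / 2\<close> instead of \<open>\<beta>\<close> from
  \<open>\<nu> j\<close> up to \<open>(1 + \<eta>) * \<nu> j\<close>. The \<open>d\<close> for which \<open>x div d\<close> lies in this interval have mass of order \<open>ln x\<close>, and the number of admissible \<open>j\<close> is of order \<open>ln x\<close> too, so a fixed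
  proportion of the total mass is affected. The gain \<open>\<kappa>\<close> depends on \<open>\<alpha>\<close> but not on \<open>\<beta>\<close>.
\<close>

lemma limsup_contraction:
  assumes \<alpha>: "0 < \<alpha>" "\<alpha> \<le> 1"
  shows "\<exists>\<kappa>>0. \<forall>\<beta>\<ge>\<alpha>. (\<forall>\<^sub>F n in sequentially. \<bar>mertens n\<bar> \<le> \<beta> * real n) \<longrightarrow>
            (\<forall>\<^sub>F n in sequentially. \<bar>mertens n\<bar> \<le> (\<beta> - \<kappa>) * real n)"
proof -
  \<comment> \<open>With this \<open>\<eta>\<close>, a bound \<open>\<alpha> / 4\<close> at \<open>\<nu> j\<close> worsens to at most \<open>\<alpha> / 2\<close> up to \<open>(1 + \<eta>) \<nu> j\<close>.\<close>
  define \<eta> where "\<eta> = \<alpha> / 8"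
  have \<eta>: "0 < \<eta>" "\<eta> \<le> 1 / 8" using \<alpha> by (auto simp: \<eta>_def)
  obtain K0 y1 where K0: "K0 \<ge> 1" "y1 \<ge> 1"
    and small: "\<And>y. y \<ge> y1 \<Longrightarrow> \<exists>n\<ge>y. n < K0 * y \<and> \<bar>mertens n\<bar> \<le> \<alpha> / 4 * real n"
    using mertens_small_somewhere[of "\<alpha> / 4"] \<alpha> by auto
  \<comment> \<open>The factor \<open>2\<close> keeps the stretched neighbourhoods of the \<open>\<nu> j\<close> disjoint.\<close>
  define B where "B = 2 * K0"
  have B: "B \<ge> 2" using K0 by (simp add: B_def)
  obtain j0 where j0: "B ^ j0 \<ge> y1"
  proof
    have "y1 < 2 ^ y1" by (rule less_exp)
    also have "2 ^ y1 \<le> B ^ y1" using B by (intro power_mono) auto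
    finally show "y1 \<le> B ^ y1" by simp
  qed
  have "\<exists>n. j \<ge> j0 \<longrightarrow> n \<ge> B ^ j \<and> n < K0 * B ^ j \<and> \<bar>mertens n\<bar> \<le> \<alpha> / 4 * real n" for j
  proof (cases "j \<ge> j0")
    case True
    then have "B ^ j0 \<le> B ^ j" using B by (intro power_increasing) auto
    then show ?thesis using small[of "B ^ j"] j0 by auto
  qed auto
  then obtain \<nu> where \<nu>: "\<And>j. j \<ge> j0 \<Longrightarrow> \<nu> j \<ge> B ^ j"
      "\<And>j. j \<ge> j0 \<Longrightarrow> \<nu> j < K0 * B ^ j" "\<And>j. j \<ge> j0 \<Longrightarrow> \<bar>mertens (\<nu> j)\<bar> \<le> \<alpha> / 4 * real (\<nu> j)"
    by metis
  have near: "\<bar>mertens z\<bar> \<le> \<alpha> / 2 * real z" if "j \<ge> j0" "\<nu> j \<le> z" "real z \<le> (1 + \<eta>) * real (\<nu> j)" for j z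
  proof -
    have "\<bar>mertens z - mertens (\<nu> j)\<bar> \<le> real z - real (\<nu> j)" using mertens_diff[OF that(2)] that(2) by (simp add: of_nat_diff)
    also have "\<dots> \<le> \<alpha> / 8 * real (\<nu> j)" using that(3) by (simp add: \<eta>_def algebra_simps)
    finally have "\<bar>mertens z\<bar> \<le> 3 / 8 * \<alpha> * real (\<nu> j)" using \<nu>(3)[OF that(1)] by linarith
    also have "\<dots> \<le> \<alpha> / 2 * real z" using that(2) \<alpha> by (intro mult_mono) auto
    finally show ?thesis .
  qed
  obtain C where C: "\<And>x. x \<ge> 1 \<Longrightarrow>
      \<bar>mertens x\<bar> * (ln x)\<^sup>2 \<le> 2 * (\<Sum>d=1..x. ln (real d) * \<bar>mertens (x div d)\<bar>) + C * x * (1 + ln x)"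
    using mertens_recursion by blast
  obtain g where g: "\<And>n. n \<ge> 1 \<Longrightarrow>
      \<bar>(\<Sum>m=1..n. ln (real m) / real m) - (ln n)\<^sup>2 / 2 - g\<bar> \<le> 6 / sqrt (real n)"
    using sum_ln_over_asymp by blast
  define I where "I = (\<lambda>x j. {d\<in>{1..x}. \<nu> j \<le> x div d \<and> real (x div d) \<le> (1 + \<eta>) * real (\<nu> j)})"
  have I_sum: "(\<Sum>d\<in>I x j. ln (real d) / real d) \<ge> \<eta> / 4 * ln x"
    if j: "j \<ge> j0" and x: "B ^ (2 * (j + 1)) \<le> x" "real x \<ge> 16 / \<eta>\<^sup>2" for x j
  proof -
    define n where "n = real (\<nu> j)"
    define X where "X = real x"
    have n1: "n \<ge> 1" using \<nu>(1)[OF j] B by (simp add: n_def) (metis One_nat_def Suc_leI le_trans neq0_conv not_numeral_le_zero of_nat_1 of_nat_le_iff power_not_zero)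
    have Bpos: "real B ^ (j + 1) > 0" using B by simp
    have X1: "X \<ge> 1"
    proof -
      have "1 \<le> B ^ (2 * (j + 1))" using B by (simp add: Suc_leI)
      then have "1 \<le> x" using x(1) by (rule order_trans)
      then show ?thesis by (simp add: X_def)
    qed
    have nB: "(1 + \<eta>) * n \<le> real B ^ (j + 1)"
    proof -
      have "(1 + \<eta>) * n \<le> 2 * (real K0 * real B ^ j)"
        using \<nu>(2)[OF j] \<eta> n1 unfolding n_def
        by (intro mult_mono) (auto simp flip: of_nat_mult of_nat_power)
      then show ?thesis by (simp add: B_def)
    qed
    have BX: "(real B ^ (j + 1))\<^sup>2 \<le> X"
    proof -
      have "(real B ^ (j + 1))\<^sup>2 = real (B ^ (2 * (j + 1)))"
        by (metis mult.commute of_nat_power power_mult)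
      also have "\<dots> \<le> X" unfolding X_def using x(1) by (simp only: of_nat_le_iff)
      finally show ?thesis .
    qed
    then have BsX: "real B ^ (j + 1) \<le> sqrt X" using Bpos by (intro real_le_rsqrt)
    define a b where "a = X / ((1 + \<eta>) * n)" and "b = X / n"
    have ab: "0 < a" "a \<le> b" using n1 \<eta> X1 by (auto simp: a_def b_def intro!: divide_left_mono)
    have a_sqrt: "sqrt X \<le> a"
    proof -
      have "sqrt X = X / sqrt X" using X1 by (simp add: real_div_sqrt)
      also have "\<dots> \<le> a" unfolding a_def using nB BsX X1 n1 \<eta> by (intro divide_left_mono) auto
      finally show ?thesis .
    qed
    define c where "c = (ln X / 2) / b"
    have lnX: "ln X \<ge> 0" using X1 by simp
    have "(b - a - 1) * c \<le> (\<Sum>d\<in>I x j. ln (real d) / real d)"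
    proof (rule sum_inverse_interval_ge[OF ab])
      fix d :: nat assume d: "a \<le> real d" "real d \<le> b"
      have d0: "d > 0" using d ab by (auto intro: Nat.gr0I)
      have "real d * n \<le> X" using d(2) n1 by (simp add: b_def le_divide_eq)
      then have dn: "d * \<nu> j \<le> x" unfolding n_def X_def by (metis of_nat_le_iff of_nat_mult)
      then have "\<nu> j \<le> x div d" using d0 by (simp add: less_eq_div_iff_mult_less_eq mult.commute)
      moreover have "real (x div d) \<le> (1 + \<eta>) * n"
      proof -
        have "X \<le> (1 + \<eta>) * n * real d" using d(1) n1 \<eta> by (simp add: a_def divide_le_eq mult.commute)
        then have "X / real d \<le> (1 + \<eta>) * n" using d0 by (simp add: divide_le_eq)
        then show ?thesis using of_nat_div_le_of_nat[of x d, where ?'a = real] unfolding X_def by linarith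
      qed
      moreover have "d \<le> x"
      proof -
        have "\<nu> j \<ge> 1" using n1 by (simp add: n_def)
        then have "d * 1 \<le> d * \<nu> j" by (intro mult_le_mono) auto
        with dn show ?thesis by linarith
      qed
      ultimately show "d \<in> I x j" using d0 by (simp add: I_def n_def)
      have "ln X / 2 = ln (sqrt X)" using X1 by (simp add: ln_sqrt)
      also have "\<dots> \<le> ln (real d)" using d a_sqrt X1 d0 by (subst ln_le_cancel_iff) auto
      finally have "ln X / 2 \<le> ln (real d)" .
      then show "c \<le> ln (real d) / real d" unfolding c_def using d d0 lnX by (intro frac_le) auto
    qed (use ab lnX in \<open>auto simp: c_def I_def\<close>)
    moreover have "\<eta> / 4 * ln X \<le> (b - a - 1) * c"
    proof -
      have "(b - a - 1) * c = (ln X / 2) * ((b - a - 1) / b)" by (simp add: c_def)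
      moreover have "(b - a - 1) / b = 1 - 1 / (1 + \<eta>) - n / X"
      proof -
        have "a / b = 1 / (1 + \<eta>)" "1 / b = n / X" using n1 X1 \<eta> by (auto simp: a_def b_def)
        then show ?thesis using ab by (simp add: diff_divide_distrib)
      qed
      moreover have "n / X \<le> \<eta> / 4"
      proof -
        have "n \<le> (1 + \<eta>) * n" using n1 \<eta> by simp
        then have "n / X \<le> sqrt X / X" using nB BsX X1 by (intro divide_right_mono) auto
        also have "\<dots> = 1 / sqrt X" using X1 by (simp add: real_div_sqrt field_simps)
        also have "\<dots> \<le> 1 / (4 / \<eta>)"
        proof (rule divide_left_mono)
          have "(4 / \<eta>)\<^sup>2 \<le> X" using x(2) by (simp add: power_divide X_def)
          then show "4 / \<eta> \<le> sqrt X" by (intro real_le_rsqrt)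
        qed (use \<eta> X1 in auto)
        finally show ?thesis by simp
      qed
      moreover have "1 - 1 / (1 + \<eta>) \<ge> 3 / 4 * \<eta>"
      proof -
        have "1 - 1 / (1 + \<eta>) = \<eta> / (1 + \<eta>)" using \<eta> by (simp add: field_simps)
        moreover have "3 / 4 * \<eta> * (1 + \<eta>) \<le> 3 / 4 * \<eta> * (9 / 8)" using \<eta> by (intro mult_left_mono) auto
        ultimately show ?thesis using \<eta> by (simp add: pos_le_divide_eq)
      qed
      ultimately have "(b - a - 1) * c \<ge> (ln X / 2) * (\<eta> / 2)"
        using lnX by (simp only:) (intro mult_left_mono, auto)
      then show ?thesis by (simp add: mult.commute)
    qed
    ultimately show ?thesis by (simp add: X_def)
  qed
  have I_disj: "I x i \<inter> I x j = {}" if "i \<ge> j0" "i < j" for x i j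
  proof (rule ccontr)
    assume "I x i \<inter> I x j \<noteq> {}"
    then obtain d where d: "real (x div d) \<le> (1 + \<eta>) * real (\<nu> i)" "\<nu> j \<le> x div d" by (auto simp: I_def)
    have pos: "real (\<nu> i) < real K0 * real B ^ i" using \<nu>(2)[OF that(1)] by (simp flip: of_nat_mult of_nat_power)
    have "real (B ^ (i + 1)) \<le> real (B ^ j)" using that B by (subst of_nat_le_iff, intro power_increasing) auto
    also have "\<dots> \<le> real (\<nu> j)" using \<nu>(1)[of j] that by (subst of_nat_le_iff) auto
    also have "\<dots> \<le> (1 + \<eta>) * real (\<nu> i)" using d by (meson of_nat_le_iff order_trans)
    also have "\<dots> \<le> 2 * real (\<nu> i)" using \<eta> by (intro mult_right_mono) auto
    also have "\<dots> < 2 * (real K0 * real B ^ i)" using pos by simp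
    also have "\<dots> = real (B ^ (i + 1))" by (simp add: B_def)
    finally show False by simp
  qed
  define \<kappa> where "\<kappa> = \<alpha> * \<eta> / (16 * ln (real B))"
  have lnB: "ln (real B) > 0" using B by simp
  have \<kappa>: "\<kappa> > 0" using \<alpha> \<eta> lnB by (simp add: \<kappa>_def)
  have "\<forall>\<^sub>F x in sequentially. \<bar>mertens x\<bar> \<le> (\<beta> - \<kappa>) * real x"
    if \<beta>: "\<beta> \<ge> \<alpha>" and ev: "\<forall>\<^sub>F n in sequentially. \<bar>mertens n\<bar> \<le> \<beta> * real n" for \<beta>
  proof -
    obtain n0 where n0: "\<And>n. n \<ge> n0 \<Longrightarrow> \<bar>mertens n\<bar> \<le> \<beta> * real n"
      using ev unfolding eventually_sequentially by blast
    define P Q where "P = 2 * \<beta> * (\<bar>g\<bar> + 6) + C" and "Q = (1 + real j0) * \<alpha> * \<eta> / 4 + 2 * real n0 + C"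
    have "\<forall>\<^sub>F x::nat in sequentially. P + Q * ln (real x) \<le> \<kappa> * (ln (real x))\<^sup>2"
      using \<kappa> by real_asymp
    moreover have "\<forall>\<^sub>F x::nat in sequentially. real x \<ge> 16 / \<eta>\<^sup>2" by real_asymp
    moreover have "\<forall>\<^sub>F x::nat in sequentially. x \<ge> 2" by (rule eventually_ge_at_top)
    ultimately show ?thesis
    proof eventually_elim
      case (elim x)
      define l where "l = ln (real x)"
      have x: "x \<ge> 1" and l: "l > 0" using elim by (auto simp: l_def)
      \<comment> \<open>For \<open>j < J\<close> the relevant \<open>d\<close> exceed \<open>sqrt x\<close>, so that \<open>ln d \<ge> ln x / 2\<close>.\<close>
      define J where "J = nat \<lfloor>l / (2 * ln (real B))\<rfloor>"
      define G where "G = (\<Union>j\<in>{j0..<J}. I x j)"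
      define w where "w = (\<lambda>d::nat. ln (real d) / real d)"
      have w_nonneg: "w d \<ge> 0" for d by (cases "d = 0") (auto simp: w_def)
      have G_sub: "G \<subseteq> {1..x}" by (auto simp: G_def I_def)
      have J: "real J \<ge> l / (2 * ln (real B)) - 1" using l lnB unfolding J_def by (simp; linarith)
      have Bx: "B ^ (2 * (j + 1)) \<le> x" if "j < J" for j
      proof -
        have "real (j + 1) \<le> real J" using that by simp
        also have "real J \<le> l / (2 * ln (real B))" using l lnB by (simp add: J_def)
        finally have "real (2 * (j + 1)) * ln (real B) \<le> l" using lnB by (simp add: le_divide_eq algebra_simps)
        moreover have "ln (real (B ^ k)) = real k * ln (real B)" for k
          using B by (simp add: ln_realpow)
        ultimately have "ln (real (B ^ (2 * (j + 1)))) \<le> ln (real x)"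
          by (simp only: l_def)
        then have "real (B ^ (2 * (j + 1))) \<le> real x"
          using B x by (subst (asm) ln_le_cancel_iff) auto
        then show ?thesis by (simp only: of_nat_le_iff)
      qed
      have "(l / (2 * ln (real B)) - 1 - real j0) * (\<eta> / 4 * l) \<le> real (card {j0..<J}) * (\<eta> / 4 * l)"
        using J l \<eta> by (intro mult_right_mono) auto
      also have "\<dots> = (\<Sum>j\<in>{j0..<J}. \<eta> / 4 * l)" by simp
      also have "\<dots> \<le> (\<Sum>j\<in>{j0..<J}. \<Sum>d\<in>I x j. w d)"
        unfolding w_def l_def using Bx elim by (intro sum_mono I_sum) auto
      also have "\<dots> = (\<Sum>d\<in>G. w d)"
        unfolding G_def
      proof (rule sum.UNION_disjoint [symmetric])
        show "\<forall>i\<in>{j0..<J}. \<forall>j\<in>{j0..<J}. i \<noteq> j \<longrightarrow> I x i \<inter> I x j = {}"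
          using I_disj by (metis Int_commute atLeastLessThan_iff linorder_neqE_nat)
      qed (auto simp: I_def)
      finally have G_sum: "(l / (2 * ln (real B)) - 1 - real j0) * (\<eta> / 4 * l) \<le> (\<Sum>d\<in>G. w d)" .
      \<comment> \<open>For these \<open>d\<close> the point \<open>x div d\<close> is too small for the bound \<open>\<beta>\<close>; the trivial bound \<open>1\<close> is used.\<close>
      define D where "D = {d\<in>{1..x}. x div d < n0}"
      have D_sum: "(\<Sum>d\<in>D. w d) \<le> real n0 * l"
      proof -
        have "(\<Sum>d\<in>D. w d) \<le> (\<Sum>d\<in>{1..x}. l * (real n0 / real x))"
        proof (rule order_trans[OF sum_mono sum_mono2])
          fix d assume "d \<in> D"
          then have d: "d \<ge> 1" "d \<le> x" "x div d < n0" by (auto simp: D_def)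
          then have "x < n0 * d" by (simp add: div_less_iff_less_mult)
          then have "real x \<le> real n0 * real d" by (metis less_imp_le of_nat_le_iff of_nat_mult)
          then have "1 / real d \<le> real n0 / real x" using d x by (simp add: field_simps)
          moreover have "ln (real d) \<le> l" using d by (simp add: l_def)
          ultimately have "ln (real d) * (1 / real d) \<le> l * (real n0 / real x)"
            using d l by (intro mult_mono) auto
          then show "w d \<le> l * (real n0 / real x)" by (simp add: w_def)
        qed (use l in \<open>auto simp: D_def\<close>)
        also have "\<dots> = real n0 * l" using x by simp
        finally show ?thesis .
      qed
      have W: "(\<Sum>d=1..x. w d) \<le> l\<^sup>2 / 2 + (\<bar>g\<bar> + 6)"
      proof -
        have "6 / sqrt (real x) \<le> 6" using x by (simp add: divide_le_eq)
        then show ?thesis using g[OF x] unfolding w_def l_def by linarith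
      qed
      have "(\<Sum>d=1..x. ln (real d) * \<bar>mertens (x div d)\<bar>) \<le>
          (\<Sum>d=1..x. real x * (\<beta> * w d - \<alpha> / 2 * (if d \<in> G then w d else 0) + (if d \<in> D then w d else 0)))"
      proof (rule sum_mono)
        fix d assume d: "d \<in> {1..x}"
        define v where "v = \<beta> - (if d \<in> G then \<alpha> / 2 else 0) + (if d \<in> D then 1 else 0)"
        have v: "v \<ge> 0" using \<alpha> \<beta> by (auto simp: v_def)
        have "\<bar>mertens (x div d)\<bar> \<le> v * real (x div d)"
        proof (cases "d \<in> D")
          case True
          then have "v \<ge> 1" using \<alpha> \<beta> by (auto simp: v_def)
          then have "1 * real (x div d) \<le> v * real (x div d)" by (intro mult_right_mono) auto
          then show ?thesis using abs_mertens_le[of "x div d"] by simp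
        next
          case notD: False
          show ?thesis
          proof (cases "d \<in> G")
            case True
            then obtain j where "j \<ge> j0" "\<nu> j \<le> x div d" "real (x div d) \<le> (1 + \<eta>) * real (\<nu> j)"
              by (auto simp: G_def I_def)
            then have "\<bar>mertens (x div d)\<bar> \<le> \<alpha> / 2 * real (x div d)" by (rule near)
            also have "\<dots> \<le> v * real (x div d)" using True notD \<beta> by (intro mult_right_mono) (auto simp: v_def)
            finally show ?thesis .
          next
            case False
            then show ?thesis using notD d n0[of "x div d"] by (auto simp: v_def D_def not_less)
          qed
        qed
        also have "\<dots> \<le> v * (real x / real d)" using v by (intro mult_left_mono of_nat_div_le_of_nat) auto
        finally have "ln (real d) * \<bar>mertens (x div d)\<bar> \<le> ln (real d) * (v * (real x / real d))"
          using d by (intro mult_left_mono) auto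
        also have "\<dots> = real x * (w d * v)" by (simp add: w_def)
        also have "w d * v = \<beta> * w d - \<alpha> / 2 * (if d \<in> G then w d else 0) + (if d \<in> D then w d else 0)"
          by (simp add: v_def algebra_simps)
        finally show "ln (real d) * \<bar>mertens (x div d)\<bar> \<le>
          real x * (\<beta> * w d - \<alpha> / 2 * (if d \<in> G then w d else 0) + (if d \<in> D then w d else 0))" .
      qed
      also have "\<dots> = real x * (\<beta> * (\<Sum>d=1..x. w d) - \<alpha> / 2 * (\<Sum>d\<in>G. w d) + (\<Sum>d\<in>D. w d))"
      proof -
        have "(\<Sum>d=1..x. if d \<in> G then w d else 0) = (\<Sum>d\<in>G. w d)"
          using G_sub by (simp add: sum.inter_restrict [symmetric] Int_absorb1)
        moreover have "(\<Sum>d=1..x. if d \<in> D then w d else 0) = (\<Sum>d\<in>D. w d)"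
          by (subst sum.inter_restrict [symmetric]) (auto simp: D_def intro!: sum.cong)
        ultimately show ?thesis
          by (simp only: sum_distrib_left [symmetric] sum.distrib sum_subtractf)
      qed
      also have "\<dots> \<le> real x * (\<beta> * (l\<^sup>2 / 2 + (\<bar>g\<bar> + 6)) -
          \<alpha> / 2 * ((l / (2 * ln (real B)) - 1 - real j0) * (\<eta> / 4 * l)) + real n0 * l)"
        using W G_sum D_sum \<alpha> \<beta> by (intro mult_left_mono add_mono diff_mono) auto
      finally have "\<bar>mertens x\<bar> * l\<^sup>2 \<le> 2 * (real x * (\<beta> * (l\<^sup>2 / 2 + (\<bar>g\<bar> + 6)) -
          \<alpha> / 2 * ((l / (2 * ln (real B)) - 1 - real j0) * (\<eta> / 4 * l)) + real n0 * l)) + C * x * (1 + l)"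
        using C[OF x] unfolding l_def by linarith
      also have "\<dots> = real x * (\<beta> * l\<^sup>2 - 2 * \<kappa> * l\<^sup>2 + (P + Q * l))"
        using lnB by (simp add: P_def Q_def \<kappa>_def field_simps power2_eq_square)
      also have "\<dots> \<le> real x * (\<beta> * l\<^sup>2 - 2 * \<kappa> * l\<^sup>2 + \<kappa> * l\<^sup>2)"
        using elim by (intro mult_left_mono add_left_mono) (auto simp: l_def)
      also have "\<dots> = ((\<beta> - \<kappa>) * real x) * l\<^sup>2" by (simp add: algebra_simps)
      finally show "\<bar>mertens x\<bar> \<le> (\<beta> - \<kappa>) * real x" using l by (simp add: mult_le_cancel_right)
    qed
  qed
  with \<kappa> show ?thesis by blast
qed

text \<open>
  Let \<open>\<alpha>\<close> be the infimum of the eventual bounds \<open>\<beta>\<close>. If it were positive, the contraction would lower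
  some \<open>\<beta> < \<alpha> + \<kappa>\<close> to a bound below \<open>\<alpha>\<close>.
\<close>

theorem mertens_little_o:
  assumes "e > 0"
  shows "\<forall>\<^sub>F n in sequentially. \<bar>mertens n\<bar> \<le> e * real n"
proof -
  define S where "S = {\<beta>. \<forall>\<^sub>F n in sequentially. \<bar>mertens n\<bar> \<le> \<beta> * real n}"
  have S_nonneg: "\<beta> \<ge> 0" if "\<beta> \<in> S" for \<beta>
  proof -
    from that obtain N where N: "\<And>n. n \<ge> N \<Longrightarrow> \<bar>mertens n\<bar> \<le> \<beta> * real n"
      by (auto simp: S_def eventually_sequentially)
    have "0 \<le> \<beta> * real (Suc N)" using N[of "Suc N"] by simp
    then show ?thesis by (simp add: zero_le_mult_iff)
  qed
  have "1 \<in> S" using abs_mertens_le by (simp add: S_def)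
  have bdd: "bdd_below S" using S_nonneg by (rule bdd_belowI)
  define \<alpha> where "\<alpha> = Inf S"
  have \<alpha>: "0 \<le> \<alpha>" "\<alpha> \<le> 1"
    using S_nonneg \<open>1 \<in> S\<close> cInf_lower[OF \<open>1 \<in> S\<close> bdd] by (auto simp: \<alpha>_def intro!: cInf_greatest)
  have "\<alpha> = 0"
  proof (rule ccontr)
    assume "\<alpha> \<noteq> 0"
    then obtain \<kappa> where \<kappa>: "\<kappa> > 0" and contr: "\<And>\<beta>. \<beta> \<ge> \<alpha> \<Longrightarrow> \<beta> \<in> S \<Longrightarrow> \<beta> - \<kappa> \<in> S"
      using limsup_contraction[of \<alpha>] \<alpha> unfolding S_def by auto
    obtain \<beta> where \<beta>: "\<beta> \<in> S" "\<beta> < \<alpha> + \<kappa>"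
      using cInf_lessD[of S "\<alpha> + \<kappa>"] \<open>1 \<in> S\<close> \<kappa> by (auto simp: \<alpha>_def)
    have "\<alpha> \<le> \<beta>" "\<alpha> \<le> \<beta> - \<kappa>"
      using cInf_lower[OF _ bdd] \<beta> contr by (auto simp: \<alpha>_def)
    with \<beta> show False by simp
  qed
  then obtain \<beta> where "\<beta> \<in> S" "\<beta> < e" using cInf_lessD[of S e] \<open>1 \<in> S\<close> assms by (auto simp: \<alpha>_def)
  then have "\<forall>\<^sub>F n in sequentially. \<bar>mertens n\<bar> \<le> \<beta> * real n" by (simp add: S_def)
  then show ?thesis
  proof eventually_elim
    case (elim n)
    have "\<beta> * real n \<le> e * real n" using \<open>\<beta> < e\<close> by (intro mult_right_mono) auto
    with elim show ?case by simp
  qed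
qed

end

section \<open>From the Moebius function to primes\<close>

lemma Lam_eq: "n > 0 \<Longrightarrow> Lam n = dconv (\<lambda>m. ln (real m)) moebius_mu n"
proof -
  assume n: "n > 0"
  have "Lam n = dconv moebius_mu (dconv (\<lambda>_. 1) Lam) n" using n by (simp add: dconv_mu_cancel)
  also have "\<dots> = dconv moebius_mu (\<lambda>m. ln (real m)) n"
    using n by (intro dconv_cong) (auto simp: dconv_commute[of "\<lambda>_. 1"] dconv_Lam_one)
  finally show ?thesis by (simp add: dconv_commute)
qed

text \<open>
  A prime power \<open>p ^ k \<le> x\<close> with \<open>k \<ge> 2\<close> has \<open>p \<le> sqrt x\<close> and \<open>k \<le> log 2 x\<close>.
\<close>

lemma card_nonprime_primepow_le:
  assumes "x \<ge> 1"
  shows "real (card {n\<in>{1..x}. primepow n \<and> \<not> prime n}) \<le> (sqrt (real x) + 1) * (ln (real x) / ln 2 + 1)"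
proof -
  define P where "P = {p. p\<^sup>2 \<le> x}"
  define E where "E = {k::nat. 2 ^ k \<le> x}"
  have P: "P \<subseteq> {0..nat \<lfloor>sqrt (real x)\<rfloor>}"
  proof
    fix p assume "p \<in> P"
    then have "real (p\<^sup>2) \<le> real x" unfolding P_def by (simp only: mem_Collect_eq of_nat_le_iff)
    then have "real p \<le> sqrt (real x)" by (intro real_le_rsqrt) simp
    then show "p \<in> {0..nat \<lfloor>sqrt (real x)\<rfloor>}" by (simp add: le_nat_iff le_floor_iff)
  qed
  have E: "E \<subseteq> {0..nat \<lfloor>ln (real x) / ln 2\<rfloor>}"
  proof
    fix k assume "k \<in> E"
    then have "real (2 ^ k) \<le> real x" unfolding E_def by (simp only: mem_Collect_eq of_nat_le_iff)
    then have "ln (real (2 ^ k)) \<le> ln (real x)" using assms by (subst ln_le_cancel_iff) auto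
    then have "real k * ln 2 \<le> ln (real x)" by (simp add: ln_realpow)
    then have "real k \<le> ln (real x) / ln 2" by (simp add: le_divide_eq)
    then have "int k \<le> \<lfloor>ln (real x) / ln 2\<rfloor>" by (simp add: le_floor_iff)
    then show "k \<in> {0..nat \<lfloor>ln (real x) / ln 2\<rfloor>}" by (simp add: le_nat_iff)
  qed
  have fin: "finite P" "finite E" using P E finite_subset by blast+
  have "{n\<in>{1..x}. primepow n \<and> \<not> prime n} \<subseteq> (\<lambda>(p, k). p ^ k) ` (P \<times> E)"
  proof
    fix n assume "n \<in> {n\<in>{1..x}. primepow n \<and> \<not> prime n}"
    then obtain p k where n: "n \<le> x" "\<not> prime n" "prime p" "k > 0" "n = p ^ k" by (auto simp: primepow_def)
    have "k \<noteq> 1" using n by (intro notI) simp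
    then have k: "k \<ge> 2" using n by linarith
    have p: "p \<ge> 2" using n by (simp add: prime_ge_2_nat)
    have "p ^ 2 \<le> p ^ k" using k p by (intro power_increasing) auto
    moreover have "2 ^ k \<le> p ^ k" using p by (intro power_mono) auto
    ultimately have "p \<in> P" "k \<in> E" using n(1) unfolding n(5) P_def E_def by (auto intro: order_trans)
    then show "n \<in> (\<lambda>(p, k). p ^ k) ` (P \<times> E)" using n by auto
  qed
  then have "card {n\<in>{1..x}. primepow n \<and> \<not> prime n} \<le> card ((\<lambda>(p, k). p ^ k) ` (P \<times> E))"
    using fin by (intro card_mono) auto
  also have "\<dots> \<le> card (P \<times> E)" using fin by (intro card_image_le) auto
  finally have "card {n\<in>{1..x}. primepow n \<and> \<not> prime n} \<le> card (P \<times> E)" .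
  also have "\<dots> \<le> (nat \<lfloor>sqrt (real x)\<rfloor> + 1) * (nat \<lfloor>ln (real x) / ln 2\<rfloor> + 1)"
    unfolding card_cartesian_product
    using card_mono[OF _ P] card_mono[OF _ E] by (intro mult_le_mono) auto
  finally have "real (card {n\<in>{1..x}. primepow n \<and> \<not> prime n}) \<le>
      real ((nat \<lfloor>sqrt (real x)\<rfloor> + 1) * (nat \<lfloor>ln (real x) / ln 2\<rfloor> + 1))"
    by (simp only: of_nat_le_iff)
  also have "\<dots> = (real (nat \<lfloor>sqrt (real x)\<rfloor>) + 1) * (real (nat \<lfloor>ln (real x) / ln 2\<rfloor>) + 1)"
    unfolding of_nat_mult of_nat_add of_nat_1 by (rule refl)
  also have "\<dots> \<le> (sqrt (real x) + 1) * (ln (real x) / ln 2 + 1)"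
    using assms by (intro mult_mono add_mono) auto
  finally show ?thesis .
qed

definition nonprime_Lam_sum :: "nat \<Rightarrow> real" where
  "nonprime_Lam_sum x = (\<Sum>n=1..x. if prime n then 0 else Lam n)"

lemma nonprime_Lam_sum_le:
  assumes "x \<ge> 1"
  shows "nonprime_Lam_sum x \<le> (sqrt (real x) + 1) * (ln (real x) / ln 2 + 1) * ln (real x)"
proof -
  have "nonprime_Lam_sum x \<le> (\<Sum>n=1..x. if primepow n \<and> \<not> prime n then ln (real x) else 0)"
    unfolding nonprime_Lam_sum_def
  proof (rule sum_mono)
    fix n assume n: "n \<in> {1..x}"
    then have "Lam n \<le> ln (real n)" by (intro mangoldt_le) auto
    also have "ln (real n) \<le> ln (real x)" using n by simp
    finally show "(if prime n then 0 else Lam n) \<le> (if primepow n \<and> \<not> prime n then ln (real x) else 0)"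
      using n by (auto simp: mangoldt_def)
  qed
  also have "\<dots> = real (card {n\<in>{1..x}. primepow n \<and> \<not> prime n}) * ln (real x)"
    by (simp add: sum.inter_filter [symmetric])
  also have "\<dots> \<le> (sqrt (real x) + 1) * (ln (real x) / ln 2 + 1) * ln (real x)"
    using assms by (intro mult_right_mono card_nonprime_primepow_le) auto
  finally show ?thesis .
qed

lemma nonprime_Lam_sum_little_o:
  assumes "e > 0"
  shows "\<forall>\<^sub>F x in sequentially. nonprime_Lam_sum x \<le> e * real x"
proof -
  have "\<forall>\<^sub>F x::nat in sequentially.
      (sqrt (real x) + 1) * (ln (real x) / ln 2 + 1) * ln (real x) \<le> e * real x"
    using assms by real_asymp
  with eventually_ge_at_top[of 1] show ?thesis
    by eventually_elim (use nonprime_Lam_sum_le order_trans in blast)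
qed

definition prime_count :: "nat \<Rightarrow> real" where
  "prime_count x = real (card {p. prime p \<and> p \<le> x})"

lemma finite_primes_le [simp]: "finite {p::nat. prime p \<and> p \<le> x}"
  by (rule finite_subset[of _ "{..x}"]) auto

lemma primes_le_eq: "{p::nat. prime p \<and> p \<le> x} = {p\<in>{1..x}. prime p}"
  by (auto simp: Suc_le_eq prime_gt_0_nat)

text \<open>
  The central binomial coefficient in logarithmic form: \<open>ln ((2 N)!) - 2 ln (N!)\<close>, which is about
  \<open>2 N ln 2\<close>, is a sum of the \<open>Lam d\<close> with weights \<open>0\<close> or \<open>1\<close>. Only primes matter, as the proper
  prime powers contribute \<open>o(x)\<close>.
\<close>

lemma chebyshev_lower:
  "\<forall>\<^sub>F x in sequentially. real x / 4 \<le> prime_count x * ln (real x)"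
proof -
  define \<psi> where "\<psi> = (\<lambda>x. \<Sum>n=1..x. Lam n)"
  have T: "(\<Sum>n=1..x. ln (real n)) = (\<Sum>d=1..x. Lam d * real (x div d))" for x
  proof -
    have "(\<Sum>n=1..x. ln (real n)) = (\<Sum>n=1..x. dconv Lam (\<lambda>_. 1) n)"
      by (intro sum.cong refl) (auto simp: dconv_Lam_one)
    also have "\<dots> = (\<Sum>d=1..x. Lam d * (\<Sum>m=1..x div d. 1))" by (rule sum_dconv)
    finally show ?thesis by simp
  qed
  have psi2: "2 * real N * ln 2 - 3 * (1 + ln (2 * real N)) \<le> \<psi> (2 * N)" if N: "N \<ge> 1" for N
  proof -
    have "(\<Sum>d=1..N. Lam d * real (N div d)) = (\<Sum>d=1..2*N. Lam d * real (N div d))"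
      by (rule sum.mono_neutral_left) auto
    then have "(\<Sum>n=1..2*N. ln (real n)) - 2 * (\<Sum>n=1..N. ln (real n)) =
        (\<Sum>d=1..2*N. Lam d * (real (2 * N div d) - 2 * real (N div d)))"
      unfolding T by (simp add: sum_subtractf right_diff_distrib sum_distrib_left mult_ac)
    also have "\<dots> \<le> (\<Sum>d=1..2*N. Lam d * 1)"
    proof (intro sum_mono mult_left_mono mangoldt_nonneg)
      fix d assume "d \<in> {1..2*N}"
      then have d: "d > 0" by simp
      have "2 * N div d \<le> 2 * (N div d) + 1"
      proof -
        have "N < (N div d + 1) * d" using d by (metis Suc_eq_plus1 dividend_less_div_times mult.commute mult_Suc add.commute)
        then have "2 * N < (2 * (N div d) + 2) * d" by (simp add: algebra_simps)
        then have "2 * N div d < 2 * (N div d) + 2" using d by (simp add: div_less_iff_less_mult)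
        then show ?thesis by simp
      qed
      then show "real (2 * N div d) - 2 * real (N div d) \<le> 1"
        by (simp add: of_nat_le_iff[where ?'a = real, symmetric] del: of_nat_le_iff)
    qed
    finally have 1: "(\<Sum>n=1..2*N. ln (real n)) - 2 * (\<Sum>n=1..N. ln (real n)) \<le> \<psi> (2 * N)"
      by (simp add: \<psi>_def)
    have 2: "(\<Sum>n=1..2*N. ln (real n)) \<ge> 2 * (real N * ln (2 * real N)) - 2 * real N - (1 + ln (2 * real N))"
      using sum_ln_bounds[of "2 * N"] N unfolding abs_le_iff by simp
    have 3: "(\<Sum>n=1..N. ln (real n)) \<le> real N * ln (real N) - real N + (1 + ln (real N))"
      using sum_ln_bounds[of N] N unfolding abs_le_iff by simp
    have 4: "ln (real N) \<le> ln (2 * real N)" "ln (2 * real N) = ln 2 + ln (real N)"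
      using N by (auto simp: ln_mult)
    have aux: "2 * n * ln 2 - 3 * (1 + L) \<le> p"
      if "a - 2 * b \<le> p" "a \<ge> 2 * (n * L) - 2 * n - (1 + L)" "b \<le> n * l - n + (1 + l)" "l \<le> L" "L = ln 2 + l"
      for a b p n l L :: real
    proof -
      have "n * L = n * ln 2 + n * l" using that(5) by (simp add: algebra_simps)
      then have "2 * (n * ln 2) - 3 - 3 * L \<le> p" using that(1-4) by linarith
      then show ?thesis by (simp add: algebra_simps)
    qed
    show ?thesis by (rule aux[OF 1 2 3 4])
  qed
  have psi_le: "\<psi> x \<le> prime_count x * ln (real x) + nonprime_Lam_sum x" if "x \<ge> 1" for x
  proof -
    have "\<psi> x = (\<Sum>n=1..x. if prime n then ln (real n) else 0) + nonprime_Lam_sum x"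
      unfolding \<psi>_def nonprime_Lam_sum_def sum.distrib [symmetric] by (intro sum.cong) auto
    also have "(\<Sum>n=1..x. if prime n then ln (real n) else 0) \<le> (\<Sum>n=1..x. if prime n then ln (real x) else 0)"
      by (intro sum_mono) auto
    also have "\<dots> = prime_count x * ln (real x)"
      by (simp add: prime_count_def primes_le_eq sum.inter_filter [symmetric])
    finally show ?thesis by simp
  qed
  have "\<forall>\<^sub>F x::nat in sequentially. real x / 4 \<le> (real x - 1) * ln 2 - 3 * (1 + ln (real x)) - (1/100) * real x"
  proof -
    have "ln (1 / 2 :: real) \<le> 1 / 2 - 1" by (rule ln_le_minus_one) simp
    then have "(26/100 :: real) < ln 2" by (simp add: ln_div)
    then have "\<forall>\<^sub>F x::nat in sequentially. 0 \<le> (ln 2 - 26/100) * real x - ln 2 - 3 * (1 + ln (real x))"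
      by real_asymp
    then show ?thesis by eventually_elim (simp add: algebra_simps)
  qed
  moreover have "\<forall>\<^sub>F x in sequentially. nonprime_Lam_sum x \<le> (1/100) * real x"
    by (rule nonprime_Lam_sum_little_o) simp
  ultimately show ?thesis using eventually_ge_at_top[of 2]
  proof eventually_elim
    case (elim x)
    define N where "N = x div 2"
    have N: "N \<ge> 1" "2 * N \<le> x" "x \<le> 2 * N + 1" using elim by (auto simp: N_def)
    have "(real x - 1) * ln 2 \<le> 2 * real N * ln 2" using N by (intro mult_right_mono) auto
    moreover have "ln (2 * real N) \<le> ln (real x)" using N by (subst ln_le_cancel_iff) auto
    moreover have "\<psi> (2 * N) \<le> \<psi> x"
      unfolding \<psi>_def using N by (intro sum_mono2) (auto simp: mangoldt_nonneg)
    moreover have "\<psi> x \<le> prime_count x * ln (real x) + nonprime_Lam_sum x"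
      using elim by (intro psi_le) simp
    ultimately show ?case using psi2[OF N(1)] elim(1,2) unfolding distrib_left by linarith
  qed
qed

context bounded_real_character
begin

lemma sum_chi_ln_bound: "\<bar>\<Sum>m=1..y. \<chi> m * ln (real m)\<bar> \<le> 6 * K * sqrt (real y)"
proof (cases "y = 0")
  case False
  define w where "w = (\<lambda>m. max 0 (ln (real y) - ln (real m)))"
  have "\<bar>\<Sum>m=Suc 0..y. \<chi> m * w m\<bar> \<le> 2 * K * w (Suc 0)"
  proof (rule abel_bound)
    show "w (Suc n) \<le> w n" if "n > 0" for n
      unfolding w_def using that by (intro max.mono) auto
  qed (auto simp: w_def)
  also have "w (Suc 0) = ln (real y)" using False by (simp add: w_def)
  also have "(\<Sum>m=Suc 0..y. \<chi> m * w m) = (\<Sum>m=1..y. \<chi> m * ln (real y) - \<chi> m * ln (real m))"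
    by (intro sum.cong) (auto simp: w_def max_def algebra_simps)
  also have "\<dots> = ln (real y) * (\<Sum>m=1..y. \<chi> m) - (\<Sum>m=1..y. \<chi> m * ln (real m))"
    by (simp add: sum_subtractf sum_distrib_left mult.commute)
  finally have 1: "\<bar>ln (real y) * (\<Sum>m=1..y. \<chi> m) - (\<Sum>m=1..y. \<chi> m * ln (real m))\<bar> \<le> 2 * K * ln (real y)" .
  have *: "\<bar>ln (real y) * (\<Sum>m=1..y. \<chi> m)\<bar> \<le> ln (real y) * K"
    using sums[of y] False unfolding abs_mult by (intro mult_mono) auto
  have aux: "\<bar>b\<bar> \<le> 3 * K * l" if "\<bar>a - b\<bar> \<le> 2 * K * l" "\<bar>a\<bar> \<le> l * K" for a b l :: real
    using that by (simp add: abs_le_iff algebra_simps)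
  have "\<bar>\<Sum>m=1..y. \<chi> m * ln (real m)\<bar> \<le> 3 * K * ln (real y)" by (rule aux[OF 1 *])
  also have "\<dots> \<le> 3 * K * (2 * sqrt (real y))"
    using K_nonneg False by (intro mult_left_mono ln_le_sqrt) auto
  finally show ?thesis by simp
qed simp

text \<open>
  The twisted \<open>Lam\<close> is the convolution of \<open>\<chi> ln\<close> and \<open>\<chi> \<mu>\<close>. In the hyperbola method with a constant
  \<open>B\<close>, the part \<open>m \<le> B\<close> consists of boundedly many terms \<open>mertens (x div m) = o(x)\<close>, and the part
  \<open>m > B\<close> is \<open>O(x / sqrt B)\<close> because the sums of \<open>\<chi> ln\<close> up to \<open>y\<close> are \<open>O(sqrt y)\<close>.
\<close>

lemma sum_chi_Lam_little_o:
  assumes e: "e > 0"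
  shows "\<forall>\<^sub>F x in sequentially. \<bar>\<Sum>n=1..x. \<chi> n * Lam n\<bar> \<le> e * real x"
proof -
  \<comment> \<open>\<open>B\<close> makes the part \<open>m > B\<close> at most \<open>e / 2 * x\<close>, and \<open>\<delta>\<close> then does the same for \<open>m \<le> B\<close>.\<close>
  obtain B :: nat where B: "real B > (48 * K / e)\<^sup>2" using reals_Archimedean2 by blast
  define W where "W = 1 + (\<Sum>m=1..B. ln (real m) / real m)"
  have W: "W \<ge> 1" by (auto simp: W_def intro!: sum_nonneg)
  define \<delta> where "\<delta> = e / (2 * W)"
  have \<delta>: "\<delta> > 0" using e W by (simp add: \<delta>_def)
  obtain n0 where n0: "\<And>n. n \<ge> n0 \<Longrightarrow> \<bar>mertens n\<bar> \<le> \<delta> * real n"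
    using mertens_little_o[OF \<delta>] unfolding eventually_sequentially by blast
  have main: "\<bar>\<Sum>n=1..x. \<chi> n * Lam n\<bar> \<le> e * real x" if x: "x \<ge> 1" "x \<ge> B" "x \<ge> B * n0" for x
  proof -
    define F where "F = (\<lambda>m d. \<chi> m * ln (real m) * (moebius_mu d * \<chi> d))"
    have "(\<Sum>n=1..x. \<chi> n * Lam n) = (\<Sum>n=1..x. \<Sum>m | m dvd n. F m (n div m))"
    proof (intro sum.cong refl)
      fix n assume "n \<in> {1..x}"
      then have n: "n > 0" by simp
      have "\<chi> n * Lam n = dconv (\<lambda>m. ln (real m) * \<chi> m) (\<lambda>d. moebius_mu d * \<chi> d) n"
        using n by (simp add: Lam_eq twist_dconv)
      then show "\<chi> n * Lam n = (\<Sum>m | m dvd n. F m (n div m))" by (simp add: dconv_def F_def mult_ac)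
    qed
    also have "\<dots> = (\<Sum>m=1..x. \<Sum>d=1..x div m. F m d)" by (rule sum_divisors_swap)
    also have "\<dots> = (\<Sum>m=1..B. \<Sum>d=1..x div m. F m d) + (\<Sum>d=1..x div Suc B. \<Sum>m=Suc B..x div d. F m d)"
      by (rule sum_hyperbola[OF x(2)])
    finally have eq: "(\<Sum>n=1..x. \<chi> n * Lam n) =
      (\<Sum>m=1..B. \<Sum>d=1..x div m. F m d) + (\<Sum>d=1..x div Suc B. \<Sum>m=Suc B..x div d. F m d)" .
    have "\<bar>\<Sum>m=1..B. \<Sum>d=1..x div m. F m d\<bar> = \<bar>\<Sum>m=1..B. \<chi> m * ln (real m) * mertens (x div m)\<bar>"
      by (simp add: F_def mertens_def sum_distrib_left)
    also have "\<dots> \<le> (\<Sum>m=1..B. \<delta> * real x * (ln (real m) / real m))"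
    proof (intro order_trans[OF sum_abs] sum_mono)
      fix m assume "m \<in> {1..B}"
      then have m: "m \<ge> 1" "m \<le> B" by auto
      have "m * n0 \<le> B * n0" using m by (intro mult_le_mono) auto
      then have "m * n0 \<le> x" using x(3) by (rule order_trans)
      then have "n0 * m \<le> x" by (simp only: mult.commute)
      then have "n0 \<le> x div m" using m by (simp add: less_eq_div_iff_mult_less_eq)
      then have "\<bar>mertens (x div m)\<bar> \<le> \<delta> * real (x div m)" by (rule n0)
      also have "\<dots> \<le> \<delta> * (real x / real m)" using \<delta> by (intro mult_left_mono of_nat_div_le_of_nat) auto
      finally have "\<bar>\<chi> m * ln (real m)\<bar> * \<bar>mertens (x div m)\<bar> \<le> (1 * ln (real m)) * (\<delta> * (real x / real m))"
        using m abs_le_1[of m] unfolding abs_mult[of "\<chi> m"] by (intro mult_mono) auto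
      then show "\<bar>\<chi> m * ln (real m) * mertens (x div m)\<bar> \<le> \<delta> * real x * (ln (real m) / real m)"
        by (simp add: abs_mult mult_ac)
    qed
    also have "\<dots> = \<delta> * real x * (W - 1)" by (simp add: W_def sum_distrib_left)
    also have "\<dots> \<le> \<delta> * real x * W" using \<delta> by (intro mult_left_mono) auto
    also have "\<dots> = e / 2 * real x" using W by (simp add: \<delta>_def)
    finally have 1: "\<bar>\<Sum>m=1..B. \<Sum>d=1..x div m. F m d\<bar> \<le> e / 2 * real x" .
    define T where "T = (\<lambda>y. \<Sum>m=1..y. \<chi> m * ln (real m))"
    have "\<bar>\<Sum>d=1..x div Suc B. \<Sum>m=Suc B..x div d. F m d\<bar> \<le> (\<Sum>d=1..x div Suc B. 12 * K * sqrt (real x / real d))"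
    proof (rule order_trans[OF sum_abs], rule sum_mono)
      fix d assume "d \<in> {1..x div Suc B}"
      then have d: "d \<ge> 1" "d \<le> x div Suc B" by auto
      then have "d * Suc B \<le> x" by (simp add: less_eq_div_iff_mult_less_eq del: mult_Suc_right)
      then have "Suc B * d \<le> x" by (simp only: mult.commute)
      then have Bd: "Suc B \<le> x div d" using d by (simp add: less_eq_div_iff_mult_less_eq del: mult_Suc_right mult_Suc)
      then have "{1..x div d} = {1..B} \<union> {Suc B..x div d}" by auto
      then have "T (x div d) = T B + (\<Sum>m=Suc B..x div d. \<chi> m * ln (real m))"
        by (simp add: T_def sum.union_disjoint)
      then have "(\<Sum>m=Suc B..x div d. F m d) = moebius_mu d * \<chi> d * (T (x div d) - T B)"
        by (simp add: F_def sum_distrib_left mult_ac)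
      then have "\<bar>\<Sum>m=Suc B..x div d. F m d\<bar> \<le> 1 * \<bar>T (x div d) - T B\<bar>"
        using abs_term_le_1[of d] by (simp only: abs_mult[of "moebius_mu d * \<chi> d"]) (intro mult_right_mono, auto)
      also have "\<bar>T (x div d) - T B\<bar> \<le> \<bar>T (x div d)\<bar> + \<bar>T B\<bar>" by (rule abs_triangle_ineq4)
      also have "\<dots> \<le> 6 * K * sqrt (real (x div d)) + 6 * K * sqrt (real B)"
        unfolding T_def by (intro add_mono sum_chi_ln_bound)
      also have "\<dots> \<le> 6 * K * sqrt (real x / real d) + 6 * K * sqrt (real x / real d)"
      proof -
        have le: "real (x div d) \<le> real x / real d" by (rule of_nat_div_le_of_nat)
        have "real B \<le> real (x div d)" using Bd by simp
        then have "real B \<le> real x / real d" using le by (rule order_trans)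
        then have "sqrt (real (x div d)) \<le> sqrt (real x / real d)" "sqrt (real B) \<le> sqrt (real x / real d)"
          using le by (auto intro!: real_sqrt_le_mono)
        then show ?thesis using K_nonneg by (intro add_mono mult_left_mono) auto
      qed
      finally show "\<bar>\<Sum>m=Suc B..x div d. F m d\<bar> \<le> 12 * K * sqrt (real x / real d)" by simp
    qed
    also have "\<dots> = 12 * K * sqrt (real x) * (\<Sum>d=1..x div Suc B. 1 / sqrt (real d))"
      by (simp add: sum_distrib_left real_sqrt_divide)
    also have "\<dots> \<le> 12 * K * sqrt (real x) * (2 * sqrt (real x / real (Suc B)))"
    proof (rule mult_left_mono)
      have "sqrt (real (x div Suc B)) \<le> sqrt (real x / real (Suc B))"
        by (intro real_sqrt_le_mono of_nat_div_le_of_nat)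
      then show "(\<Sum>d=1..x div Suc B. 1 / sqrt (real d)) \<le> 2 * sqrt (real x / real (Suc B))"
        using sum_inverse_sqrt_le[of "x div Suc B"] by linarith
    qed (use K_nonneg in auto)
    also have "\<dots> = (24 * K / sqrt (real (Suc B))) * real x"
      by (simp add: real_sqrt_divide)
    also have "\<dots> \<le> e / 2 * real x"
    proof (rule mult_right_mono)
      have "48 * K / e \<le> sqrt (real (Suc B))" using B by (intro real_le_rsqrt) auto
      then have "48 * K \<le> e * sqrt (real (Suc B))" using e by (simp add: divide_le_eq mult.commute)
      then have "24 * K \<le> e / 2 * sqrt (real (Suc B))" by simp
      then show "24 * K / sqrt (real (Suc B)) \<le> e / 2" by (subst divide_le_eq) auto
    qed simp
    finally have 2: "\<bar>\<Sum>d=1..x div Suc B. \<Sum>m=Suc B..x div d. F m d\<bar> \<le> e / 2 * real x" .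
    have "\<bar>\<Sum>n=1..x. \<chi> n * Lam n\<bar> \<le> e / 2 * real x + e / 2 * real x"
      unfolding eq by (rule order_trans[OF abs_triangle_ineq add_mono[OF 1 2]])
    then show ?thesis by simp
  qed
  show ?thesis
    using eventually_ge_at_top[of "1 + B + B * n0"] by eventually_elim (rule main, auto)
qed

definition theta :: "nat \<Rightarrow> real" where
  "theta x = (\<Sum>n=1..x. if prime n then \<chi> n * ln (real n) else 0)"

lemma theta_little_o:
  assumes e: "e > 0"
  shows "\<forall>\<^sub>F x in sequentially. \<bar>theta x\<bar> \<le> e * real x"
proof -
  have e2: "e / 2 > 0" using e by simp
  have diff: "\<bar>(\<Sum>n=1..x. \<chi> n * Lam n) - theta x\<bar> \<le> nonprime_Lam_sum x" for x
    unfolding theta_def nonprime_Lam_sum_def sum_subtractf [symmetric]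
  proof (intro order_trans[OF sum_abs] sum_mono)
    fix n assume "n \<in> {1..x}"
    have "\<bar>\<chi> n\<bar> * Lam n \<le> 1 * Lam n" by (intro mult_right_mono abs_le_1 mangoldt_nonneg)
    then show "\<bar>\<chi> n * Lam n - (if prime n then \<chi> n * ln (real n) else 0)\<bar> \<le> (if prime n then 0 else Lam n)"
      by (auto simp: abs_mult mangoldt_nonneg)
  qed
  from sum_chi_Lam_little_o[OF e2] nonprime_Lam_sum_little_o[OF e2] show ?thesis
  proof eventually_elim
    case (elim x)
    have "\<bar>theta x\<bar> \<le> \<bar>\<Sum>n=1..x. \<chi> n * Lam n\<bar> + \<bar>(\<Sum>n=1..x. \<chi> n * Lam n) - theta x\<bar>" by arith
    also have "\<dots> \<le> e / 2 * real x + e / 2 * real x" using elim diff[of x] by (intro add_mono) auto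
    finally show ?case by simp
  qed
qed

definition prime_char_sum :: "nat \<Rightarrow> real" where
  "prime_char_sum x = (\<Sum>p | prime p \<and> p \<le> x. \<chi> p)"

text \<open>
  Partial summation removes the weights \<open>ln n\<close> from \<open>theta\<close>.
\<close>

lemma prime_char_sum_abel:
  "x \<ge> 2 \<Longrightarrow> prime_char_sum x = theta x / ln (real x) +
     (\<Sum>n=2..<x. theta n * (1 / ln (real n) - 1 / ln (real (Suc n))))"
proof (induction x rule: dec_induct)
  case base
  have "{p::nat. prime p \<and> p \<le> 2} = {2}" by (auto dest: prime_ge_2_nat)
  moreover have "theta 2 = \<chi> 2 * ln 2"
  proof -
    have "{1..2::nat} = {1, 2}" by auto
    then show ?thesis by (simp add: theta_def)
  qed
  ultimately show ?case by (simp add: prime_char_sum_def)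
next
  case (step x)
  have "prime_char_sum (Suc x) = prime_char_sum x + (if prime (Suc x) then \<chi> (Suc x) else 0)"
  proof -
    have "prime_char_sum y = (\<Sum>n\<in>{1..y}. if prime n then \<chi> n else 0)" for y
      unfolding prime_char_sum_def primes_le_eq by (rule sum.inter_filter) simp
    then show ?thesis by simp
  qed
  moreover have "theta (Suc x) = theta x + (if prime (Suc x) then \<chi> (Suc x) * ln (real (Suc x)) else 0)"
    by (simp add: theta_def)
  moreover have "ln (real (Suc x)) > 0" using step.hyps by simp
  ultimately show ?case using step by (simp add: algebra_simps add_divide_distrib)
qed

text \<open>
  The range is cut at \<open>sqrt x\<close>, beyond which \<open>ln n \<ge> ln x / 2\<close>.
\<close>

lemma sum_inverse_ln_squared_le:
  assumes "x \<ge> 4"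
  shows "(\<Sum>n=2..<x. 1 / (ln (real n))\<^sup>2) \<le> (sqrt (real x) + 1) / (ln 2)\<^sup>2 + 4 * real x / (ln (real x))\<^sup>2"
proof -
  define I where "I = {n\<in>{2..<x}. real n \<le> sqrt (real x)}"
  have "(\<Sum>n=2..<x. 1 / (ln (real n))\<^sup>2) \<le>
      (\<Sum>n=2..<x. (if real n \<le> sqrt (real x) then 1 / (ln 2)\<^sup>2 else 0) + 4 / (ln (real x))\<^sup>2)"
  proof (rule sum_mono)
    fix n assume n: "n \<in> {2..<x}"
    have lx: "ln (real x) > 0" using assms by simp
    show "1 / (ln (real n))\<^sup>2 \<le> (if real n \<le> sqrt (real x) then 1 / (ln 2)\<^sup>2 else 0) + 4 / (ln (real x))\<^sup>2"
    proof (cases "real n \<le> sqrt (real x)")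
      case True
      have "(ln 2)\<^sup>2 \<le> (ln (real n))\<^sup>2" using n by (intro power_mono) auto
      then have "1 / (ln (real n))\<^sup>2 \<le> 1 / (ln 2)\<^sup>2" using n by (intro divide_left_mono) auto
      then show ?thesis using True by (simp add: add_increasing2)
    next
      case False
      then have "sqrt (real x) \<le> real n" by simp
      then have "ln (sqrt (real x)) \<le> ln (real n)" using assms n by (subst ln_le_cancel_iff) auto
      then have "ln (real x) / 2 \<le> ln (real n)" using assms by (simp add: ln_sqrt)
      then have "(ln (real x) / 2)\<^sup>2 \<le> (ln (real n))\<^sup>2" using lx by (intro power_mono) auto
      then have "1 / (ln (real n))\<^sup>2 \<le> 1 / (ln (real x) / 2)\<^sup>2" using lx n by (intro divide_left_mono) auto
      then show ?thesis using False by (simp add: power_divide)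
    qed
  qed
  also have "\<dots> = real (card I) * (1 / (ln 2)\<^sup>2) + real (x - 2) * (4 / (ln (real x))\<^sup>2)"
    by (simp add: sum.distrib I_def sum.inter_filter [symmetric])
  also have "\<dots> \<le> (sqrt (real x) + 1) * (1 / (ln 2)\<^sup>2) + real x * (4 / (ln (real x))\<^sup>2)"
  proof (intro add_mono mult_right_mono)
    have "I \<subseteq> {0..nat \<lfloor>sqrt (real x)\<rfloor>}" by (auto simp: I_def le_nat_iff le_floor_iff)
    then have "card I \<le> nat \<lfloor>sqrt (real x)\<rfloor> + 1" using card_mono[of "{0..nat \<lfloor>sqrt (real x)\<rfloor>}" I] by simp
    then have "real (card I) \<le> real (nat \<lfloor>sqrt (real x)\<rfloor>) + 1" by linarith
    also have "\<dots> \<le> sqrt (real x) + 1" by simp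
    finally show "real (card I) \<le> sqrt (real x) + 1" .
  qed auto
  finally show ?thesis by (simp add: mult.commute)
qed

text \<open>
  From \<open>theta x = o(x)\<close> partial summation gives \<open>o(x / ln x)\<close>, and by Chebyshev's lower bound this is
  small against the number of primes.
\<close>

theorem prime_char_sum_little_o:
  "(\<lambda>x. prime_char_sum x / prime_count x) \<longlonglongrightarrow> 0"
proof (rule LIMSEQ_I)
  fix r :: real assume r: "r > 0"
  define e where "e = r / 16"
  have e: "e > 0" using r by (simp add: e_def)
  obtain C where C: "\<And>n. \<bar>theta n\<bar> \<le> C * real n" "C \<ge> 0"
  proof -
    obtain n0 where n0: "\<And>n. n \<ge> n0 \<Longrightarrow> \<bar>theta n\<bar> \<le> 1 * real n"
      using theta_little_o[of 1] unfolding eventually_sequentially by auto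
    define C where "C = 1 + (\<Sum>n\<le>n0. \<bar>theta n\<bar>)"
    have C1: "C \<ge> 1" by (simp add: C_def sum_nonneg)
    have "\<bar>theta n\<bar> \<le> C * real n" for n
    proof (cases "n \<ge> n0 \<or> n = 0")
      case True
      have "1 * real n \<le> C * real n" using C1 by (intro mult_right_mono) auto
      then show ?thesis using True n0[of n] by (auto simp: theta_def)
    next
      case False
      then have "\<bar>theta n\<bar> \<le> (\<Sum>n\<le>n0. \<bar>theta n\<bar>)" by (intro member_le_sum) auto
      also have "\<dots> \<le> C * 1" by (simp add: C_def)
      also have "\<dots> \<le> C * real n" using C1 False by (intro mult_left_mono) auto
      finally show ?thesis .
    qed
    with C1 show ?thesis by (intro that[of C]) auto
  qed
  have "\<forall>\<^sub>F x::nat in sequentially.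
      C * ((sqrt (real x) + 1) / (ln 2)\<^sup>2 + 4 * real x / (ln (real x))\<^sup>2) * ln (real x) \<le> e * real x"
    using e by real_asymp
  moreover note theta_little_o[OF e]
  moreover note chebyshev_lower
  moreover note eventually_ge_at_top[of "4::nat"]
  ultimately have "\<forall>\<^sub>F x in sequentially. norm (prime_char_sum x / prime_count x - 0) < r"
  proof eventually_elim
    case (elim x)
    have lx: "ln (real x) > 0" using elim by simp
    have "\<bar>\<Sum>n=2..<x. theta n * (1 / ln (real n) - 1 / ln (real (Suc n)))\<bar> \<le> (\<Sum>n=2..<x. C * (1 / (ln (real n))\<^sup>2))"
    proof (intro order_trans[OF sum_abs] sum_mono)
      fix n assume n: "n \<in> {2..<x}"
      have ln: "ln (real n) > 0" "ln (real n) \<le> ln (real (Suc n))" using n by auto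
      have "1 / ln (real n) - 1 / ln (real (Suc n)) = (ln (real (Suc n)) - ln (real n)) / (ln (real n) * ln (real (Suc n)))"
      proof -
        have "1 / a - 1 / b = (b - a) / (a * b)" if "a > 0" "b > 0" for a b :: real
          using that by (simp add: field_simps)
        then show ?thesis using ln by (meson less_le_trans)
      qed
      also have "\<dots> \<le> (1 / real n) / (ln (real n) * ln (real n))"
        using ln n ln_Suc_diff_bounds(2)[of n] by (intro frac_le mult_left_mono mult_pos_pos) auto
      finally have le: "1 / ln (real n) - 1 / ln (real (Suc n)) \<le> (1 / real n) / (ln (real n))\<^sup>2"
        by (simp add: power2_eq_square)
      have "1 / ln (real n) - 1 / ln (real (Suc n)) \<ge> 0" using ln by (simp add: frac_le)
      then have "\<bar>theta n\<bar> * \<bar>1 / ln (real n) - 1 / ln (real (Suc n))\<bar> \<le> (C * real n) * ((1 / real n) / (ln (real n))\<^sup>2)"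
        using le C by (intro mult_mono) auto
      also have "\<dots> = C * (1 / (ln (real n))\<^sup>2)" using n by simp
      finally show "\<bar>theta n * (1 / ln (real n) - 1 / ln (real (Suc n)))\<bar> \<le> C * (1 / (ln (real n))\<^sup>2)"
        by (simp only: abs_mult)
    qed
    also have "\<dots> \<le> C * ((sqrt (real x) + 1) / (ln 2)\<^sup>2 + 4 * real x / (ln (real x))\<^sup>2)"
      unfolding sum_distrib_left [symmetric]
      using sum_inverse_ln_squared_le[of x] C elim by (intro mult_left_mono) auto
    finally have "\<bar>\<Sum>n=2..<x. theta n * (1 / ln (real n) - 1 / ln (real (Suc n)))\<bar> * ln (real x) \<le> e * real x"
      using elim lx by (meson mult_right_mono order_trans less_imp_le)
    moreover have "\<bar>theta x / ln (real x)\<bar> * ln (real x) \<le> e * real x" using elim lx by (simp add: abs_divide)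
    moreover have "\<bar>prime_char_sum x\<bar> \<le> \<bar>theta x / ln (real x)\<bar> +
        \<bar>\<Sum>n=2..<x. theta n * (1 / ln (real n) - 1 / ln (real (Suc n)))\<bar>"
    proof -
      have x2: "x \<ge> 2" using elim by simp
      show ?thesis unfolding prime_char_sum_abel[OF x2] by (rule abs_triangle_ineq)
    qed
    ultimately have "\<bar>prime_char_sum x\<bar> * ln (real x) \<le> 2 * e * real x"
      using lx by (smt (verit) mult_right_mono distrib_right)
    also have "\<dots> = r / 2 * (real x / 4)" by (simp add: e_def)
    also have "\<dots> \<le> r / 2 * (prime_count x * ln (real x))" using elim r by (intro mult_left_mono) auto
    finally have "\<bar>prime_char_sum x\<bar> * ln (real x) \<le> (r / 2 * prime_count x) * ln (real x)" by (simp only: mult.assoc)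
    then have le: "\<bar>prime_char_sum x\<bar> \<le> r / 2 * prime_count x" using lx by (simp add: mult_le_cancel_right)
    have "prime_count x * ln (real x) > 0" using elim by (auto intro: less_le_trans[rotated])
    then have pos: "prime_count x > 0" using lx by (simp add: zero_less_mult_iff)
    then have "r / 2 * prime_count x < r * prime_count x" using r by simp
    with le have "\<bar>prime_char_sum x\<bar> < r * prime_count x" by linarith
    then show ?case using pos by (simp add: abs_divide divide_less_eq)
  qed
  then show "\<exists>no. \<forall>n\<ge>no. norm (prime_char_sum n / prime_count n - 0) < r"
    unfolding eventually_sequentially .
qed

end

section \<open>Quadratic characters\<close>

lemma QuadRes_Legendre: "Legendre a p = 1 \<longleftrightarrow> \<not> [a = 0] (mod p) \<and> QuadRes p a"
  by (auto simp: Legendre_def)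

lemma Legendre_values: "Legendre a p \<in> {-1, 0, 1}"
  by (auto simp: Legendre_def)

lemma Legendre_eq_0_iff: "Legendre a p = 0 \<longleftrightarrow> p dvd a"
  by (auto simp: Legendre_def cong_0_iff)

lemma Legendre_cong: "[a = b] (mod p) \<Longrightarrow> Legendre a p = Legendre b p"
proof -
  assume ab: "[a = b] (mod p)"
  have eq: "[c = a] (mod p) \<longleftrightarrow> [c = b] (mod p)" for c
    using ab cong_sym cong_trans by blast
  then show ?thesis unfolding Legendre_def QuadRes_def eq cong_sym_eq[of _ 0] by simp
qed

lemma Legendre_1 [simp]: "prime p \<Longrightarrow> Legendre 1 (int p) = 1"
  using not_prime_unit[of "int p"]
  by (auto simp: QuadRes_Legendre QuadRes_def cong_0_iff intro!: exI[of _ 1])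

lemma small_cong_imp_eq:
  assumes "[a = b] (mod int p)" "a \<in> {-1, 0, 1}" "b \<in> {-1, 0, 1}" "p > 2"
  shows "a = b"
proof (rule ccontr)
  assume "a \<noteq> b"
  have "int p dvd a - b" using assms by (simp add: cong_iff_dvd_diff)
  then have "\<bar>int p\<bar> \<le> \<bar>a - b\<bar>" using \<open>a \<noteq> b\<close> by (intro dvd_imp_le_int) auto
  with assms show False by auto
qed

lemma Legendre_mult:
  assumes "prime p" "p > 2"
  shows "Legendre (a * b) (int p) = Legendre a (int p) * Legendre b (int p)"
proof (rule small_cong_imp_eq)
  have "[Legendre (a * b) p = (a * b) ^ ((p - 1) div 2)] (mod p)"
    by (rule euler_criterion[OF assms])
  also have "(a * b) ^ ((p - 1) div 2) = a ^ ((p - 1) div 2) * b ^ ((p - 1) div 2)"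
    by (rule power_mult_distrib)
  also have "[\<dots> = Legendre a p * Legendre b p] (mod p)"
    by (intro cong_mult cong_sym[OF euler_criterion[OF assms]])
  finally show "[Legendre (a * b) (int p) = Legendre a (int p) * Legendre b (int p)] (mod p)" .
  show "Legendre a (int p) * Legendre b (int p) \<in> {-1, 0, 1}"
    using Legendre_values[of a p] Legendre_values[of b p] by auto
qed (use assms Legendre_values in auto)

definition chi4 :: "nat \<Rightarrow> int" where
  "chi4 n = (if even n then 0 else if n mod 4 = 1 then 1 else - 1)"

lemma chi4_mult: "chi4 (m * n) = chi4 m * chi4 n"
proof -
  define g where "g = (\<lambda>k::nat. if k = 1 then 1 else if k = 3 then - 1 else 0 :: int)"
  have chi4: "chi4 k = g (k mod 4)" for k
  proof -
    have "k mod 4 = 3 \<longleftrightarrow> odd k \<and> k mod 4 \<noteq> 1" "k mod 4 = 1 \<longrightarrow> odd k" by presburger+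
    then show ?thesis by (simp add: chi4_def g_def)
  qed
  have g_mult: "g (i * j mod 4) = g i * g j" if "i < 4" "j < 4" for i j
  proof -
    from that have "i = 0 \<or> i = 1 \<or> i = 2 \<or> i = 3" "j = 0 \<or> j = 1 \<or> j = 2 \<or> j = 3" by arith+
    then show ?thesis by (elim disjE) (simp_all add: g_def)
  qed
  have "chi4 (m * n) = g ((m mod 4) * (n mod 4) mod 4)" unfolding chi4 by (simp only: mod_mult_eq)
  also have "\<dots> = g (m mod 4) * g (n mod 4)" by (intro g_mult) auto
  finally show ?thesis unfolding chi4 .
qed

lemma chi4_odd: "odd n \<Longrightarrow> chi4 n = (- 1) ^ ((n - 1) div 2)"
proof -
  assume "odd n"
  then have "n = 4 * (n div 4) + 1 \<or> n = 4 * (n div 4) + 3" by presburger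
  then obtain k where "n = 4 * k + 1 \<or> n = 4 * k + 3" by blast
  then show ?thesis
  proof
    assume n: "n = 4 * k + 1"
    then have "(n - 1) div 2 = 2 * k" by simp
    then show ?thesis using n by (simp add: chi4_def)
  next
    assume n: "n = 4 * k + 3"
    then have "(n - 1) div 2 = 2 * k + 1" by simp
    moreover have "n mod 4 = 3" "odd n" using n by presburger+
    ultimately show ?thesis by (simp add: chi4_def)
  qed
qed

text \<open>
  A Dirichlet character \<open>\<chi>\<close> modulo \<open>q\<close> that extends the Legendre symbol \<open>(D / p)\<close> as a function of
  the prime \<open>p\<close>. The last clause limits the primes of the modulus, so that for a prime \<open>l > 2\<close> not
  dividing \<open>D\<close> residues modulo \<open>l\<close> and modulo \<open>q\<close> can be prescribed independently.
\<close>

definition quad_char :: "int \<Rightarrow> nat \<Rightarrow> (nat \<Rightarrow> int) \<Rightarrow> bool" where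
  "quad_char D q \<chi> \<longleftrightarrow> q > 0 \<and> even q \<and> (\<forall>m n. \<chi> (m * n) = \<chi> m * \<chi> n) \<and> \<chi> 1 = 1 \<and>
     (\<forall>n. \<chi> n \<in> {-1, 0, 1}) \<and> (\<forall>n. \<chi> (n + q) = \<chi> n) \<and> (\<forall>n. \<chi> n \<noteq> 0 \<longleftrightarrow> coprime n q) \<and>
     (\<forall>p. prime p \<longrightarrow> \<not> p dvd q \<longrightarrow> \<chi> p = Legendre D (int p)) \<and>
     (\<forall>r. prime r \<longrightarrow> r dvd q \<longrightarrow> r = 2 \<or> int r dvd D)"

lemma quad_charI:
  assumes "q > 0" "even q" "\<And>m n. \<chi> (m * n) = \<chi> m * \<chi> n" "\<chi> 1 = 1" "\<And>n. \<chi> n \<in> {-1, 0, 1}"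
    "\<And>n. \<chi> (n + q) = \<chi> n" "\<And>n. \<chi> n \<noteq> 0 \<longleftrightarrow> coprime n q"
    "\<And>p. prime p \<Longrightarrow> \<not> p dvd q \<Longrightarrow> \<chi> p = Legendre D (int p)"
    "\<And>r. prime r \<Longrightarrow> r dvd q \<Longrightarrow> r = 2 \<or> int r dvd D"
  shows "quad_char D q \<chi>"
  unfolding quad_char_def by (intro conjI allI impI assms)

lemma quad_char_periodic:
  assumes "quad_char D q \<chi>" shows "\<chi> (n + k * q) = \<chi> n"
proof (induction k)
  case (Suc k)
  have "\<chi> (n + Suc k * q) = \<chi> ((n + k * q) + q)" by (simp add: algebra_simps)
  also have "\<dots> = \<chi> (n + k * q)" using assms by (simp add: quad_char_def)
  finally show ?case using Suc by simp
qed simp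

lemma quad_char_mod: "quad_char D q \<chi> \<Longrightarrow> \<chi> (n mod q) = \<chi> n"
  using quad_char_periodic[of D q \<chi> "n mod q" "n div q"] by simp

lemma quad_char_cong: "quad_char D q \<chi> \<Longrightarrow> [m = n] (mod q) \<Longrightarrow> \<chi> m = \<chi> n"
  using quad_char_mod[of D q \<chi> m] quad_char_mod[of D q \<chi> n] by (simp add: unique_euclidean_semiring_class.cong_def)

lemma quad_char_one: "quad_char 1 2 (\<lambda>n. if odd n then 1 else 0)"
proof -
  have "r = 2" if "prime r" "r dvd 2" for r :: nat
    by (rule primes_dvd_imp_eq[OF that(1) two_is_prime_nat that(2)])
  moreover have "p = 2" if "prime p" "even p" for p :: nat
    using primes_dvd_imp_eq[OF two_is_prime_nat that(1)] that(2) by simp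
  ultimately show ?thesis by (auto simp: quad_char_def)
qed

lemma quad_char_minus_one: "quad_char (- 1) 4 chi4"
proof -
  have "chi4 p = Legendre (- 1) (int p)" if p: "prime p" "\<not> p dvd 4" for p
  proof -
    have "p \<noteq> 2" using p by auto
    then have "p > 2" "odd p" using p prime_ge_2_nat[of p] prime_odd_nat[of p] by auto
    show ?thesis
    proof (rule small_cong_imp_eq)
      show "[chi4 p = Legendre (- 1) (int p)] (mod int p)"
        using cong_sym[OF euler_criterion[OF p(1) \<open>p > 2\<close>, of "- 1"]] chi4_odd[OF \<open>odd p\<close>] by simp
    qed (use Legendre_values \<open>p > 2\<close> in \<open>auto simp: chi4_def\<close>)
  qed
  moreover have "chi4 n \<noteq> 0 \<longleftrightarrow> coprime n 4" for n
  proof -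
    have "coprime n (2 * 2) \<longleftrightarrow> odd n" unfolding coprime_mult_right_iff by simp
    then show ?thesis by (simp add: chi4_def)
  qed
  moreover have "chi4 (n + 4) = chi4 n" for n by (simp add: chi4_def)
  moreover have "r = 2" if "prime r" "r dvd 4" for r :: nat
  proof -
    have "r dvd 2 ^ 2" using that by simp
    then show ?thesis using that(1) by (metis prime_dvd_power primes_dvd_imp_eq two_is_prime_nat)
  qed
  ultimately show ?thesis
    unfolding quad_char_def by (auto simp: chi4_mult) (auto simp: chi4_def split: if_splits)
qed

lemma quad_char_mult:
  assumes "quad_char D1 q1 \<chi>1" "quad_char D2 q2 \<chi>2"
  shows "quad_char (D1 * D2) (q1 * q2) (\<lambda>n. \<chi>1 n * \<chi>2 n)"
proof -
  have 1: "\<chi>1 (n + q1 * q2) = \<chi>1 n" "\<chi>2 (n + q1 * q2) = \<chi>2 n" for n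
    using quad_char_periodic[OF assms(1), of n q2] quad_char_periodic[OF assms(2), of n q1]
    by (simp_all add: mult.commute)
  have 2: "\<chi>1 p * \<chi>2 p = Legendre (D1 * D2) (int p)" if p: "prime p" "\<not> p dvd q1 * q2" for p
  proof -
    have "\<not> p dvd q1" "\<not> p dvd q2" using p(2) by auto
    moreover from this have "p \<noteq> 2" using assms by (auto simp: quad_char_def)
    then have "p > 2" using prime_ge_2_nat[OF p(1)] by simp
    ultimately show ?thesis using assms p(1) by (simp add: quad_char_def Legendre_mult)
  qed
  have 3: "\<chi>1 n * \<chi>2 n \<in> {-1, 0, 1}" for n
  proof -
    have "\<chi>1 n \<in> {-1, 0, 1}" "\<chi>2 n \<in> {-1, 0, 1}" using assms unfolding quad_char_def by blast+
    then show ?thesis by auto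
  qed
  have 4: "r = 2 \<or> int r dvd D1 * D2" if r: "prime r" "r dvd q1 * q2" for r
  proof -
    have "r dvd q1 \<or> r dvd q2" using r by (simp add: prime_dvd_mult_iff)
    then have "r = 2 \<or> int r dvd D1 \<or> int r dvd D2" using assms r(1) unfolding quad_char_def by blast
    then show ?thesis by auto
  qed
  have 5: "\<chi>1 n * \<chi>2 n \<noteq> 0 \<longleftrightarrow> coprime n (q1 * q2)" for n
    using assms by (simp add: quad_char_def)
  from assms show ?thesis
    unfolding quad_char_def using 1 2 3 4 5 by (simp only:) (auto simp: quad_char_def)
qed

text \<open>
  Quadratic reciprocity: \<open>(l / p)\<close> equals \<open>(p / l)\<close>, with an additional sign \<open>chi4 p\<close> if
  \<open>l mod 4 = 3\<close>.
\<close>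

lemma quad_char_prime:
  assumes l: "prime l" "l > 2"
  shows "quad_char (int l) (4 * l)
    (\<lambda>n. if even n then 0 else Legendre (int n) (int l) * (if l mod 4 = 1 then 1 else chi4 n))"
    (is "quad_char _ _ ?\<chi>")
proof -
  have odd_l: "odd l" using l by (simp add: prime_odd_nat)
  have mult: "?\<chi> (m * n) = ?\<chi> m * ?\<chi> n" for m n
    by (auto simp: Legendre_mult[OF l] chi4_mult)
  have vals: "?\<chi> n \<in> {-1, 0, 1}" for n
    using Legendre_values[of "int n" "int l"] by (auto simp: chi4_def)
  have per: "?\<chi> (n + 4 * l) = ?\<chi> n" for n
  proof -
    have "Legendre (int (n + 4 * l)) (int l) = Legendre (int n) (int l)"
      by (rule Legendre_cong) (simp add: unique_euclidean_semiring_class.cong_def)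
    moreover have "(n + 4 * l) mod 4 = n mod 4" by presburger
    ultimately show ?thesis by (simp add: chi4_def)
  qed
  have cop: "?\<chi> n \<noteq> 0 \<longleftrightarrow> coprime n (4 * l)" for n
  proof -
    have "coprime n (2 * 2) \<longleftrightarrow> odd n" unfolding coprime_mult_right_iff by simp
    moreover have "coprime n l \<longleftrightarrow> \<not> l dvd n"
      using l(1) by (metis coprime_commute coprime_absorb_left not_prime_unit prime_imp_coprime)
    ultimately show ?thesis by (simp add: Legendre_eq_0_iff chi4_def)
  qed
  have leg: "?\<chi> p = Legendre (int l) (int p)" if p: "prime p" "\<not> p dvd 4 * l" for p
  proof -
    have "p \<noteq> 2" "p \<noteq> l" using p(2) by auto
    then have p2: "p > 2" and odd_p: "odd p" using p prime_ge_2_nat[of p] prime_odd_nat[of p] by auto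
    have QR: "Legendre (int p) (int l) * Legendre (int l) (int p) = (-1) ^ ((p - 1) div 2 * ((l - 1) div 2))"
      using Quadratic_Reciprocity[of p l] p p2 l \<open>p \<noteq> l\<close> by simp
    have nz: "Legendre (int l) (int p) \<noteq> 0" "Legendre (int p) (int l) \<noteq> 0"
      using primes_dvd_imp_eq[of p l] primes_dvd_imp_eq[of l p] p(1) l(1) \<open>p \<noteq> l\<close>
      by (auto simp: Legendre_eq_0_iff)
    have sq: "Legendre (int l) (int p) * Legendre (int l) (int p) = 1"
      using Legendre_values[of "int l" "int p"] nz by auto
    show ?thesis
    proof (cases "l mod 4 = 1")
      case True
      then have "even ((l - 1) div 2)" by presburger
      then have "Legendre (int p) (int l) * Legendre (int l) (int p) = 1" using QR by simp
      then have "Legendre (int p) (int l) = Legendre (int l) (int p)"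
        using sq nz by (metis mult_right_cancel)
      then show ?thesis using True odd_p by simp
    next
      case False
      then have "l mod 4 = 3" using odd_l by presburger
      then have "odd ((l - 1) div 2)" by presburger
      then have "Legendre (int p) (int l) * Legendre (int l) (int p) = chi4 p"
        using QR chi4_odd[OF odd_p] by (simp add: minus_one_power_iff)
      then have "Legendre (int p) (int l) * chi4 p = Legendre (int p) (int l) * Legendre (int p) (int l) * Legendre (int l) (int p)"
        by simp
      also have "Legendre (int p) (int l) * Legendre (int p) (int l) = 1"
        using Legendre_values[of "int p" "int l"] nz by auto
      finally show ?thesis using False odd_p by simp
    qed
  qed
  have div: "r = 2 \<or> int r dvd int l" if "prime r" "r dvd 4 * l" for r
  proof -
    have "r dvd 2 ^ 2 * l" using that by simp
    then have "r dvd 2 \<or> r dvd l" using that(1) by (metis prime_dvd_mult_iff prime_dvd_power)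
    then show ?thesis using primes_dvd_imp_eq[OF that(1) two_is_prime_nat] by auto
  qed
  have one: "?\<chi> 1 = 1" using l by (simp add: chi4_def)
  show ?thesis by (rule quad_charI[OF _ _ mult one vals per cop leg div]) (use l in auto)
qed

lemma quad_char_exists_pos:
  fixes n :: nat
  assumes "odd n"
  shows "\<exists>q \<chi>. quad_char (int n) q \<chi>"
  using assms
proof (induction n rule: less_induct)
  case (less n)
  show ?case
  proof (cases "n = 1")
    case True
    show ?thesis unfolding True of_nat_1 by (intro exI) (rule quad_char_one)
  next
    case False
    then obtain p where p: "prime p" "p dvd n" using prime_factor_nat by blast
    then obtain k where k: "n = p * k" by auto
    have "odd p" "odd k" using less.prems k by auto
    then have "p > 2" using p prime_ge_2_nat[of p] by (cases "p = 2") auto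
    have "k > 0" using \<open>odd k\<close> by (auto intro: Nat.gr0I)
    then have "k < n" using k \<open>p > 2\<close> by simp
    then obtain q \<chi> where "quad_char (int k) q \<chi>" using less.IH \<open>odd k\<close> by blast
    from quad_char_mult[OF quad_char_prime[OF p(1) \<open>p > 2\<close>] this] show ?thesis
      unfolding k of_nat_mult by (intro exI)
  qed
qed

lemma quad_char_exists:
  assumes "odd (D :: int)"
  shows "\<exists>q \<chi>. quad_char D q \<chi>"
proof -
  have "even (int (nat \<bar>D\<bar>)) \<longleftrightarrow> even D" by simp
  then have "odd (nat \<bar>D\<bar>)" using assms by (simp only: even_of_nat) simp
  then obtain q \<chi> where q: "quad_char (int (nat \<bar>D\<bar>)) q \<chi>" using quad_char_exists_pos by blast
  show ?thesis
  proof (cases "D \<ge> 0")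
    case True
    then have eq: "int (nat \<bar>D\<bar>) = D" by simp
    from q show ?thesis unfolding eq by (intro exI)
  next
    case False
    then have eq: "- 1 * int (nat \<bar>D\<bar>) = D" by simp
    from quad_char_mult[OF quad_char_minus_one q] show ?thesis unfolding eq by (intro exI)
  qed
qed

lemma exists_nonresidue:
  assumes "prime l" "l > 2"
  shows "\<exists>g::nat. Legendre (int g) (int l) = - 1"
proof (rule ccontr)
  assume none: "\<nexists>g::nat. Legendre (int g) (int l) = - 1"
  \<comment> \<open>Otherwise squaring would permute the residues, but it identifies \<open>1\<close> and \<open>-1\<close>.\<close>
  let ?R = "{0..<int l}"
  have "?R \<subseteq> (\<lambda>y. y\<^sup>2 mod int l) ` ?R"
  proof
    fix a assume a: "a \<in> ?R"
    then have "Legendre a (int l) \<noteq> - 1" using none spec[of "\<lambda>g. Legendre (int g) (int l) \<noteq> - 1" "nat a"] by auto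
    then obtain y where y: "[y\<^sup>2 = a] (mod int l)"
    proof (cases "[a = 0] (mod int l)")
      case True
      then show ?thesis using that[of 0] by (simp add: cong_sym)
    next
      case False
      then show ?thesis using that \<open>Legendre a (int l) \<noteq> - 1\<close> by (auto simp: Legendre_def QuadRes_def split: if_splits)
    qed
    have "(y mod int l)\<^sup>2 mod int l = a" using y a by (simp add: unique_euclidean_semiring_class.cong_def power_mod)
    moreover have "y mod int l \<in> ?R" using assms by simp
    ultimately show "a \<in> (\<lambda>y. y\<^sup>2 mod int l) ` ?R" by force
  qed
  then have "card ?R \<le> card ((\<lambda>y. y\<^sup>2 mod int l) ` ?R)" by (intro card_mono) auto
  moreover have "card ((\<lambda>y. y\<^sup>2 mod int l) ` ?R) \<le> card ?R" by (rule card_image_le) simp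
  ultimately have "inj_on (\<lambda>y. y\<^sup>2 mod int l) ?R" by (intro eq_card_imp_inj_on) auto
  moreover have "1\<^sup>2 mod int l = (int l - 1)\<^sup>2 mod int l"
  proof -
    have "(int l - 1)\<^sup>2 = 1\<^sup>2 + int l * (int l - 2)" by (simp add: power2_eq_square algebra_simps)
    then show ?thesis by (metis mod_mult_self2)
  qed
  moreover have "1 \<in> ?R" "int l - 1 \<in> ?R" using assms by auto
  ultimately have "1 = int l - 1" by (rule inj_onD)
  then show False using assms by simp
qed

text \<open>
  A prime \<open>l\<close> dividing \<open>D\<close> exactly once contributes the factor \<open>(\<sqdot> / l)\<close> to the character. By the
  Chinese remainder theorem some \<open>a\<close> is a nonresidue modulo \<open>l\<close> and congruent to \<open>1\<close> modulo \<open>4\<close> and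
  modulo the modulus belonging to \<open>D / l\<close>.
\<close>

lemma quad_char_nonprincipal:
  assumes l: "prime l" "l > 2" and D: "D = int l * m" "\<not> int l dvd m" "odd D"
  shows "\<exists>q \<chi> a. quad_char D q \<chi> \<and> \<chi> a = - 1"
proof -
  have "odd m" using D by auto
  then obtain q \<chi> where q: "quad_char m q \<chi>" using quad_char_exists by blast
  obtain g :: nat where g: "Legendre (int g) (int l) = - 1" using exists_nonresidue[OF l] by blast
  have "\<not> l dvd q" using q l D(2) unfolding quad_char_def by auto
  moreover have "\<not> l dvd 4"
    using l by (metis dvd_imp_le prime_dvd_power primes_dvd_imp_eq two_is_prime_nat less_irrefl numeral_Bit0 power2_eq_square mult_2 numeral_times_numeral semiring_norm(11))
  ultimately have "coprime l (4 * q)" using l(1) by (simp add: prime_imp_coprime prime_dvd_mult_iff)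
  then obtain a where a: "[a = g] (mod l)" "[a = 1] (mod 4 * q)"
    using binary_chinese_remainder_nat by blast
  have "[a = 1] (mod 4)" "[a = 1] (mod q)" using a(2) by (metis cong_modulus_mult_nat mult.commute)+
  then have "a mod 4 = 1" by (simp add: unique_euclidean_semiring_class.cong_def)
  then have "chi4 a = 1" "odd a" unfolding chi4_def by presburger+
  have "Legendre (int a) (int l) = - 1"
    using a(1) g Legendre_cong by (metis cong_int_iff)
  moreover have "\<chi> a = 1"
    using quad_char_cong[OF q \<open>[a = 1] (mod q)\<close>] q by (simp add: quad_char_def)
  ultimately have "(if even a then 0 else Legendre (int a) (int l) * (if l mod 4 = 1 then 1 else chi4 a)) * \<chi> a = - 1"
    using \<open>chi4 a = 1\<close> \<open>odd a\<close> by simp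
  with quad_char_mult[OF quad_char_prime[OF l] q] show ?thesis
    unfolding D(1) by (intro exI conjI)
qed

text \<open>
  Multiplication by \<open>a\<close> permutes the residues, so the sum over a full period equals its own negative and
  vanishes.
\<close>

lemma quad_char_sum_bound:
  assumes q: "quad_char D q \<chi>" and a: "\<chi> a = - 1"
  shows "\<bar>\<Sum>n=1..N. \<chi> n\<bar> \<le> int q"
proof -
  have q0: "q > 0" using q by (simp add: quad_char_def)
  have "coprime a q" using q a unfolding quad_char_def by force
  have inj: "inj_on (\<lambda>n. (a * n) mod q) {..<q}"
  proof (rule inj_onI)
    fix x y assume xy: "x \<in> {..<q}" "y \<in> {..<q}" "(a * x) mod q = (a * y) mod q"
    then have "[a * x = a * y] (mod q)" by (simp add: unique_euclidean_semiring_class.cong_def)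
    then have "[x = y] (mod q)" using \<open>coprime a q\<close> by (simp add: cong_mult_lcancel_nat)
    then show "x = y" using xy by (simp add: unique_euclidean_semiring_class.cong_def)
  qed
  have "(\<lambda>n. (a * n) mod q) ` {..<q} = {..<q}"
    using q0 by (intro endo_inj_surj inj) auto
  then have "(\<Sum>n<q. \<chi> n) = (\<Sum>n\<in>(\<lambda>n. (a * n) mod q) ` {..<q}. \<chi> n)" by simp
  also have "\<dots> = (\<Sum>n<q. \<chi> ((a * n) mod q))" using inj by (subst sum.reindex) auto
  also have "\<dots> = (\<Sum>n<q. \<chi> a * \<chi> n)" using q by (simp add: quad_char_mod[OF q] quad_char_def)
  also have "\<dots> = - (\<Sum>n<q. \<chi> n)" using a by (simp add: sum_negf)
  finally have zero: "(\<Sum>n<q. \<chi> n) = 0" by simp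
  have shift: "(\<Sum>n<q. \<chi> (N + n)) = 0" for N
  proof (induction N)
    case (Suc N)
    obtain r where r: "q = Suc r" using q0 by (cases q) auto
    have "(\<Sum>n<q. \<chi> (Suc N + n)) = (\<Sum>n<r. \<chi> (N + Suc n)) + \<chi> (N + q)" unfolding r by simp
    also have "\<chi> (N + q) = \<chi> (N + 0)" using q by (simp add: quad_char_def)
    also have "(\<Sum>n<r. \<chi> (N + Suc n)) + \<chi> (N + 0) = (\<Sum>n<q. \<chi> (N + n))"
      unfolding r by (simp only: sum.lessThan_Suc_shift)
    finally show ?case using Suc by simp
  qed (simp add: zero)
  define f where "f = (\<lambda>N. \<Sum>n<N. \<chi> (Suc n))"
  have f_per: "f (N + q) = f N" for N
  proof -
    have "f (N + k) = f N + (\<Sum>n<k. \<chi> (Suc N + n))" for k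
      by (induction k) (auto simp: f_def)
    then show ?thesis using shift[of "Suc N"] by simp
  qed
  have f_mod: "f N = f (N mod q)" for N
  proof -
    have "f (r + k * q) = f r" for r k
    proof (induction k)
      case (Suc k)
      then show ?case using f_per[of "r + k * q"] by (simp add: algebra_simps)
    qed simp
    from this[of "N mod q" "N div q"] show ?thesis by simp
  qed
  have "\<bar>f k\<bar> \<le> int k" for k
  proof -
    have "\<bar>\<chi> n\<bar> \<le> 1" for n
    proof -
      have "\<chi> n \<in> {-1, 0, 1}" using q unfolding quad_char_def by blast
      then show ?thesis by auto
    qed
    then have "\<bar>f k\<bar> \<le> (\<Sum>n<k. 1)" unfolding f_def by (intro order_trans[OF sum_abs] sum_mono)
    then show ?thesis by simp
  qed
  from this[of "N mod q"] have "\<bar>f N\<bar> \<le> int (N mod q)" by (simp only: f_mod[of N, symmetric])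
  also have "\<dots> \<le> int q" using q0 by (simp add: less_imp_le)
  finally have "\<bar>f N\<bar> \<le> int q" .
  moreover have "f N = (\<Sum>n=1..N. \<chi> n)"
    unfolding f_def by (simp add: sum.atLeast1_atMost_eq lessThan_atLeast0)
  ultimately show ?thesis by simp
qed

lemma prime_count_at_top: "filterlim prime_count at_top sequentially"
proof (rule filterlim_at_top_mono)
  show "filterlim (\<lambda>x. real x / (4 * ln (real x))) at_top sequentially" by real_asymp
  show "\<forall>\<^sub>F x in sequentially. real x / (4 * ln (real x)) \<le> prime_count x"
    using chebyshev_lower eventually_ge_at_top[of 2]
  proof eventually_elim
    case (elim x)
    then have "ln (real x) > 0" by simp
    then show ?case using elim by (simp add: field_simps)
  qed
qed

text \<open>
  The Legendre symbol \<open>(D / p)\<close> agrees with a nonprincipal real character at all but finitely many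
  primes \<open>p\<close>.
\<close>

theorem Legendre_prime_average:
  fixes D m :: int
  assumes l: "prime l" "l > 2" and D: "D = int l * m" "\<not> int l dvd m" "odd D"
  shows "(\<lambda>x. (\<Sum>p | prime p \<and> p \<le> x. real_of_int (Legendre D (int p))) / prime_count x) \<longlonglongrightarrow> 0"
proof -
  obtain q \<chi> a where q: "quad_char D q \<chi>" and a: "\<chi> a = - 1"
    using quad_char_nonprincipal[OF assms] by blast
  have q0: "q > 0" using q by (simp add: quad_char_def)
  interpret bounded_real_character "\<lambda>n. real_of_int (\<chi> n)" "real q"
  proof
    show "real_of_int (\<chi> (m * n)) = real_of_int (\<chi> m) * real_of_int (\<chi> n)" for m n
      using q by (simp add: quad_char_def)
    show "real_of_int (\<chi> 1) = 1" using q by (simp add: quad_char_def)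
    show "real_of_int (\<chi> n) \<in> {-1, 0, 1}" for n
    proof -
      have "\<chi> n \<in> {-1, 0, 1}" using q unfolding quad_char_def by blast
      then show ?thesis by auto
    qed
    show "\<bar>\<Sum>n=1..N. real_of_int (\<chi> n)\<bar> \<le> real q" for N
    proof -
      have "real_of_int \<bar>\<Sum>n=1..N. \<chi> n\<bar> \<le> real_of_int (int q)"
        using quad_char_sum_bound[OF q a, of N] by (simp only: of_int_le_iff)
      then show ?thesis by simp
    qed
  qed
  define s where "s = (\<lambda>x. \<Sum>p | prime p \<and> p \<le> x. real_of_int (Legendre D (int p)))"
  have diff: "\<bar>s x - prime_char_sum x\<bar> \<le> 2 * real q" for x
  proof -
    have "\<bar>s x - prime_char_sum x\<bar> \<le> (\<Sum>p | prime p \<and> p \<le> x. \<bar>real_of_int (Legendre D (int p)) - real_of_int (\<chi> p)\<bar>)"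
      unfolding s_def prime_char_sum_def sum_subtractf [symmetric] by (rule sum_abs)
    also have "\<dots> \<le> (\<Sum>p | prime p \<and> p \<le> x. if p dvd q then 2 else 0)"
    proof (rule sum_mono)
      fix p assume "p \<in> {p. prime p \<and> p \<le> x}"
      then have p: "prime p" by simp
      have "\<chi> p \<in> {-1, 0, 1}" using q unfolding quad_char_def by blast
      then have "\<bar>real_of_int (Legendre D (int p)) - real_of_int (\<chi> p)\<bar> \<le> 2"
        using Legendre_values[of D "int p"] by auto
      moreover have "\<not> p dvd q \<Longrightarrow> \<chi> p = Legendre D (int p)" using q p unfolding quad_char_def by blast
      ultimately show "\<bar>real_of_int (Legendre D (int p)) - real_of_int (\<chi> p)\<bar> \<le> (if p dvd q then 2 else 0)"
        by simp
    qed
    also have "\<dots> = 2 * real (card {p \<in> {p. prime p \<and> p \<le> x}. p dvd q})"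
      by (subst sum.inter_filter [symmetric]) auto
    also have "\<dots> \<le> 2 * real q"
    proof -
      have "card {p \<in> {p. prime p \<and> p \<le> x}. p dvd q} \<le> card {1..q}"
        using q0 by (intro card_mono) (auto simp: Suc_le_eq prime_gt_0_nat dvd_imp_le)
      then show ?thesis by simp
    qed
    finally show ?thesis .
  qed
  have "(\<lambda>x. (s x - prime_char_sum x) / prime_count x) \<longlonglongrightarrow> 0"
  proof (rule tendsto_norm_zero_cancel, rule tendsto_sandwich[OF _ _ tendsto_const])
    show "\<forall>\<^sub>F x in sequentially. norm ((s x - prime_char_sum x) / prime_count x) \<le> 2 * real q / prime_count x"
      using diff by (intro always_eventually) (auto simp: abs_divide prime_count_def intro!: divide_right_mono)
    show "(\<lambda>x. 2 * real q / prime_count x) \<longlonglongrightarrow> 0"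
      by (rule real_tendsto_divide_at_top[OF tendsto_const prime_count_at_top])
    show "\<forall>\<^sub>F x in sequentially. 0 \<le> norm ((s x - prime_char_sum x) / prime_count x)" by simp
  qed
  from tendsto_add[OF this prime_char_sum_little_o] show ?thesis
    by (simp add: s_def add_divide_distrib [symmetric])
qed

section \<open>Residues of rational numbers and reductions of Weierstrass equations\<close>

lemma quotient_of_mult: "q * of_int (snd (quotient_of q)) = of_int (fst (quotient_of q))"
proof -
  obtain n d where nd: "quotient_of q = (n, d)" by (cases "quotient_of q")
  then have "q = of_int n / of_int d" "d > 0" using quotient_of_div quotient_of_denom_pos by blast+
  then show ?thesis using nd by simp
qed

lemma weierstrass_scale_identity:
  fixes U x y :: int
  shows "U ^ 6 * ((y ^ 2 + a1 * x * y + a3 * y) - (x ^ 3 + a2 * x ^ 2 + a4 * x + a6)) =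
        U ^ 6 * y ^ 2 + U ^ 5 * x * y * (U * a1) + U ^ 3 * y * (U ^ 3 * a3) - U ^ 6 * x ^ 3
        - U ^ 4 * x ^ 2 * (U ^ 2 * a2) - U ^ 2 * x * (U ^ 4 * a4) - U ^ 6 * a6"
proof -
  have e: "U ^ 6 = U ^ 5 * U" "U ^ 6 = U ^ 3 * U ^ 3" "U ^ 6 = U ^ 4 * U ^ 2"
    using power_add[of U 5 1] power_add[of U 3 3] power_add[of U 4 2] by simp_all
  have t1: "U ^ 6 * (a1 * x * y) = U ^ 5 * x * y * (U * a1)" unfolding e(1) by (simp only: mult_ac)
  have t2: "U ^ 6 * (a3 * y) = U ^ 3 * y * (U ^ 3 * a3)" unfolding e(2) by (simp only: mult_ac)
  have t3: "U ^ 6 * (a2 * x ^ 2) = U ^ 4 * x ^ 2 * (U ^ 2 * a2)" "U ^ 6 * (a4 * x) = U ^ 2 * x * (U ^ 4 * a4)"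
    unfolding e(3) by (simp_all only: mult_ac)
  have "U ^ 6 * ((y ^ 2 + a1 * x * y + a3 * y) - (x ^ 3 + a2 * x ^ 2 + a4 * x + a6)) =
      U ^ 6 * y ^ 2 + U ^ 6 * (a1 * x * y) + U ^ 6 * (a3 * y) - U ^ 6 * x ^ 3 - U ^ 6 * (a2 * x ^ 2)
      - U ^ 6 * (a4 * x) - U ^ 6 * a6"
    by (simp add: algebra_simps)
  then show ?thesis by (simp only: t1 t2 t3)
qed

lemma weierstrass_subst_identity:
  fixes U x y :: int
  shows "U ^ 6 * y ^ 2 + U ^ 5 * x * y * (2 * S) + U ^ 3 * y * (2 * T) - U ^ 6 * x ^ 3
        - U ^ 4 * x ^ 2 * (A + 3 * R - S ^ 2) - U ^ 2 * x * (B + 2 * R * A + 3 * R ^ 2 - 2 * S * T)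
        - (C + R * B + R ^ 2 * A + R ^ 3 - T ^ 2) =
    (U ^ 3 * y + U ^ 2 * S * x + T) ^ 2
      - ((U ^ 2 * x + R) ^ 3 + A * (U ^ 2 * x + R) ^ 2 + B * (U ^ 2 * x + R) + C)"
proof -
  have h2: "(U ^ 3 * y + U ^ 2 * S * x + T) ^ 2 = U ^ 6 * y ^ 2 + U ^ 5 * x * y * (2 * S) + U ^ 3 * y * (2 * T)
      + U ^ 4 * x ^ 2 * S ^ 2 + U ^ 2 * x * (2 * S * T) + T ^ 2"
    by (simp add: algebra_simps power_numeral_reduce)
  have g2: "(U ^ 2 * x + R) ^ 2 = U ^ 4 * x ^ 2 + 2 * (U ^ 2 * x) * R + R ^ 2"
    by (simp add: algebra_simps power_numeral_reduce)
  have g3: "(U ^ 2 * x + R) ^ 3 = U ^ 6 * x ^ 3 + 3 * (U ^ 4 * x ^ 2) * R + 3 * (U ^ 2 * x) * R ^ 2 + R ^ 3"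
    by (simp add: algebra_simps power_numeral_reduce)
  show ?thesis unfolding h2 g2 g3 by (simp add: algebra_simps)
qed

locale prime_above_3 =
  fixes p :: nat
  assumes prime_p: "prime p" and p_gt_3: "p > 3"
begin

lemma prime_int_p: "prime (int p)" using prime_p by simp

lemma dvd_mult_iff: "int p dvd a * b \<longleftrightarrow> int p dvd a \<or> int p dvd b"
  using prime_int_p by (rule prime_dvd_mult_iff)

lemma dvd_power_iff: "n > 0 \<Longrightarrow> int p dvd a ^ n \<longleftrightarrow> int p dvd a"
  using prime_int_p by (simp add: prime_dvd_power_iff)

lemma not_dvd_small: "0 < c \<Longrightarrow> c < int p \<Longrightarrow> \<not> int p dvd c"
  by (auto dest: zdvd_imp_le)

lemma not_dvd_2: "\<not> int p dvd 2" and not_dvd_3: "\<not> int p dvd 3"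
  using p_gt_3 not_dvd_small[of 2] not_dvd_small[of 3] by simp_all

lemma cancel: "[c * a = c * b] (mod int p) \<Longrightarrow> \<not> int p dvd c \<Longrightarrow> [a = b] (mod int p)"
  by (simp add: cong_iff_dvd_diff dvd_mult_iff flip: right_diff_distrib)

lemma rat_val_eq:
  assumes "q \<noteq> 0" "q * of_int d = of_int n" "d \<noteq> 0"
  shows "rat_val p q = int (multiplicity (int p) n) - int (multiplicity (int p) d)"
proof -
  obtain n' d' where nd: "quotient_of q = (n', d')" by (cases "quotient_of q")
  then have q: "q * of_int d' = of_int n'" using quotient_of_mult[of q] by simp
  have d': "d' > 0" using nd quotient_of_denom_pos by blast
  then have n': "n' \<noteq> 0" using q assms(1) by auto
  have n: "n \<noteq> 0" using assms by auto
  have "(of_int (n' * d) :: rat) = of_int (n * d')" using q assms(2) by (simp flip: q assms(2))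
  then have eq: "n' * d = n * d'" by (simp only: of_int_eq_iff)
  have pe: "prime_elem (int p)" using prime_int_p by simp
  have "multiplicity (int p) n' + multiplicity (int p) d = multiplicity (int p) n + multiplicity (int p) d'"
    using arg_cong[OF eq, of "multiplicity (int p)"] n n' d' assms(3)
    by (simp add: prime_elem_multiplicity_mult_distrib[OF pe])
  then show ?thesis by (simp add: rat_val_def nd)
qed

lemma rat_val_mult:
  assumes "a \<noteq> 0" "b \<noteq> 0"
  shows "rat_val p (a * b) = rat_val p a + rat_val p b"
proof -
  obtain n d where a: "quotient_of a = (n, d)" by (cases "quotient_of a")
  obtain n' d' where b: "quotient_of b = (n', d')" by (cases "quotient_of b")
  have d: "d > 0" "d' > 0" using a b quotient_of_denom_pos by blast+
  have q: "a * of_int d = of_int n" "b * of_int d' = of_int n'"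
    using quotient_of_mult[of a] quotient_of_mult[of b] a b by simp_all
  have n: "n \<noteq> 0" "n' \<noteq> 0" using q assms d by auto
  have "a * b * of_int (d * d') = (a * of_int d) * (b * of_int d')" by simp
  also have "\<dots> = of_int (n * n')" unfolding q by simp
  finally have ab: "a * b * of_int (d * d') = of_int (n * n')" .
  have "prime_elem (int p)" using prime_int_p by simp
  then show ?thesis
    using rat_val_eq[OF _ ab] rat_val_eq[OF assms(1) q(1)] rat_val_eq[OF assms(2) q(2)] assms n d
    by (simp add: prime_elem_multiplicity_mult_distrib)
qed

lemma rat_val_power: "a \<noteq> 0 \<Longrightarrow> rat_val p (a ^ n) = int n * rat_val p a"
proof (induction n)
  case 0
  have "rat_val p 1 = 0" using rat_val_eq[of 1 1 1] by simp
  then show ?case by simp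
qed (simp add: rat_val_mult algebra_simps)

lemma p_integral_iff: "p_integral p q \<longleftrightarrow> (\<exists>n d. \<not> int p dvd d \<and> q * of_int d = of_int n)"
proof
  assume int: "p_integral p q"
  obtain n d where nd: "quotient_of q = (n, d)" by (cases "quotient_of q")
  have q: "q * of_int d = of_int n" using quotient_of_mult[of q] nd by simp
  have "\<not> int p dvd d"
  proof
    assume pd: "int p dvd d"
    have "coprime n d" using nd by (rule quotient_of_coprime)
    then have pn: "\<not> int p dvd n" using pd prime_int_p by (meson coprime_common_divisor not_prime_unit)
    then have "n \<noteq> 0" by auto
    then have "q \<noteq> 0" using q by auto
    then have "rat_val p q \<ge> 0" using int by (simp add: p_integral_def)
    moreover have "multiplicity (int p) n = 0" using pn by (rule not_dvd_imp_multiplicity_0)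
    moreover have "multiplicity (int p) d > 0"
      using pd quotient_of_denom_pos[OF nd] prime_int_p by (simp add: prime_multiplicity_gt_zero_iff)
    ultimately show False using nd by (simp add: rat_val_def)
  qed
  with q show "\<exists>n d. \<not> int p dvd d \<and> q * of_int d = of_int n" by blast
next
  assume "\<exists>n d. \<not> int p dvd d \<and> q * of_int d = of_int n"
  then obtain n d where d: "\<not> int p dvd d" and q: "q * of_int d = of_int n" by blast
  show "p_integral p q"
  proof (cases "q = 0")
    case False
    have "d \<noteq> 0" using d by auto
    with rat_val_eq[OF False q] not_dvd_imp_multiplicity_0[OF d] show ?thesis by (simp add: p_integral_def)
  qed (simp add: p_integral_def)
qed

lemma p_integralE:
  assumes "p_integral p q"
  obtains n d where "\<not> int p dvd d" "q * of_int d = of_int n"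
  using assms p_integral_iff by blast

lemma p_integral_of_int: "p_integral p (of_int n)"
  unfolding p_integral_iff using not_dvd_small[of 1] p_gt_3 by (intro exI[of _ n] exI[of _ 1]) auto

lemma p_integral_mult:
  assumes "p_integral p a" "p_integral p b" shows "p_integral p (a * b)"
proof (cases "a = 0 \<or> b = 0")
  case False
  then show ?thesis using assms by (auto simp: p_integral_def rat_val_mult)
qed (auto simp: p_integral_def)

lemma p_integral_add:
  assumes "p_integral p a" "p_integral p b" shows "p_integral p (a + b)"
proof -
  obtain n d where 1: "\<not> int p dvd d" "a * of_int d = of_int n" using assms(1) by (rule p_integralE)
  obtain n' d' where 2: "\<not> int p dvd d'" "b * of_int d' = of_int n'" using assms(2) by (rule p_integralE)
  have "(a + b) * of_int (d * d') = (a * of_int d) * of_int d' + (b * of_int d') * of_int d"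
    by (simp add: algebra_simps)
  also have "\<dots> = of_int (n * d' + n' * d)" unfolding 1 2 by simp
  finally have "(a + b) * of_int (d * d') = of_int (n * d' + n' * d)" .
  moreover have "\<not> int p dvd d * d'" using 1 2 by (simp add: dvd_mult_iff)
  ultimately show ?thesis unfolding p_integral_iff by blast
qed

lemma p_integral_minus: "p_integral p a \<Longrightarrow> p_integral p (- a)"
  using p_integral_mult[OF p_integral_of_int[of "- 1"], of a] by simp

lemma p_integral_diff: "p_integral p a \<Longrightarrow> p_integral p b \<Longrightarrow> p_integral p (a - b)"
  using p_integral_add[of a "- b"] p_integral_minus[of b] by simp

lemma p_integral_power: "p_integral p a \<Longrightarrow> p_integral p (a ^ n)"
proof (induction n)
  case 0
  then show ?case using p_integral_of_int[of 1] by simp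
qed (simp add: p_integral_mult)

lemmas p_integral_intros = p_integral_add p_integral_diff p_integral_mult p_integral_minus p_integral_power
  p_integral_of_int p_integral_of_int[of "numeral m" for m, simplified]
  p_integral_of_int[of 1, simplified] p_integral_of_int[of 0, simplified]

lemma p_integral_cancel:
  assumes "\<not> int p dvd c" "p_integral p (of_int c * x)" shows "p_integral p x"
proof -
  obtain n d where "\<not> int p dvd d" "of_int c * x * of_int d = of_int n" using assms(2) by (rule p_integralE)
  then have "\<not> int p dvd c * d" "x * of_int (c * d) = of_int n"
    using assms(1) by (auto simp: dvd_mult_iff mult_ac)
  then show ?thesis unfolding p_integral_iff by blast
qed

lemma rat_mod_cong:
  assumes d: "\<not> int p dvd d" and q: "q * of_int d = of_int n"
  shows "[rat_mod p q * d = n] (mod int p)"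
proof -
  obtain n' d' where nd: "quotient_of q = (n', d')" by (cases "quotient_of q")
  have q': "q * of_int d' = of_int n'" using quotient_of_mult[of q] nd by simp
  have "(of_int (n' * d) :: rat) = of_int (n * d')" using q q' by (simp flip: q q')
  then have eq: "n' * d = n * d'" by (simp only: of_int_eq_iff)
  have d': "\<not> int p dvd d'"
  proof
    assume pd: "int p dvd d'"
    then have "int p dvd n' * d" unfolding eq by simp
    then have "int p dvd n'" using d by (simp add: dvd_mult_iff)
    moreover have "coprime n' d'" using nd by (rule quotient_of_coprime)
    ultimately show False using pd prime_int_p by (meson coprime_common_divisor not_prime_unit)
  qed
  then have "coprime d' (int p)" using prime_int_p by (metis coprime_commute prime_imp_coprime)
  then have inv: "[d' * modular_inverse (int p) d' = 1] (mod int p)" by (rule cong_modular_inverse1)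
  have "[rat_mod p q = n' * modular_inverse (int p) d'] (mod int p)"
    by (simp add: rat_mod_def nd)
  then have "[d' * (rat_mod p q * d) = d' * (n' * modular_inverse (int p) d' * d)] (mod int p)"
    by (intro cong_mult cong_refl)
  also have "d' * (n' * modular_inverse (int p) d' * d) = (d' * modular_inverse (int p) d') * (n' * d)"
    by (simp add: mult_ac)
  also have "[\<dots> = 1 * (n' * d)] (mod int p)" by (intro cong_mult inv cong_refl)
  also have "1 * (n' * d) = d' * n" using eq by (simp add: mult.commute)
  finally show ?thesis using d' by (rule cancel)
qed

lemma rat_mod_of_int: "[rat_mod p (of_int n) = n] (mod int p)"
  using rat_mod_cong[of 1 "of_int n" n] not_dvd_small[of 1] p_gt_3 by simp

lemma rat_mod_add:
  assumes "p_integral p a" "p_integral p b"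
  shows "[rat_mod p (a + b) = rat_mod p a + rat_mod p b] (mod int p)"
proof -
  obtain n d where 1: "\<not> int p dvd d" "a * of_int d = of_int n" using assms(1) by (rule p_integralE)
  obtain n' d' where 2: "\<not> int p dvd d'" "b * of_int d' = of_int n'" using assms(2) by (rule p_integralE)
  have dd: "\<not> int p dvd d * d'" using 1 2 by (simp add: dvd_mult_iff)
  have "(a + b) * of_int (d * d') = (a * of_int d) * of_int d' + (b * of_int d') * of_int d"
    by (simp add: algebra_simps)
  also have "\<dots> = of_int (n * d' + n' * d)" unfolding 1 2 by simp
  finally have "[rat_mod p (a + b) * (d * d') = n * d' + n' * d] (mod int p)"
    by (rule rat_mod_cong[OF dd])
  also have "[n * d' + n' * d = (rat_mod p a * d) * d' + (rat_mod p b * d') * d] (mod int p)"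
    by (intro cong_add cong_mult cong_refl cong_sym[OF rat_mod_cong[OF 1]] cong_sym[OF rat_mod_cong[OF 2]])
  finally have "[(d * d') * rat_mod p (a + b) = (d * d') * (rat_mod p a + rat_mod p b)] (mod int p)"
    by (simp add: algebra_simps)
  then show ?thesis using dd by (rule cancel)
qed

lemma rat_mod_mult:
  assumes "p_integral p a" "p_integral p b"
  shows "[rat_mod p (a * b) = rat_mod p a * rat_mod p b] (mod int p)"
proof -
  obtain n d where 1: "\<not> int p dvd d" "a * of_int d = of_int n" using assms(1) by (rule p_integralE)
  obtain n' d' where 2: "\<not> int p dvd d'" "b * of_int d' = of_int n'" using assms(2) by (rule p_integralE)
  have dd: "\<not> int p dvd d * d'" using 1 2 by (simp add: dvd_mult_iff)
  have "(a * b) * of_int (d * d') = (a * of_int d) * (b * of_int d')" by simp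
  also have "\<dots> = of_int (n * n')" unfolding 1 2 by simp
  finally have "[rat_mod p (a * b) * (d * d') = n * n'] (mod int p)"
    by (rule rat_mod_cong[OF dd])
  also have "[n * n' = (rat_mod p a * d) * (rat_mod p b * d')] (mod int p)"
    by (intro cong_mult cong_sym[OF rat_mod_cong[OF 1]] cong_sym[OF rat_mod_cong[OF 2]])
  finally have "[(d * d') * rat_mod p (a * b) = (d * d') * (rat_mod p a * rat_mod p b)] (mod int p)"
    by (simp add: mult_ac)
  then show ?thesis using dd by (rule cancel)
qed

text \<open>
  The units among the \<open>p\<close>-integral rationals are those with nonzero residue.
\<close>

lemma rat_val_zero_iff:
  assumes "p_integral p q" "q \<noteq> 0"
  shows "rat_val p q = 0 \<longleftrightarrow> \<not> int p dvd rat_mod p q"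
proof -
  obtain n d where nd: "\<not> int p dvd d" "q * of_int d = of_int n" using assms(1) by (rule p_integralE)
  have d: "d \<noteq> 0" using nd by auto
  have n: "n \<noteq> 0" using nd d assms by auto
  have "rat_val p q = int (multiplicity (int p) n)"
    using rat_val_eq[OF assms(2) nd(2) d] not_dvd_imp_multiplicity_0[OF nd(1)] by simp
  then have "rat_val p q = 0 \<longleftrightarrow> \<not> int p dvd n"
    using n prime_int_p by (metis multiplicity_eq_zero_iff not_prime_unit of_nat_eq_0_iff)
  also have "int p dvd n \<longleftrightarrow> int p dvd rat_mod p q * d"
    using cong_dvd_iff[OF rat_mod_cong[OF nd]] by simp
  also have "\<dots> \<longleftrightarrow> int p dvd rat_mod p q" using nd(1) by (simp add: dvd_mult_iff)
  finally show ?thesis .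
qed

text \<open>
  A relation between rationals and residues, so that congruences between residues can be derived by
  introduction rules that follow the structure of a polynomial expression.
\<close>

definition res_cong :: "rat \<Rightarrow> int \<Rightarrow> bool" where
  "res_cong q n \<longleftrightarrow> p_integral p q \<and> [rat_mod p q = n] (mod int p)"

lemma res_cong_refl: "p_integral p q \<Longrightarrow> res_cong q (rat_mod p q)"
  by (simp add: res_cong_def)

lemma res_cong_of_int: "res_cong (of_int n) n"
  by (simp add: res_cong_def p_integral_of_int rat_mod_of_int)

lemma res_cong_add: "res_cong a m \<Longrightarrow> res_cong b n \<Longrightarrow> res_cong (a + b) (m + n)"
  unfolding res_cong_def by (auto intro: p_integral_add cong_trans[OF rat_mod_add cong_add])

lemma res_cong_mult: "res_cong a m \<Longrightarrow> res_cong b n \<Longrightarrow> res_cong (a * b) (m * n)"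
  unfolding res_cong_def by (auto intro: p_integral_mult cong_trans[OF rat_mod_mult cong_mult])

lemma res_cong_minus: "res_cong a m \<Longrightarrow> res_cong (- a) (- m)"
  using res_cong_mult[OF res_cong_of_int[of "- 1"], of a m] by simp

lemma res_cong_diff: "res_cong a m \<Longrightarrow> res_cong b n \<Longrightarrow> res_cong (a - b) (m - n)"
  using res_cong_add[of a m "- b" "- n"] res_cong_minus[of b n] by simp

lemma res_cong_power: "res_cong a m \<Longrightarrow> res_cong (a ^ n) (m ^ n)"
proof (induction n)
  case 0
  then show ?case using res_cong_of_int[of 1] by simp
qed (simp add: res_cong_mult)

lemmas res_cong_intros = res_cong_add res_cong_diff res_cong_mult res_cong_minus res_cong_power
  res_cong_of_int res_cong_of_int[of "numeral m" for m, simplified]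
  res_cong_of_int[of 1, simplified] res_cong_of_int[of 0, simplified]

lemma res_cong_unique: "res_cong q m \<Longrightarrow> res_cong q n \<Longrightarrow> [m = n] (mod int p)"
  unfolding res_cong_def by (auto intro: cong_trans[OF cong_sym])

definition sqpoints :: "(int \<Rightarrow> int) \<Rightarrow> (int \<times> int) set" where
  "sqpoints f = {(x, y). x \<in> {0..<int p} \<and> y \<in> {0..<int p} \<and> [y\<^sup>2 = f x] (mod int p)}"

lemma mod_range: "x mod int p \<in> {0..<int p}"
  using p_gt_3 by simp

lemma eq_of_cong: "x \<in> {0..<int p} \<Longrightarrow> y \<in> {0..<int p} \<Longrightarrow> [x = y] (mod int p) \<Longrightarrow> x = y"
  by (simp add: unique_euclidean_semiring_class.cong_def)

text \<open>
  A map of the finite affine plane that is injective modulo \<open>p\<close> is a bijection, and so matches up solution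
  sets.
\<close>

lemma card_points_transport:
  fixes g h :: "int \<Rightarrow> int \<Rightarrow> int" and P Q :: "int \<Rightarrow> int \<Rightarrow> bool"
  assumes P_cong: "\<And>x x' y y'. [x = x'] (mod int p) \<Longrightarrow> [y = y'] (mod int p) \<Longrightarrow> P x y \<Longrightarrow> P x' y'"
    and inj: "\<And>x y x' y'. [g x y = g x' y'] (mod int p) \<Longrightarrow> [h x y = h x' y'] (mod int p) \<Longrightarrow>
        [x = x'] (mod int p) \<and> [y = y'] (mod int p)"
    and iff: "\<And>x y. Q x y \<longleftrightarrow> P (g x y) (h x y)"
  shows "card {(x, y). x \<in> {0..<int p} \<and> y \<in> {0..<int p} \<and> Q x y} =
         card {(x, y). x \<in> {0..<int p} \<and> y \<in> {0..<int p} \<and> P x y}" (is "card ?Q = card ?P")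
proof -
  define F where "F = (\<lambda>(x, y). (g x y mod int p, h x y mod int p))"
  let ?R = "{0..<int p} \<times> {0..<int p}"
  have injF: "inj_on F ?R"
  proof (rule inj_onI)
    fix a b assume a: "a \<in> ?R" and b: "b \<in> ?R" and eq: "F a = F b"
    obtain x y x' y' where [simp]: "a = (x, y)" "b = (x', y')" by (cases a, cases b)
    have "[g x y = g x' y'] (mod int p)" "[h x y = h x' y'] (mod int p)"
      using eq by (auto simp: F_def unique_euclidean_semiring_class.cong_def)
    from inj[OF this] show "a = b" using a b by (auto intro: eq_of_cong)
  qed
  have FR: "F ` ?R \<subseteq> ?R" using mod_range by (auto simp: F_def)
  have surj: "F ` ?R = ?R" by (rule endo_inj_surj[OF _ FR injF]) simp
  have P_mod: "P x y \<longleftrightarrow> P (x mod int p) (y mod int p)" for x y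
    using P_cong[of x "x mod int p" y "y mod int p"] P_cong[of "x mod int p" x "y mod int p" y]
    by (auto simp: unique_euclidean_semiring_class.cong_def)
  have "F ` ?Q = ?P"
  proof (intro equalityI subsetI)
    fix b assume "b \<in> F ` ?Q"
    then obtain x y where "b = F (x, y)" "x \<in> {0..<int p}" "y \<in> {0..<int p}" "Q x y" by auto
    then show "b \<in> ?P" using mod_range iff P_mod by (auto simp: F_def)
  next
    fix b assume b: "b \<in> ?P"
    then have "b \<in> F ` ?R" using surj by auto
    then obtain x y where xy: "b = F (x, y)" "x \<in> {0..<int p}" "y \<in> {0..<int p}" by auto
    then have "Q x y" using b iff P_mod by (auto simp: F_def)
    with xy show "b \<in> F ` ?Q" by auto
  qed
  moreover have "inj_on F ?Q" using injF by (rule inj_on_subset) auto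
  ultimately show ?thesis using card_image[of F ?Q] by simp
qed

text \<open>
  Modulo \<open>p\<close> the substitution \<open>(x, y) \<mapsto> (U\<^sup>2 x + R, U\<^sup>3 y + U\<^sup>2 S x + T)\<close> is a bijection of the
  affine plane, and it carries the cubic equation to \<open>U ^ 6\<close> times the given Weierstrass equation.
\<close>

lemma weierstrass_transport:
  fixes A B C U R S T a1 a2 a3 a4 a6 :: int
  assumes U: "\<not> int p dvd U"
    and h1: "[U * a1 = 2 * S] (mod int p)"
    and h2: "[U ^ 2 * a2 = A + 3 * R - S ^ 2] (mod int p)"
    and h3: "[U ^ 3 * a3 = 2 * T] (mod int p)"
    and h4: "[U ^ 4 * a4 = B + 2 * R * A + 3 * R ^ 2 - 2 * S * T] (mod int p)"
    and h6: "[U ^ 6 * a6 = C + R * B + R ^ 2 * A + R ^ 3 - T ^ 2] (mod int p)"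
  shows "card (points_mod p (Weierstrass a1 a2 a3 a4 a6)) = 1 + card (sqpoints (\<lambda>x. x ^ 3 + A * x ^ 2 + B * x + C))"
proof -
  define Q where "Q = (\<lambda>x y. [y ^ 2 + a1 * x * y + a3 * y = x ^ 3 + a2 * x ^ 2 + a4 * x + a6] (mod int p))"
  define P where "P = (\<lambda>x y. [y ^ 2 = x ^ 3 + A * x ^ 2 + B * x + C] (mod int p))"
  define g h where "g = (\<lambda>x y::int. U ^ 2 * x + R)" and "h = (\<lambda>x y. U ^ 3 * y + U ^ 2 * S * x + T)"
  have "card {(x, y). x \<in> {0..<int p} \<and> y \<in> {0..<int p} \<and> Q x y} =
        card {(x, y). x \<in> {0..<int p} \<and> y \<in> {0..<int p} \<and> P x y}"
  proof (rule card_points_transport)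
    fix x x' y y' assume c: "[x = x'] (mod int p)" "[y = y'] (mod int p)" and Pxy: "P x y"
    have "[y' ^ 2 = y ^ 2] (mod int p)" by (intro cong_pow cong_sym[OF c(2)])
    also have "[y ^ 2 = x ^ 3 + A * x ^ 2 + B * x + C] (mod int p)" using Pxy by (simp add: P_def)
    also have "[x ^ 3 + A * x ^ 2 + B * x + C = x' ^ 3 + A * x' ^ 2 + B * x' + C] (mod int p)"
      by (intro cong_add cong_mult cong_pow cong_refl c)
    finally show "P x' y'" by (simp add: P_def)
  next
    fix x y x' y' assume gg: "[g x y = g x' y'] (mod int p)" and hh: "[h x y = h x' y'] (mod int p)"
    have "[U ^ 2 * x = U ^ 2 * x'] (mod int p)" using gg unfolding g_def by (simp add: cong_add_rcancel)
    then have x: "[x = x'] (mod int p)" by (rule cancel) (simp add: dvd_power_iff U)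
    have "[h x y - (U ^ 2 * S * x + T) = h x' y' - (U ^ 2 * S * x' + T)] (mod int p)"
      by (intro cong_diff cong_add cong_mult cong_refl hh x)
    then have "[U ^ 3 * y = U ^ 3 * y'] (mod int p)" by (simp add: h_def)
    then have "[y = y'] (mod int p)" by (rule cancel) (simp add: dvd_power_iff U)
    with x show "[x = x'] (mod int p) \<and> [y = y'] (mod int p)" ..
  next
    fix x y
    have c: "[U ^ 6 * ((y ^ 2 + a1 * x * y + a3 * y) - (x ^ 3 + a2 * x ^ 2 + a4 * x + a6)) =
        h x y ^ 2 - (g x y ^ 3 + A * g x y ^ 2 + B * g x y + C)] (mod int p)"
      unfolding weierstrass_scale_identity g_def h_def weierstrass_subst_identity [symmetric]
      by (intro cong_add cong_diff cong_mult[OF cong_refl] cong_refl h1 h2 h3 h4 h6)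
    have "Q x y \<longleftrightarrow> int p dvd U ^ 6 * ((y ^ 2 + a1 * x * y + a3 * y) - (x ^ 3 + a2 * x ^ 2 + a4 * x + a6))"
      using U by (simp add: Q_def cong_iff_dvd_diff dvd_mult_iff dvd_power_iff)
    also have "\<dots> \<longleftrightarrow> int p dvd h x y ^ 2 - (g x y ^ 3 + A * g x y ^ 2 + B * g x y + C)"
      by (rule cong_dvd_iff[OF c])
    also have "\<dots> \<longleftrightarrow> P (g x y) (h x y)" by (simp add: P_def cong_iff_dvd_diff)
    finally show "Q x y \<longleftrightarrow> P (g x y) (h x y)" .
  qed
  also have "\<dots> = card (sqpoints (\<lambda>x. x ^ 3 + A * x ^ 2 + B * x + C))"
    by (simp add: sqpoints_def P_def)
  finally have eq: "card {(x, y). x \<in> {0..<int p} \<and> y \<in> {0..<int p} \<and> Q x y} =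
      card (sqpoints (\<lambda>x. x ^ 3 + A * x ^ 2 + B * x + C))" .
  let ?Z = "{(x, y). x \<in> {0..<int p} \<and> y \<in> {0..<int p} \<and> Q x y}"
  have "finite ?Z" by (rule finite_subset[of _ "{0..<int p} \<times> {0..<int p}"]) auto
  then have "card (insert None (Some ` ?Z)) = 1 + card ?Z"
    by (subst card_insert_disjoint) (auto simp: card_image)
  then show ?thesis using eq by (simp add: points_mod_def Q_def)
qed

end

definition disc_form :: "rat \<Rightarrow> rat \<Rightarrow> rat \<Rightarrow> rat \<Rightarrow> rat" where
  "disc_form b2 b4 b6 b8 = - (b2 ^ 2) * b8 - 8 * b4 ^ 3 - 27 * b6 ^ 2 + 9 * b2 * b4 * b6"

lemma disc_form_scale:
  "u ^ 12 * disc_form b2 b4 b6 b8 = disc_form (u ^ 2 * b2) (u ^ 4 * b4) (u ^ 6 * b6) (u ^ 8 * b8)"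
proof -
  have e: "u ^ 12 = (u ^ 2) ^ 2 * u ^ 8" "u ^ 12 = (u ^ 4) ^ 3" "u ^ 12 = (u ^ 6) ^ 2" "u ^ 12 = u ^ 2 * u ^ 4 * u ^ 6"
    by (simp_all flip: power_mult power_add)
  have "u ^ 12 * (- (b2 ^ 2) * b8) = - ((u ^ 2 * b2) ^ 2) * (u ^ 8 * b8)"
    unfolding e(1) power_mult_distrib by (simp only: mult_ac mult_minus_left mult_minus_right)
  moreover have "u ^ 12 * (8 * b4 ^ 3) = 8 * (u ^ 4 * b4) ^ 3"
    unfolding e(2) power_mult_distrib by (simp only: mult_ac)
  moreover have "u ^ 12 * (27 * b6 ^ 2) = 27 * (u ^ 6 * b6) ^ 2"
    unfolding e(3) power_mult_distrib by (simp only: mult_ac)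
  moreover have "u ^ 12 * (9 * b2 * b4 * b6) = 9 * (u ^ 2 * b2) * (u ^ 4 * b4) * (u ^ 6 * b6)"
    unfolding e(4) by (simp only: mult_ac)
  ultimately show ?thesis unfolding disc_form_def right_diff_distrib distrib_left by (simp only:)
qed

lemma discriminant_eq:
  "discriminant (Weierstrass a1 a2 a3 a4 a6) =
    disc_form (a1 ^ 2 + 4 * a2) (2 * a4 + a1 * a3) (a3 ^ 2 + 4 * a6)
      (a1 ^ 2 * a6 + 4 * a2 * a6 - a1 * a3 * a4 + a2 * a3 ^ 2 - a4 ^ 2)"
  unfolding discriminant_def disc_form_def Let_def weierstrass.sel by (rule refl)

text \<open>
  The classical identity \<open>1728 \<Delta> = c\<^sub>4\<^sup>3 - c\<^sub>6\<^sup>2\<close>.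
\<close>

lemma disc_form_c4_c6:
  assumes "4 * b8 = b2 * b6 - b4 ^ 2"
  shows "1728 * disc_form b2 b4 b6 b8 = (b2 ^ 2 - 24 * b4) ^ 3 - (36 * b2 * b4 - b2 ^ 3 - 216 * b6) ^ 2"
proof -
  have "1728 * disc_form b2 b4 b6 b8 = - 432 * b2 ^ 2 * (4 * b8)
      + 1728 * (9 * b2 * b4 * b6 - 8 * b4 ^ 3 - 27 * b6 ^ 2)"
    by (simp add: disc_form_def algebra_simps)
  then show ?thesis unfolding assms by (simp add: algebra_simps power_numeral_reduce)
qed

text \<open>
  The invariants \<open>c\<^sub>4\<close> and \<open>c\<^sub>6\<close> do not change under \<open>x \<mapsto> x + r\<close>.
\<close>

lemma disc_form_translate:
  fixes A B C r :: rat
  shows "disc_form (4 * A + 12 * r) (2 * B + 4 * r * A + 6 * r ^ 2) (4 * C + 4 * r * B + 4 * r ^ 2 * A + 4 * r ^ 3)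
    (4 * A * C - B ^ 2 + 12 * r * C + 6 * r ^ 2 * B + 4 * r ^ 3 * A + 3 * r ^ 4) =
    disc_form (4 * A) (2 * B) (4 * C) (4 * A * C - B ^ 2)" (is "disc_form ?b2 ?b4 ?b6 ?b8 = _")
proof -
  have "4 * ?b8 = ?b2 * ?b6 - ?b4 ^ 2" by (simp add: algebra_simps power_numeral_reduce)
  moreover have "?b2 ^ 2 - 24 * ?b4 = (4 * A) ^ 2 - 24 * (2 * B)"
    by (simp add: algebra_simps power_numeral_reduce)
  moreover have "36 * ?b2 * ?b4 - ?b2 ^ 3 - 216 * ?b6 = 36 * (4 * A) * (2 * B) - (4 * A) ^ 3 - 216 * (4 * C)"
    by (simp add: algebra_simps power_numeral_reduce)
  moreover have "4 * (4 * A * C - B ^ 2) = (4 * A) * (4 * C) - (2 * B) ^ 2"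
    by (simp add: algebra_simps power_numeral_reduce)
  ultimately have "1728 * disc_form ?b2 ?b4 ?b6 ?b8 = 1728 * disc_form (4 * A) (2 * B) (4 * C) (4 * A * C - B ^ 2)"
    using disc_form_c4_c6[of ?b8 ?b2 ?b6 ?b4] disc_form_c4_c6[of "4 * A * C - B ^ 2" "4 * A" "4 * C" "2 * B"]
    by (simp only:)
  then show ?thesis by simp
qed

text \<open>
  The coefficients \<open>b\<^sub>i\<close> of the scaled model are those of the translated cubic divided by \<open>u ^ i\<close>, and
  the discriminant is homogeneous of weight \<open>12\<close>.
\<close>

lemma discriminant_iso:
  fixes A B C :: rat
  assumes "weierstrass_iso (Weierstrass 0 A 0 B C) W"
  shows "\<exists>u r s w. u \<noteq> 0 \<and> u * cf1 W = 2 * s \<and> u ^ 2 * cf2 W = A + 3 * r - s ^ 2 \<and> u ^ 3 * cf3 W = 2 * w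
     \<and> u ^ 4 * cf4 W = B + 2 * r * A + 3 * r ^ 2 - 2 * s * w
     \<and> u ^ 6 * cf6 W = C + r * B + r ^ 2 * A + r ^ 3 - w ^ 2
     \<and> u ^ 12 * discriminant W = discriminant (Weierstrass 0 A 0 B C)"
proof -
  obtain u r s w where u: "u \<noteq> 0"
    and raw: "u * cf1 W = 0 + 2 * s" "u ^ 2 * cf2 W = A - s * 0 + 3 * r - s ^ 2" "u ^ 3 * cf3 W = 0 + r * 0 + 2 * w"
      "u ^ 4 * cf4 W = B - s * 0 + 2 * r * A - (w + r * s) * 0 + 3 * r ^ 2 - 2 * s * w"
      "u ^ 6 * cf6 W = C + r * B + r ^ 2 * A + r ^ 3 - w * 0 - w ^ 2 - r * w * 0"
    using assms unfolding weierstrass_iso_def weierstrass.sel by blast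
  have h: "u * cf1 W = 2 * s" "u ^ 2 * cf2 W = A + 3 * r - s ^ 2" "u ^ 3 * cf3 W = 2 * w"
      "u ^ 4 * cf4 W = B + 2 * r * A + 3 * r ^ 2 - 2 * s * w"
      "u ^ 6 * cf6 W = C + r * B + r ^ 2 * A + r ^ 3 - w ^ 2"
    unfolding raw by simp_all
  define a1 a2 a3 a4 a6 where a: "a1 = cf1 W" "a2 = cf2 W" "a3 = cf3 W" "a4 = cf4 W" "a6 = cf6 W"
  have W: "W = Weierstrass a1 a2 a3 a4 a6" by (simp add: a)
  note h' = h[folded a]
  have "u ^ 2 * (a1 ^ 2 + 4 * a2) = (u * a1) ^ 2 + 4 * (u ^ 2 * a2)"
    by (simp add: algebra_simps power_numeral_reduce)
  also have "\<dots> = 4 * A + 12 * r" unfolding h' by (simp add: algebra_simps power_numeral_reduce)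
  finally have b2: "u ^ 2 * (a1 ^ 2 + 4 * a2) = 4 * A + 12 * r" .
  have "u ^ 4 * (2 * a4 + a1 * a3) = 2 * (u ^ 4 * a4) + (u * a1) * (u ^ 3 * a3)"
    by (simp add: algebra_simps power_numeral_reduce)
  also have "\<dots> = 2 * B + 4 * r * A + 6 * r ^ 2" unfolding h' by (simp add: algebra_simps power_numeral_reduce)
  finally have b4: "u ^ 4 * (2 * a4 + a1 * a3) = 2 * B + 4 * r * A + 6 * r ^ 2" .
  have "u ^ 6 * (a3 ^ 2 + 4 * a6) = (u ^ 3 * a3) ^ 2 + 4 * (u ^ 6 * a6)"
    by (simp add: algebra_simps power_numeral_reduce)
  also have "\<dots> = 4 * C + 4 * r * B + 4 * r ^ 2 * A + 4 * r ^ 3"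
    unfolding h' by (simp add: algebra_simps power_numeral_reduce)
  finally have b6: "u ^ 6 * (a3 ^ 2 + 4 * a6) = 4 * C + 4 * r * B + 4 * r ^ 2 * A + 4 * r ^ 3" .
  have "u ^ 8 * (a1 ^ 2 * a6 + 4 * a2 * a6 - a1 * a3 * a4 + a2 * a3 ^ 2 - a4 ^ 2) =
      (u * a1) ^ 2 * (u ^ 6 * a6) + 4 * (u ^ 2 * a2) * (u ^ 6 * a6) - (u * a1) * (u ^ 3 * a3) * (u ^ 4 * a4)
      + (u ^ 2 * a2) * (u ^ 3 * a3) ^ 2 - (u ^ 4 * a4) ^ 2"
    by (simp add: algebra_simps power_numeral_reduce)
  also have "\<dots> = 4 * A * C - B ^ 2 + 12 * r * C + 6 * r ^ 2 * B + 4 * r ^ 3 * A + 3 * r ^ 4"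
    unfolding h' by (simp add: algebra_simps power_numeral_reduce)
  finally have b8: "u ^ 8 * (a1 ^ 2 * a6 + 4 * a2 * a6 - a1 * a3 * a4 + a2 * a3 ^ 2 - a4 ^ 2) =
      4 * A * C - B ^ 2 + 12 * r * C + 6 * r ^ 2 * B + 4 * r ^ 3 * A + 3 * r ^ 4" .
  have "u ^ 12 * discriminant W = disc_form (4 * A) (2 * B) (4 * C) (4 * A * C - B ^ 2)"
    unfolding W discriminant_eq disc_form_scale b2 b4 b6 b8 by (rule disc_form_translate)
  also have "\<dots> = discriminant (Weierstrass 0 A 0 B C)"
    by (simp add: discriminant_eq)
  finally have "u ^ 12 * discriminant W = discriminant (Weierstrass 0 A 0 B C)" .
  with u h show ?thesis by (intro exI[of _ u] exI[of _ r] exI[of _ s] exI[of _ w] conjI)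
qed

section \<open>Counting points modulo 3 and modulo 4\<close>

lemma dvd_card_of_orbits:
  assumes fin: "finite X" and sub: "\<And>x. x \<in> X \<Longrightarrow> x \<in> orb x \<and> orb x \<subseteq> X \<and> card (orb x) = m"
    and eq: "\<And>x y. x \<in> X \<Longrightarrow> y \<in> orb x \<Longrightarrow> orb y = orb x"
  shows "m dvd card X"
proof -
  have U: "\<Union>(orb ` X) = X" using sub by blast
  have "m * card (orb ` X) = card (\<Union>(orb ` X))"
  proof (rule card_partition)
    show "finite (orb ` X)" using fin by simp
    show "finite (\<Union>(orb ` X))" unfolding U by (rule fin)
    show "card c = m" if "c \<in> orb ` X" for c using that sub by auto
    show "c1 \<inter> c2 = {}" if c1: "c1 \<in> orb ` X" and c2: "c2 \<in> orb ` X" and ne: "c1 \<noteq> c2" for c1 c2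
    proof (rule ccontr)
      assume "c1 \<inter> c2 \<noteq> {}"
      then obtain z where z: "z \<in> c1" "z \<in> c2" by blast
      obtain x1 x2 where x: "x1 \<in> X" "c1 = orb x1" "x2 \<in> X" "c2 = orb x2" using c1 c2 by blast
      have "orb z = c1" "orb z = c2" using eq[of x1 z] eq[of x2 z] z x by auto
      then show False using ne by simp
    qed
  qed
  then show ?thesis unfolding U by (metis dvd_triv_left)
qed

lemma three_dvd_card:
  assumes "finite X" and closed: "\<And>x. x \<in> X \<Longrightarrow> \<rho> x \<in> X" and cube: "\<And>x. x \<in> X \<Longrightarrow> \<rho> (\<rho> (\<rho> x)) = x"
    and free: "\<And>x. x \<in> X \<Longrightarrow> \<rho> x \<noteq> x"
  shows "3 dvd card X"
proof (rule dvd_card_of_orbits[where orb = "\<lambda>x. {x, \<rho> x, \<rho> (\<rho> x)}"])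
  fix x assume x: "x \<in> X"
  have "\<rho> (\<rho> x) \<noteq> x" using free[OF x] cube[OF x] by metis
  moreover have "\<rho> (\<rho> x) \<noteq> \<rho> x" using free[OF closed[OF x]] .
  ultimately have "card {x, \<rho> x, \<rho> (\<rho> x)} = 3" using free[OF x] by auto
  then show "x \<in> {x, \<rho> x, \<rho> (\<rho> x)} \<and> {x, \<rho> x, \<rho> (\<rho> x)} \<subseteq> X \<and> card {x, \<rho> x, \<rho> (\<rho> x)} = 3"
    using x closed by auto
  fix y assume "y \<in> {x, \<rho> x, \<rho> (\<rho> x)}"
  then show "{y, \<rho> y, \<rho> (\<rho> y)} = {x, \<rho> x, \<rho> (\<rho> x)}" using cube[OF x] by auto
qed (rule assms)

lemma four_dvd_card:
  assumes "finite X" and closed: "\<And>x. x \<in> X \<Longrightarrow> \<alpha> x \<in> X" "\<And>x. x \<in> X \<Longrightarrow> \<beta> x \<in> X"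
    and invol: "\<And>x. x \<in> X \<Longrightarrow> \<alpha> (\<alpha> x) = x" "\<And>x. x \<in> X \<Longrightarrow> \<beta> (\<beta> x) = x"
    and comm: "\<And>x. x \<in> X \<Longrightarrow> \<alpha> (\<beta> x) = \<beta> (\<alpha> x)"
    and free: "\<And>x. x \<in> X \<Longrightarrow> \<alpha> x \<noteq> x" "\<And>x. x \<in> X \<Longrightarrow> \<beta> x \<noteq> x" "\<And>x. x \<in> X \<Longrightarrow> \<alpha> (\<beta> x) \<noteq> x"
  shows "4 dvd card X"
proof (rule dvd_card_of_orbits[where orb = "\<lambda>x. {x, \<alpha> x, \<beta> x, \<alpha> (\<beta> x)}"])
  fix x assume x: "x \<in> X"
  have 1: "\<alpha> (\<beta> x) \<noteq> \<beta> x" using free(1)[OF closed(2)[OF x]] .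
  have 2: "\<alpha> (\<beta> x) \<noteq> \<alpha> x" using free(2)[OF x] invol(1) x closed by metis
  have 3: "\<beta> x \<noteq> \<alpha> x" using free(3)[OF x] invol(1)[OF x] by metis
  have "card {x, \<alpha> x, \<beta> x, \<alpha> (\<beta> x)} = 4" using free[OF x] 1 2 3 by (auto simp: card_insert_if)
  then show "x \<in> {x, \<alpha> x, \<beta> x, \<alpha> (\<beta> x)} \<and> {x, \<alpha> x, \<beta> x, \<alpha> (\<beta> x)} \<subseteq> X \<and> card {x, \<alpha> x, \<beta> x, \<alpha> (\<beta> x)} = 4"
    using x closed by auto
  fix y assume y: "y \<in> {x, \<alpha> x, \<beta> x, \<alpha> (\<beta> x)}"
  have i: "\<alpha> (\<alpha> x) = x" "\<beta> (\<beta> x) = x" "\<alpha> (\<alpha> (\<beta> x)) = \<beta> x" "\<beta> (\<alpha> x) = \<alpha> (\<beta> x)"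
    "\<beta> (\<alpha> (\<beta> x)) = \<alpha> x" "\<alpha> (\<beta> (\<alpha> x)) = \<beta> x"
    using invol comm x closed by simp_all
  from y consider "y = x" | "y = \<alpha> x" | "y = \<beta> x" | "y = \<alpha> (\<beta> x)" by blast
  then show "{y, \<alpha> y, \<beta> y, \<alpha> (\<beta> y)} = {x, \<alpha> x, \<beta> x, \<alpha> (\<beta> x)}"
    by cases (simp_all only: i insert_commute)
qed (rule assms)

context prime_above_3
begin

lemma p_gt_2: "p > 2" using p_gt_3 by simp

lemma Legendre_nz: "\<not> int p dvd a \<Longrightarrow> Legendre a p = 1 \<or> Legendre a p = - 1"
  using Legendre_values[of a "int p"] Legendre_eq_0_iff[of a "int p"] by auto

lemma Legendre_square: "\<not> int p dvd a \<Longrightarrow> Legendre (a ^ 2) p = 1"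
  using Legendre_nz[of a] by (auto simp: power2_eq_square Legendre_mult[OF prime_p p_gt_2])

lemma square_cong_iff: "[y ^ 2 = z ^ 2] (mod int p) \<longleftrightarrow> [y = z] (mod int p) \<or> [y = - z] (mod int p)"
proof -
  have "y ^ 2 - z ^ 2 = (y - z) * (y - (- z))" by (simp add: power2_eq_square algebra_simps)
  then show ?thesis by (simp only: cong_iff_dvd_diff dvd_mult_iff)
qed

text \<open>
  This turns point counts into sums of Legendre symbols.
\<close>

lemma card_square_roots:
  "int (card {y. y \<in> {0..<int p} \<and> [y ^ 2 = a] (mod int p)}) = 1 + Legendre a p" (is "int (card ?S) = _")
proof (cases "\<exists>y. [y ^ 2 = a] (mod int p)")
  case False
  then have empty: "?S = {}" by auto
  have leg: "Legendre a p = - 1"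
  proof -
    have "\<not> QuadRes p a" using False by (auto simp: QuadRes_def)
    moreover have "\<not> [a = 0] (mod int p)"
    proof
      assume "[a = 0] (mod int p)"
      then have "[0 ^ 2 = a] (mod int p)" by (simp add: cong_sym)
      with False show False by blast
    qed
    ultimately show ?thesis by (simp add: Legendre_def)
  qed
  show ?thesis unfolding empty leg by simp
next
  case True
  then obtain z where z: "[z ^ 2 = a] (mod int p)" by blast
  have "[y ^ 2 = a] (mod int p) \<longleftrightarrow> [y ^ 2 = z ^ 2] (mod int p)" for y
    using z by (meson cong_sym cong_trans)
  then have S1: "?S = {y. y \<in> {0..<int p} \<and> ([y = z] (mod int p) \<or> [y = - z] (mod int p))}"
    by (simp only: square_cong_iff)
  have S: "?S = {z mod int p, (- z) mod int p}"
    unfolding S1 using mod_range[of z] mod_range[of "- z"]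
    by (auto simp: unique_euclidean_semiring_class.cong_def)
  show ?thesis
  proof (cases "int p dvd z")
    case True
    then have S0: "?S = {0}" unfolding S by auto
    have leg: "Legendre a p = 0"
      unfolding Legendre_eq_0_iff using cong_dvd_iff[OF z] True by (simp add: dvd_power_iff)
    show ?thesis unfolding S0 leg by simp
  next
    case False
    have "z mod int p \<noteq> (- z) mod int p"
    proof
      assume "z mod int p = (- z) mod int p"
      then have "int p dvd 2 * z" by (simp add: mod_eq_dvd_iff)
      then show False using False not_dvd_2 by (simp add: dvd_mult_iff)
    qed
    then have card: "card ?S = 2" unfolding S by simp
    have "\<not> int p dvd a" using cong_dvd_iff[OF z] False by (simp add: dvd_power_iff)
    then have leg: "Legendre a p = 1" using z by (auto simp: Legendre_def QuadRes_def cong_0_iff)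
    show ?thesis unfolding card leg by simp
  qed
qed

lemma card_sqpoints_on:
  assumes "X \<subseteq> {0..<int p}"
  shows "int (card {(x, y). x \<in> X \<and> y \<in> {0..<int p} \<and> [y ^ 2 = f x] (mod int p)}) = (\<Sum>x\<in>X. 1 + Legendre (f x) p)"
proof -
  have fin: "finite X" using assms by (rule finite_subset) simp
  have "{(x, y). x \<in> X \<and> y \<in> {0..<int p} \<and> [y ^ 2 = f x] (mod int p)} =
      (SIGMA x:X. {y. y \<in> {0..<int p} \<and> [y ^ 2 = f x] (mod int p)})" by auto
  also have "card \<dots> = (\<Sum>x\<in>X. card {y. y \<in> {0..<int p} \<and> [y ^ 2 = f x] (mod int p)})"
    using fin by (intro card_SigmaI) (auto intro: finite_subset[of _ "{0..<int p}"])
  finally show ?thesis by (simp only: of_nat_sum card_square_roots)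
qed

lemma card_sqpoints: "int (card (sqpoints f)) = (\<Sum>x\<in>{0..<int p}. 1 + Legendre (f x) p)"
  unfolding sqpoints_def by (rule card_sqpoints_on) simp

lemma inverse_exists: "\<not> int p dvd x \<Longrightarrow> [x * modular_inverse (int p) x = 1] (mod int p)"
proof (rule cong_modular_inverse1)
  assume "\<not> int p dvd x"
  then show "coprime x (int p)" using prime_int_p by (metis coprime_commute prime_imp_coprime)
qed

lemma range_dvd_iff: "x \<in> {0..<int p} \<Longrightarrow> int p dvd x \<longleftrightarrow> x = 0"
  by (auto dest: zdvd_imp_le)

lemma p_mod_3: "p mod 3 \<noteq> 0"
proof
  assume "p mod 3 = 0"
  then have "3 dvd p" by presburger
  moreover have "prime (3::nat)" by simp
  ultimately have "3 = p" using prime_p primes_dvd_imp_eq by blast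
  then show False using p_gt_3 by simp
qed

lemma Legendre_minus_3: "Legendre (- 3) p = (if p mod 3 = 1 then 1 else - 1)"
proof -
  have "\<not> p dvd 2" "\<not> p dvd 3"
    using p_gt_3 by (auto dest!: dvd_imp_le)
  then have "\<not> p dvd 2 * 2" unfolding prime_dvd_mult_iff[OF prime_p] by simp
  then have nd4: "\<not> p dvd 4" by simp
  have nd: "\<not> p dvd 4" "\<not> p dvd 4 * 3"
    using nd4 \<open>\<not> p dvd 3\<close> unfolding prime_dvd_mult_iff[OF prime_p] by auto
  have odd_p: "odd p" using prime_p p_gt_3 by (simp add: prime_odd_nat)
  have "chi4 p = Legendre (- 1) p" using quad_char_minus_one nd prime_p by (simp add: quad_char_def)
  moreover have "Legendre (int p) 3 * chi4 p = Legendre 3 p"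
  proof -
    have pr: "prime (3::nat)" "(3::nat) > 2" by auto
    have "(if even p then 0 else Legendre (int p) (int 3) * (if 3 mod 4 = (1::nat) then 1 else chi4 p)) = Legendre (int 3) (int p)"
      using quad_char_prime[OF pr] nd(2) prime_p unfolding quad_char_def by blast
    then show ?thesis using odd_p by simp
  qed
  moreover have "chi4 p * chi4 p = 1" using odd_p by (simp add: chi4_def)
  moreover have "Legendre (- 3) p = Legendre (- 1) p * Legendre 3 p"
    using Legendre_mult[OF prime_p p_gt_2, of "- 1" 3] by simp
  ultimately have eq: "Legendre (- 3) p = Legendre (int p) 3"
    by (metis mult.assoc mult.commute mult_1)
  have "p mod 3 \<noteq> 0" by (rule p_mod_3)
  then consider "p mod 3 = 1" | "p mod 3 = 2" by linarith
  then show ?thesis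
  proof cases
    case 1
    then have "[int p = 1] (mod int 3)" by (simp add: unique_euclidean_semiring_class.cong_def) presburger
    then have "Legendre (int p) (int 3) = Legendre 1 (int 3)" by (rule Legendre_cong)
    then show ?thesis using 1 eq Legendre_1[of 3] by simp
  next
    case 2
    then have c: "[int p = 2] (mod 3)" by (simp add: unique_euclidean_semiring_class.cong_def) presburger
    have "\<not> QuadRes 3 2"
    proof
      assume "QuadRes 3 2"
      then obtain y :: int where "y ^ 2 mod 3 = 2" by (auto simp: QuadRes_def unique_euclidean_semiring_class.cong_def)
      then have "(y mod 3) ^ 2 mod 3 = 2" by (simp add: power_mod)
      moreover have "y mod 3 = 0 \<or> y mod 3 = 1 \<or> y mod 3 = 2" by presburger
      ultimately show False by auto
    qed
    then have "Legendre 2 3 = - 1" by (simp add: Legendre_def unique_euclidean_semiring_class.cong_def)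
    then show ?thesis using 2 eq Legendre_cong[OF c] by simp
  qed
qed

text \<open>
  In homogeneous coordinates this is \<open>(U + V + W)\<^sup>3 = - 12 \<tau>\<^sup>2 U V W\<close>, a model of the twist of the curve
  by \<open>-3\<close> on which translation by a point of order three is the cyclic permutation of the coordinates.
\<close>

definition twist_cubic :: "int \<Rightarrow> (int \<times> int) set" where
  "twist_cubic \<tau> = {(U, V). U \<in> {0..<int p} \<and> V \<in> {0..<int p} \<and> [(U + V + 1) ^ 3 = - 12 * \<tau> ^ 2 * (U * V)] (mod int p)}"

text \<open>
  The cyclic permutation is \<open>(U, V) \<mapsto> (V / U, 1 / U)\<close> in affine coordinates. A fixed point has
  \<open>U\<^sup>3 = 1\<close> and \<open>V = U\<^sup>2\<close>. If \<open>U = 1\<close>, the equation says \<open>27 = - 12 \<tau>\<^sup>2\<close>; otherwise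
  \<open>U + V + 1 = 0\<close>, although \<open>U V \<noteq> 0\<close>.
\<close>

lemma three_dvd_torsion_free_part:
  assumes \<tau>: "\<not> int p dvd \<tau>" "\<not> int p dvd 9 + 4 * \<tau> ^ 2"
  shows "3 dvd card {(U, V) \<in> twist_cubic \<tau>. U \<noteq> 0 \<and> V \<noteq> 0}" (is "3 dvd card ?X")
proof -
  define iv where "iv = modular_inverse (int p)"
  define \<rho> where "\<rho> = (\<lambda>(U, V). ((V * iv U) mod int p, iv U mod int p))"
  define k where "k = - 12 * \<tau> ^ 2"
  have k: "\<not> int p dvd k"
  proof -
    have "k = 2 * 2 * 3 * (- (\<tau> ^ 2))" by (simp add: k_def)
    moreover have "\<not> int p dvd - (\<tau> ^ 2)" using \<tau>(1) by (simp add: dvd_power_iff)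
    ultimately show ?thesis using not_dvd_2 not_dvd_3 by (simp only: dvd_mult_iff) simp
  qed
  have X: "(U, V) \<in> ?X \<longleftrightarrow> U \<in> {0..<int p} \<and> V \<in> {0..<int p} \<and> \<not> int p dvd U \<and> \<not> int p dvd V \<and>
      [(U + V + 1) ^ 3 = k * (U * V)] (mod int p)" for U V
    by (auto simp: twist_cubic_def k_def range_dvd_iff)
  have rho: "[a * U = V] (mod int p) \<and> [b * U = 1] (mod int p) \<and> a \<in> {0..<int p} \<and> b \<in> {0..<int p}
      \<and> \<not> int p dvd a \<and> \<not> int p dvd b"
    if U: "\<not> int p dvd U" "\<not> int p dvd V" and r: "\<rho> (U, V) = (a, b)" for U V a b
  proof -
    have inv: "[U * iv U = 1] (mod int p)" unfolding iv_def by (rule inverse_exists[OF U(1)])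
    have a: "[a = V * iv U] (mod int p)" and b: "[b = iv U] (mod int p)"
      using r by (auto simp: \<rho>_def unique_euclidean_semiring_class.cong_def)
    have "[b * U = iv U * U] (mod int p)" by (intro cong_mult b cong_refl)
    then have bU: "[b * U = 1] (mod int p)" using inv by (simp add: mult.commute cong_trans)
    have "[a * U = V * iv U * U] (mod int p)" by (intro cong_mult a cong_refl)
    moreover have "[V * (U * iv U) = V * 1] (mod int p)" by (intro cong_mult inv cong_refl)
    ultimately have aU: "[a * U = V] (mod int p)" by (simp add: mult_ac cong_trans)
    have "\<not> int p dvd b" using cong_dvd_iff[OF bU] not_dvd_small[of 1] p_gt_3 by auto
    moreover have "\<not> int p dvd a" using cong_dvd_iff[OF aU] U(2) by auto
    ultimately show ?thesis using aU bU r mod_range by (auto simp: \<rho>_def)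
  qed
  show ?thesis
  proof (rule three_dvd_card[where \<rho> = \<rho>])
    show "finite ?X" by (rule finite_subset[of _ "{0..<int p} \<times> {0..<int p}"]) (auto simp: twist_cubic_def)
    fix z assume "z \<in> ?X"
    then obtain U V where z: "z = (U, V)" "(U, V) \<in> ?X" by (cases z) auto
    have UV: "U \<in> {0..<int p}" "V \<in> {0..<int p}" "\<not> int p dvd U" "\<not> int p dvd V"
      "[(U + V + 1) ^ 3 = k * (U * V)] (mod int p)" using z(2) X by auto
    obtain a b where ab: "\<rho> (U, V) = (a, b)" by (cases "\<rho> (U, V)")
    note 1 = rho[OF UV(3,4) ab]
    then have a1: "[a * U = V] (mod int p)" and b1: "[b * U = 1] (mod int p)" by auto
    have "[U ^ 3 * (a + b + 1) ^ 3 = U ^ 3 * (k * (a * b))] (mod int p)"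
    proof -
      have "[(a * U + b * U + U) ^ 3 = (V + 1 + U) ^ 3] (mod int p)"
        by (intro cong_pow cong_add cong_refl a1 b1)
      moreover have "[(V + 1 + U) ^ 3 = k * (U * V)] (mod int p)" using UV(5) by (simp add: add_ac)
      moreover have "[k * (U * V) = k * (U * (a * U) * (b * U))] (mod int p)"
      proof -
        have "[U * (a * U) * (b * U) = U * V * 1] (mod int p)"
          by (rule cong_mult[OF cong_mult[OF cong_refl a1] b1])
        then have "[k * (U * (a * U) * (b * U)) = k * (U * V)] (mod int p)" by (intro cong_mult[OF cong_refl]) simp
        then show ?thesis by (rule cong_sym)
      qed
      ultimately have "[(a * U + b * U + U) ^ 3 = k * (U * (a * U) * (b * U))] (mod int p)" by (meson cong_trans)
      moreover have "(a * U + b * U + U) ^ 3 = U ^ 3 * (a + b + 1) ^ 3"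
        by (simp flip: power_mult_distrib add: algebra_simps)
      moreover have "k * (U * (a * U) * (b * U)) = U ^ 3 * (k * (a * b))"
        by (simp add: power3_eq_cube mult_ac)
      ultimately show ?thesis by simp
    qed
    then have "[(a + b + 1) ^ 3 = k * (a * b)] (mod int p)"
      by (rule cancel) (simp add: dvd_power_iff UV(3))
    then show "\<rho> z \<in> ?X" unfolding z(1) ab X using 1 by blast
    obtain c d where cd: "\<rho> (a, b) = (c, d)" by (cases "\<rho> (a, b)")
    have 2: "[c * a = b] (mod int p) \<and> [d * a = 1] (mod int p) \<and> c \<in> {0..<int p} \<and> d \<in> {0..<int p}
      \<and> \<not> int p dvd c \<and> \<not> int p dvd d" using rho[OF _ _ cd] 1 by blast
    then have c2: "[c * a = b] (mod int p)" and d2: "[d * a = 1] (mod int p)" by auto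
    obtain e f where ef: "\<rho> (c, d) = (e, f)" by (cases "\<rho> (c, d)")
    have 3: "[e * c = d] (mod int p) \<and> [f * c = 1] (mod int p) \<and> e \<in> {0..<int p} \<and> f \<in> {0..<int p}
      \<and> \<not> int p dvd e \<and> \<not> int p dvd f" using rho[OF _ _ ef] 2 by blast
    then have e3: "[e * c = d] (mod int p)" and f3: "[f * c = 1] (mod int p)" by auto
    have e: "[e = U] (mod int p)"
    proof -
      have "[e * b = e * (c * a)] (mod int p)" by (rule cong_mult[OF cong_refl cong_sym[OF c2]])
      also have "e * (c * a) = (e * c) * a" by simp
      also have "[(e * c) * a = d * a] (mod int p)" by (rule cong_mult[OF e3 cong_refl])
      also note d2
      finally have eb: "[e * b = 1] (mod int p)" .
      have "[e * (b * U) = e * 1] (mod int p)" by (rule cong_mult[OF cong_refl b1])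
      then have "[e = (e * b) * U] (mod int p)" by (simp add: cong_sym mult.assoc)
      also have "[(e * b) * U = 1 * U] (mod int p)" by (rule cong_mult[OF eb cong_refl])
      finally show ?thesis by simp
    qed
    have f: "[f = V] (mod int p)"
    proof -
      have "[f * b = f * (c * a)] (mod int p)" by (rule cong_mult[OF cong_refl cong_sym[OF c2]])
      also have "f * (c * a) = (f * c) * a" by simp
      also have "[(f * c) * a = 1 * a] (mod int p)" by (rule cong_mult[OF f3 cong_refl])
      finally have fb: "[f * b = a] (mod int p)" by simp
      have "[f * (b * U) = f * 1] (mod int p)" by (rule cong_mult[OF cong_refl b1])
      then have "[f = (f * b) * U] (mod int p)" by (simp add: cong_sym mult.assoc)
      also have "[(f * b) * U = a * U] (mod int p)" by (rule cong_mult[OF fb cong_refl])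
      also note a1
      finally show ?thesis .
    qed
    show "\<rho> (\<rho> (\<rho> z)) = z"
      unfolding z(1) ab cd ef using eq_of_cong[OF _ UV(1) e] eq_of_cong[OF _ UV(2) f] 3 by simp
    show "\<rho> z \<noteq> z"
    proof
      assume "\<rho> z = z"
      then have fp: "[U * U = V] (mod int p)" "[V * U = 1] (mod int p)" using 1 ab z(1) by auto
      have "[U * U * U = V * U] (mod int p)" using fp by (intro cong_mult cong_refl)
      then have U3: "[U * U * U = 1] (mod int p)" using fp(2) by (rule cong_trans)
      have "(U - 1) * (U * U + U + 1) = U * U * U - 1" by (simp add: algebra_simps)
      then have "int p dvd (U - 1) * (U * U + U + 1)" using U3 by (simp add: cong_iff_dvd_diff)
      then consider "int p dvd U - 1" | "int p dvd U * U + U + 1" by (auto simp: dvd_mult_iff)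
      then show False
      proof cases
        case 1
        then have U1: "[U = 1] (mod int p)" by (simp add: cong_iff_dvd_diff)
        then have "[U * U = 1 * 1] (mod int p)" by (intro cong_mult)
        then have V1: "[V = 1] (mod int p)" using fp(1) by (metis cong_sym cong_trans mult_1)
        have "[(U + V + 1) ^ 3 = (1 + 1 + 1) ^ 3] (mod int p)" by (intro cong_pow cong_add cong_refl U1 V1)
        moreover have "[k * (U * V) = k * (1 * 1)] (mod int p)" by (intro cong_mult cong_refl U1 V1)
        ultimately have "[(1 + 1 + 1) ^ 3 = k * (1 * 1)] (mod int p)"
          using UV(5) by (meson cong_sym cong_trans)
        then have "[27 = k] (mod int p)" by simp
        moreover have "27 - k = 3 * (9 + 4 * \<tau> ^ 2)" by (simp add: k_def)
        ultimately have "int p dvd 3 * (9 + 4 * \<tau> ^ 2)" by (simp only: cong_iff_dvd_diff)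
        then show False using \<tau>(2) not_dvd_3 by (simp only: dvd_mult_iff) simp
      next
        case 2
        have c: "[U + V + 1 = U + U * U + 1] (mod int p)"
          by (rule cong_add[OF cong_add[OF cong_refl cong_sym[OF fp(1)]] cong_refl])
        have "int p dvd U + V + 1" using 2 cong_dvd_iff[OF c] by (simp add: add_ac)
        then have "int p dvd (U + V + 1) ^ 3" by (simp add: dvd_power_iff)
        then have "int p dvd k * (U * V)" using cong_dvd_iff[OF UV(5)] by simp
        then show False using k UV by (simp add: dvd_mult_iff)
      qed
    qed
  qed
qed

text \<open>
  The points with a vanishing coordinate are \<open>(0, -1)\<close>, \<open>(-1, 0)\<close> and one point at infinity: the subgroup
  of order three.
\<close>

lemma card_twist_cubic:
  assumes \<tau>: "\<not> int p dvd \<tau>" "\<not> int p dvd 9 + 4 * \<tau> ^ 2"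
  shows "3 dvd 1 + card (twist_cubic \<tau>)"
proof -
  let ?X = "{(U, V) \<in> twist_cubic \<tau>. U \<noteq> 0 \<and> V \<noteq> 0}"
  have fin: "finite ?X" by (rule finite_subset[of _ "{0..<int p} \<times> {0..<int p}"]) (auto simp: twist_cubic_def)
  have zero: "[(V + 1) ^ 3 = 0] (mod int p) \<longleftrightarrow> V = int p - 1" if "V \<in> {0..<int p}" for V
  proof -
    have "[(V + 1) ^ 3 = 0] (mod int p) \<longleftrightarrow> int p dvd V + 1" by (simp add: cong_0_iff dvd_power_iff)
    also have "\<dots> \<longleftrightarrow> V = int p - 1" using that by (auto dest: zdvd_imp_le)
    finally show ?thesis .
  qed
  have p3: "[int p ^ 3 = 0] (mod int p)" by (simp add: cong_0_iff)
  have eq: "twist_cubic \<tau> = insert (0, int p - 1) (insert (int p - 1, 0) ?X)"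
    using p_gt_3 zero p3 by (auto simp: twist_cubic_def)
  have "(0, int p - 1) \<notin> insert (int p - 1, 0) ?X" "(int p - 1, 0) \<notin> ?X" using p_gt_3 by auto
  then have "card (insert (0, int p - 1) (insert (int p - 1, 0) ?X)) = Suc (Suc (card ?X))"
    using fin by simp
  then have "card (twist_cubic \<tau>) = Suc (Suc (card ?X))" by (simp only: eq [symmetric])
  then show ?thesis using three_dvd_torsion_free_part[OF \<tau>] by simp presburger
qed

lemma twist_identity:
  fixes \<tau> U V :: int
  shows "(3 * \<tau> * (U - V)) ^ 2 - (- 3) * ((- (U + V)) ^ 3 + (- 3 * (\<tau> ^ 2 + 1)) * (- (U + V)) ^ 2 + 3 * (- (U + V)) + (- 1))
    = - 3 * ((U + V + 1) ^ 3 - (- 12 * \<tau> ^ 2 * (U * V)))"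
  by (simp add: algebra_simps power2_eq_square power3_eq_cube)

text \<open>
  The curve \<open>y\<^sup>2 = - 3 f(x)\<close> is the twist, and its points correspond to those of the cubic under
  \<open>x = - (U + V)\<close>, \<open>y = 3 \<tau> (U - V)\<close>. If \<open>p mod 3 = 1\<close>, then \<open>-3\<close> is a square and the two
  curves have equally many points. If \<open>p mod 3 = 2\<close>, it is a nonresidue and the two numbers add up to
  \<open>2 p + 2\<close>, a multiple of \<open>3\<close>.
\<close>

lemma three_dvd_points:
  assumes \<tau>: "\<not> int p dvd \<tau>" "\<not> int p dvd 9 + 4 * \<tau> ^ 2"
  defines "f \<equiv> \<lambda>x. x ^ 3 + (- 3 * (\<tau> ^ 2 + 1)) * x ^ 2 + 3 * x + (- 1)"
  shows "3 dvd 1 + card (sqpoints f)"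
proof -
  have "card {(U, V). U \<in> {0..<int p} \<and> V \<in> {0..<int p} \<and> [(U + V + 1) ^ 3 = - 12 * \<tau> ^ 2 * (U * V)] (mod int p)} =
      card {(x, y). x \<in> {0..<int p} \<and> y \<in> {0..<int p} \<and> [y ^ 2 = - 3 * f x] (mod int p)}"
  proof (rule card_points_transport[where g = "\<lambda>U V. - (U + V)" and h = "\<lambda>U V. 3 * \<tau> * (U - V)"])
    fix x x' y y' assume c: "[x = x'] (mod int p)" "[y = y'] (mod int p)" and Pxy: "[y ^ 2 = - 3 * f x] (mod int p)"
    have 1: "[y' ^ 2 = y ^ 2] (mod int p)" by (intro cong_pow cong_sym[OF c(2)])
    have 2: "[- 3 * f x = - 3 * f x'] (mod int p)"
      unfolding f_def by (intro cong_add cong_mult[OF cong_refl] cong_pow cong_refl c)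
    show "[y' ^ 2 = - 3 * f x'] (mod int p)" by (rule cong_trans[OF cong_trans[OF 1 Pxy] 2])
  next
    fix U V U' V'
    assume a: "[- (U + V) = - (U' + V')] (mod int p)" and b: "[3 * \<tau> * (U - V) = 3 * \<tau> * (U' - V')] (mod int p)"
    have "\<not> int p dvd 3 * \<tau>" using \<tau> not_dvd_3 by (simp add: dvd_mult_iff)
    with b have b': "[U - V = U' - V'] (mod int p)" by (rule cancel)
    have a': "[U + V = U' + V'] (mod int p)" using a by (simp only: cong_minus_minus_iff)
    have "[(U + V) + (U - V) = (U' + V') + (U' - V')] (mod int p)" by (intro cong_add a' b')
    then have "[2 * U = 2 * U'] (mod int p)" by (simp add: algebra_simps)
    then have U: "[U = U'] (mod int p)" using not_dvd_2 by (rule cancel)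
    have "[(U + V) - (U - V) = (U' + V') - (U' - V')] (mod int p)" by (intro cong_diff a' b')
    then have "[2 * V = 2 * V'] (mod int p)" by (simp add: algebra_simps)
    then have "[V = V'] (mod int p)" using not_dvd_2 by (rule cancel)
    with U show "[U = U'] (mod int p) \<and> [V = V'] (mod int p)" ..
  next
    fix U V :: int
    have "[(3 * \<tau> * (U - V)) ^ 2 = - 3 * f (- (U + V))] (mod int p) \<longleftrightarrow>
        int p dvd - 3 * ((U + V + 1) ^ 3 - (- 12 * \<tau> ^ 2 * (U * V)))"
      unfolding cong_iff_dvd_diff f_def twist_identity ..
    also have "\<dots> \<longleftrightarrow> int p dvd (U + V + 1) ^ 3 - (- 12 * \<tau> ^ 2 * (U * V))"
      using not_dvd_3 by (simp only: dvd_mult_iff dvd_minus_iff) simp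
    also have "\<dots> \<longleftrightarrow> [(U + V + 1) ^ 3 = - 12 * \<tau> ^ 2 * (U * V)] (mod int p)" unfolding cong_iff_dvd_diff ..
    finally show "[(U + V + 1) ^ 3 = - 12 * \<tau> ^ 2 * (U * V)] (mod int p) \<longleftrightarrow>
        [(3 * \<tau> * (U - V)) ^ 2 = - 3 * f (- (U + V))] (mod int p)" by blast
  qed
  then have "card (sqpoints (\<lambda>x. - 3 * f x)) = card (twist_cubic \<tau>)"
    unfolding sqpoints_def twist_cubic_def by simp
  then have tw: "3 dvd 1 + int (card (sqpoints (\<lambda>x. - 3 * f x)))"
    using card_twist_cubic[OF \<tau>] by presburger
  define s where "s = (\<Sum>x\<in>{0..<int p}. Legendre (f x) p)"
  have N1: "int (card (sqpoints f)) = int p + s"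
    unfolding card_sqpoints s_def by (simp add: sum.distrib)
  have N3: "int (card (sqpoints (\<lambda>x. - 3 * f x))) = int p + Legendre (- 3) p * s"
    unfolding card_sqpoints s_def Legendre_mult[OF prime_p p_gt_2, of "- 3"]
    by (simp add: sum.distrib sum_distrib_left)
  have p3: "p mod 3 \<noteq> 0" by (rule p_mod_3)
  have "3 dvd 1 + int (card (sqpoints f))"
  proof (cases "p mod 3 = 1")
    case True
    then show ?thesis using tw unfolding N1 N3 Legendre_minus_3 by simp
  next
    case False
    then have "p mod 3 = 2" using p3 by linarith
    then have "3 dvd 2 * int p + 2" by presburger
    moreover have "3 dvd 1 + (int p - s)" using tw False unfolding N3 Legendre_minus_3 by simp
    ultimately have "3 dvd (2 * int p + 2) - (1 + (int p - s))" by (rule dvd_diff)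
    then show ?thesis unfolding N1 by (simp add: algebra_simps)
  qed
  then show ?thesis by presburger
qed

text \<open>
  The negation \<open>\<alpha>\<close> and the translation \<open>\<beta>\<close> by the point \<open>(0, 0)\<close> of order two commute. They act freely
  here: \<open>\<alpha>\<close> fixes only points with \<open>y = 0\<close>, while \<open>\<beta>\<close> maps \<open>x\<close> to \<open>b / x\<close>, so that \<open>\<beta>\<close> or
  \<open>\<alpha> \<beta>\<close> can fix a point only if \<open>x\<^sup>2 = b\<close>.
\<close>

lemma four_dvd_free_part:
  fixes a b :: int
  assumes b: "\<not> int p dvd b"
  defines "g \<equiv> \<lambda>x. x * (x ^ 2 + a * x + b)"
  defines "X \<equiv> {x. x \<in> {0..<int p} \<and> \<not> int p dvd g x \<and> \<not> [x ^ 2 = b] (mod int p)}"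
  shows "4 dvd card {(x, y). x \<in> X \<and> y \<in> {0..<int p} \<and> [y ^ 2 = g x] (mod int p)}" (is "4 dvd card ?Z")
proof -
  define iv where "iv = modular_inverse (int p)"
  define \<alpha> :: "int \<times> int \<Rightarrow> int \<times> int" where "\<alpha> = (\<lambda>(x, y). (x, (- y) mod int p))"
  define \<beta> where "\<beta> = (\<lambda>(x, y). ((b * iv x) mod int p, (b * y * (iv x) ^ 2) mod int p))"
  have g_cong: "[x = x'] (mod int p) \<Longrightarrow> [g x = g x'] (mod int p)" for x x'
    unfolding g_def by (intro cong_add cong_mult cong_pow cong_refl)
  have Z: "(x, y) \<in> ?Z \<longleftrightarrow> x \<in> {0..<int p} \<and> y \<in> {0..<int p} \<and> \<not> int p dvd g x \<and> \<not> [x ^ 2 = b] (mod int p)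
      \<and> [y ^ 2 = g x] (mod int p)" for x y
    by (auto simp: X_def)
  have Z_nz: "\<not> int p dvd x \<and> \<not> int p dvd y" if "(x, y) \<in> ?Z" for x y
  proof -
    from that have gx: "\<not> int p dvd g x" and y: "[y ^ 2 = g x] (mod int p)" using Z by auto
    have "\<not> int p dvd y ^ 2" using gx cong_dvd_iff[OF y] by simp
    then show ?thesis using gx by (auto simp: g_def dvd_mult_iff dvd_power_iff)
  qed
  have beta: "\<exists>w. [w * x = 1] (mod int p) \<and> \<not> int p dvd w \<and> [x' = b * w] (mod int p) \<and> [y' = b * y * w ^ 2] (mod int p)
      \<and> x' \<in> {0..<int p} \<and> y' \<in> {0..<int p}"
    if "\<not> int p dvd x" "\<beta> (x, y) = (x', y')" for x y x' y'
  proof (intro exI conjI)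
    show w: "[iv x * x = 1] (mod int p)"
      unfolding iv_def using inverse_exists[OF that(1)] by (simp add: mult.commute)
    show "\<not> int p dvd iv x" using cong_dvd_iff[OF w] not_dvd_small[of 1] p_gt_3 by auto
    show "[x' = b * iv x] (mod int p)" "[y' = b * y * (iv x) ^ 2] (mod int p)" "x' \<in> {0..<int p}" "y' \<in> {0..<int p}"
      using that(2) mod_range by (auto simp: \<beta>_def unique_euclidean_semiring_class.cong_def)
  qed
  have g_inv: "[g (b * w) = b ^ 2 * w ^ 4 * g x] (mod int p)" if w: "[w * x = 1] (mod int p)" for w x
  proof -
    have e1: "b ^ 2 * w ^ 4 * g x = b ^ 2 * w * ((w * x) * ((w * x) ^ 2 + a * w * (w * x) + b * w ^ 2))"
      by (simp add: g_def algebra_simps power_numeral_reduce)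
    have c: "[b ^ 2 * w * ((w * x) * ((w * x) ^ 2 + a * w * (w * x) + b * w ^ 2)) =
        b ^ 2 * w * (1 * (1 ^ 2 + a * w * 1 + b * w ^ 2))] (mod int p)"
      by (rule cong_mult[OF cong_refl cong_mult[OF w cong_add[OF cong_add[OF cong_pow[OF w] cong_mult[OF cong_refl w]] cong_refl]]])
    have e2: "b ^ 2 * w * (1 * (1 ^ 2 + a * w * 1 + b * w ^ 2)) = g (b * w)"
      by (simp add: g_def algebra_simps power_numeral_reduce)
    show ?thesis unfolding e1 by (rule cong_sym) (rule c[unfolded e2])
  qed
  show ?thesis
  proof (rule four_dvd_card[where \<alpha> = \<alpha> and \<beta> = \<beta>])
    show "finite ?Z" by (rule finite_subset[of _ "{0..<int p} \<times> {0..<int p}"]) (auto simp: X_def)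
    fix z assume z0: "z \<in> ?Z"
    obtain x y where z: "z = (x, y)" by (cases z)
    have xy: "x \<in> {0..<int p}" "y \<in> {0..<int p}" "\<not> int p dvd g x" "\<not> [x ^ 2 = b] (mod int p)"
      "[y ^ 2 = g x] (mod int p)" using z0 Z unfolding z by auto
    have nz: "\<not> int p dvd x" "\<not> int p dvd y" using Z_nz z0 unfolding z by auto
    obtain x' y' where \<beta>z: "\<beta> (x, y) = (x', y')" by (cases "\<beta> (x, y)")
    from beta[OF nz(1) this] obtain w where w: "[w * x = 1] (mod int p)" "\<not> int p dvd w"
      "[x' = b * w] (mod int p)" "[y' = b * y * w ^ 2] (mod int p)" "x' \<in> {0..<int p}" "y' \<in> {0..<int p}" by blast
    have neg: "[((- y) mod int p) ^ 2 = y ^ 2] (mod int p)"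
      by (simp add: unique_euclidean_semiring_class.cong_def power_mod)
    show "\<alpha> z \<in> ?Z"
      unfolding z \<alpha>_def prod.case Z using xy mod_range cong_trans[OF neg xy(5)] by blast
    have x'2: "\<not> [x' ^ 2 = b] (mod int p)"
    proof
      assume "[x' ^ 2 = b] (mod int p)"
      with cong_pow[OF w(3), of 2] have "[(b * w) ^ 2 = b] (mod int p)" by (meson cong_sym cong_trans)
      then have "[b * (b * w ^ 2) = b * 1] (mod int p)" by (simp add: power2_eq_square mult_ac)
      then have bw: "[b * w ^ 2 = 1] (mod int p)" using b by (rule cancel)
      have "[b * (w * x) ^ 2 = b * 1 ^ 2] (mod int p)" by (rule cong_mult[OF cong_refl cong_pow[OF w(1)]])
      then have 1: "[b * (w * x) ^ 2 = b] (mod int p)" by simp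
      have "[(b * w ^ 2) * x ^ 2 = 1 * x ^ 2] (mod int p)" by (rule cong_mult[OF bw cong_refl])
      then have 2: "[b * (w * x) ^ 2 = x ^ 2] (mod int p)" by (simp add: power_mult_distrib mult.assoc)
      from cong_trans[OF cong_sym[OF 2] 1] xy(4) show False by blast
    qed
    have gx': "[g x' = b ^ 2 * w ^ 4 * g x] (mod int p)"
      by (rule cong_trans[OF g_cong[OF w(3)] g_inv[OF w(1)]])
    have "\<not> int p dvd g x'"
      using cong_dvd_iff[OF gx'] b w(2) xy(3) by (simp add: dvd_mult_iff dvd_power_iff)
    moreover have "[y' ^ 2 = g x'] (mod int p)"
    proof -
      have "[y' ^ 2 = (b * y * w ^ 2) ^ 2] (mod int p)" by (rule cong_pow[OF w(4)])
      moreover have "(b * y * w ^ 2) ^ 2 = b ^ 2 * w ^ 4 * y ^ 2"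
        by (simp add: power_mult_distrib algebra_simps)
      moreover have "[b ^ 2 * w ^ 4 * y ^ 2 = b ^ 2 * w ^ 4 * g x] (mod int p)"
        by (rule cong_mult[OF cong_refl xy(5)])
      ultimately show ?thesis using gx' by (metis cong_sym cong_trans)
    qed
    ultimately show "\<beta> z \<in> ?Z" unfolding z \<beta>z Z using w x'2 by blast
    then have z'0: "(x', y') \<in> ?Z" by (simp add: z \<beta>z)
    show "\<alpha> (\<alpha> z) = z"
      unfolding z \<alpha>_def using xy(2) by (simp add: mod_minus_eq)
    obtain x'' y'' where \<beta>z': "\<beta> (x', y') = (x'', y'')" by (cases "\<beta> (x', y')")
    from beta[OF _ this] Z_nz[OF z'0] obtain w' where w': "[w' * x' = 1] (mod int p)"
      "[x'' = b * w'] (mod int p)" "[y'' = b * y' * w' ^ 2] (mod int p)" "x'' \<in> {0..<int p}" "y'' \<in> {0..<int p}" by blast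
    have bww: "[b * w * w' = 1] (mod int p)"
      using cong_trans[OF cong_mult[OF cong_sym[OF w(3)] cong_refl[of w']], of 1] w'(1) by (simp add: mult.commute)
    have "[x'' = x] (mod int p)"
    proof -
      have "[b * w * w' * x = 1 * x] (mod int p)" by (rule cong_mult[OF bww cong_refl])
      then have 1: "[(b * w') * (w * x) = x] (mod int p)" by (simp add: mult_ac)
      have "[(b * w') * (w * x) = (b * w') * 1] (mod int p)" by (rule cong_mult[OF cong_refl w(1)])
      then have 2: "[(b * w') * (w * x) = b * w'] (mod int p)" by simp
      show ?thesis by (rule cong_trans[OF w'(2) cong_trans[OF cong_sym[OF 2] 1]])
    qed
    moreover have "[y'' = y] (mod int p)"
    proof -
      have "[b * y' * w' ^ 2 = b * (b * y * w ^ 2) * w' ^ 2] (mod int p)"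
        by (rule cong_mult[OF cong_mult[OF cong_refl w(4)] cong_refl])
      moreover have "b * (b * y * w ^ 2) * w' ^ 2 = (b * w * w') ^ 2 * y"
        by (simp add: power2_eq_square mult_ac)
      moreover have "[(b * w * w') ^ 2 * y = 1 ^ 2 * y] (mod int p)"
        by (rule cong_mult[OF cong_pow[OF bww] cong_refl])
      ultimately show ?thesis using w'(3) by (metis cong_trans mult_1 power_one)
    qed
    ultimately show "\<beta> (\<beta> z) = z"
      unfolding z \<beta>z \<beta>z' using eq_of_cong[OF w'(4) xy(1)] eq_of_cong[OF w'(5) xy(2)] by simp
    show "\<alpha> (\<beta> z) = \<beta> (\<alpha> z)"
    proof -
      have "(- ((b * y * iv x ^ 2) mod int p)) mod int p = (b * ((- y) mod int p) * iv x ^ 2) mod int p"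
      proof (rule eq_of_cong[OF mod_range mod_range])
        have A1: "[(- ((b * y * iv x ^ 2) mod int p)) mod int p = - (b * y * iv x ^ 2)] (mod int p)"
          by (simp add: unique_euclidean_semiring_class.cong_def mod_minus_eq)
        have A2: "[(b * ((- y) mod int p) * iv x ^ 2) mod int p = b * (- y) * iv x ^ 2] (mod int p)"
        proof -
          have "[b * ((- y) mod int p) * iv x ^ 2 = b * (- y) * iv x ^ 2] (mod int p)"
            by (rule cong_mult[OF cong_mult[OF cong_refl] cong_refl]) simp
          then show ?thesis by simp
        qed
        have A3: "b * (- y) * iv x ^ 2 = - (b * y * iv x ^ 2)" by simp
        show "[(- ((b * y * iv x ^ 2) mod int p)) mod int p = (b * ((- y) mod int p) * iv x ^ 2) mod int p] (mod int p)"
          by (rule cong_trans[OF A1 cong_sym[OF A2[unfolded A3]]])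
      qed
      then show ?thesis by (simp add: z \<alpha>_def \<beta>_def)
    qed
    show "\<alpha> z \<noteq> z"
    proof
      assume "\<alpha> z = z"
      then have "(- y) mod int p = y" by (simp add: z \<alpha>_def)
      then have "[- y = y] (mod int p)" using xy(2) by (simp add: unique_euclidean_semiring_class.cong_def)
      then have "int p dvd 2 * y" by (simp add: cong_iff_dvd_diff)
      then show False using nz not_dvd_2 by (simp add: dvd_mult_iff)
    qed
    have x'x: "x' \<noteq> x"
    proof
      assume "x' = x"
      then have "[x * x = b * w * x] (mod int p)" using w(3) by (intro cong_mult cong_refl) simp
      moreover have "[b * (w * x) = b * 1] (mod int p)" by (rule cong_mult[OF cong_refl w(1)])
      ultimately have "[x ^ 2 = b] (mod int p)" by (metis cong_trans mult.assoc mult.right_neutral power2_eq_square)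
      with xy(4) show False by blast
    qed
    then show "\<beta> z \<noteq> z" "\<alpha> (\<beta> z) \<noteq> z" by (simp_all add: z \<beta>z \<alpha>_def)
  qed
qed

lemma card_quadratic_roots:
  "int (card {x. x \<in> {0..<int p} \<and> [x ^ 2 + a * x + b = 0] (mod int p)}) = 1 + Legendre (a ^ 2 - 4 * b) p"
  (is "int (card ?R) = _")
proof -
  let ?S = "{y. y \<in> {0..<int p} \<and> [y ^ 2 = a ^ 2 - 4 * b] (mod int p)}"
  define F where "F = (\<lambda>x. (2 * x + a) mod int p)"
  have inj: "inj_on F {0..<int p}"
  proof (rule inj_onI)
    fix x x' assume x: "x \<in> {0..<int p}" "x' \<in> {0..<int p}" "F x = F x'"
    then have "[2 * x + a = 2 * x' + a] (mod int p)" by (simp add: F_def unique_euclidean_semiring_class.cong_def)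
    then have "[2 * x = 2 * x'] (mod int p)" by (simp add: cong_add_rcancel)
    then have "[x = x'] (mod int p)" using not_dvd_2 by (rule cancel)
    then show "x = x'" using x by (simp add: eq_of_cong)
  qed
  have surj: "F ` {0..<int p} = {0..<int p}"
    by (rule endo_inj_surj[OF _ _ inj]) (use mod_range in \<open>auto simp: F_def\<close>)
  have iff: "[x ^ 2 + a * x + b = 0] (mod int p) \<longleftrightarrow> [(F x) ^ 2 = a ^ 2 - 4 * b] (mod int p)" for x
  proof -
    have "[(F x) ^ 2 = a ^ 2 - 4 * b] (mod int p) \<longleftrightarrow> [(2 * x + a) ^ 2 = a ^ 2 - 4 * b] (mod int p)"
      by (simp add: F_def unique_euclidean_semiring_class.cong_def power_mod)
    also have "\<dots> \<longleftrightarrow> int p dvd 2 * 2 * (x ^ 2 + a * x + b)"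
    proof -
      have "(2 * x + a) ^ 2 - (a ^ 2 - 4 * b) = 2 * 2 * (x ^ 2 + a * x + b)"
        by (simp add: power2_eq_square algebra_simps)
      then show ?thesis by (simp only: cong_iff_dvd_diff)
    qed
    also have "\<dots> \<longleftrightarrow> int p dvd x ^ 2 + a * x + b" using not_dvd_2 by (simp only: dvd_mult_iff) simp
    finally show ?thesis by (simp add: cong_0_iff)
  qed
  have "F ` ?R = ?S"
  proof (intro equalityI subsetI)
    fix y assume "y \<in> F ` ?R"
    then obtain x where x: "y = F x" "[x ^ 2 + a * x + b = 0] (mod int p)" by auto
    have "F x \<in> {0..<int p}" unfolding F_def by (rule mod_range)
    then show "y \<in> ?S" using x iff by simp
  next
    fix y assume y: "y \<in> ?S"
    then have "y \<in> F ` {0..<int p}" using surj by simp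
    then obtain x where "x \<in> {0..<int p}" "y = F x" by auto
    then show "y \<in> F ` ?R" using y iff by auto
  qed
  moreover have "inj_on F ?R" using inj by (rule inj_on_subset) auto
  ultimately have "card ?R = card ?S" using card_image[of F ?R] by simp
  then show ?thesis by (simp only: card_square_roots)
qed

text \<open>
  Outside the free part there remain the point at infinity, the point \<open>(0, 0)\<close>, the \<open>1 + (a\<^sup>2 - 4 b / p)\<close>
  further points of order two, and the points over \<open>x = \<plusminus>r\<close> if \<open>b = r\<^sup>2\<close>. At such an \<open>x\<close> the cubic
  takes the value \<open>r\<^sup>2 (a + 2 x)\<close>, and the product of \<open>a + 2 r\<close> and \<open>a - 2 r\<close> is \<open>a\<^sup>2 - 4 b\<close>.
  If \<open>b\<close> is not a square, then \<open>a\<^sup>2 - 4 b\<close> is, and four points remain. If \<open>b\<close> and \<open>a\<^sup>2 - 4 b\<close> are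
  squares, the points over \<open>r\<close> and \<open>-r\<close> number \<open>0\<close> or \<open>4\<close>, in addition to these four; if only \<open>b\<close>
  is, they number \<open>2\<close>, in addition to two.
\<close>

theorem four_dvd_points:
  fixes a b :: int
  assumes b: "\<not> int p dvd b" and D: "\<not> int p dvd a ^ 2 - 4 * b"
    and sq: "Legendre b p = 1 \<or> Legendre (a ^ 2 - 4 * b) p = 1"
  defines "g \<equiv> \<lambda>x. x * (x ^ 2 + a * x + b)"
  shows "4 dvd 1 + card (sqpoints g)"
proof -
  define X where "X = {x. x \<in> {0..<int p} \<and> \<not> int p dvd g x \<and> \<not> [x ^ 2 = b] (mod int p)}"
  define R where "R = {x. x \<in> {0..<int p} \<and> [x ^ 2 + a * x + b = 0] (mod int p)}"
  define Q where "Q = {x. x \<in> {0..<int p} \<and> [x ^ 2 = b] (mod int p)}"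
  define h where "h = (\<lambda>x. 1 + Legendre (g x) p)"
  have fin: "finite X" "finite R" "finite Q"
    unfolding X_def R_def Q_def by (auto intro: finite_subset[of _ "{0..<int p}"])
  have RQ: "R \<inter> Q = {}"
  proof (rule ccontr)
    assume "R \<inter> Q \<noteq> {}"
    then obtain x where x: "[x ^ 2 + a * x + b = 0] (mod int p)" "[x ^ 2 = b] (mod int p)" by (auto simp: R_def Q_def)
    have d1: "int p dvd x ^ 2 + a * x + b" "int p dvd x ^ 2 - b" using x by (auto simp: cong_0_iff cong_iff_dvd_diff)
    \<comment> \<open>\<open>(a\<^sup>2 - 4 b) b\<close> is a combination of \<open>x\<^sup>2 + a x + b\<close> and \<open>x\<^sup>2 - b\<close>.\<close>
    have "(a ^ 2 - 4 * b) * b = (x ^ 2 + a * x + b) * (a * x - x ^ 2 - b) + (x ^ 2 - b) * (x ^ 2 - a ^ 2 + 3 * b)"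
      by (simp add: power2_eq_square algebra_simps)
    also have "int p dvd \<dots>" by (rule dvd_add[OF dvd_mult2[OF d1(1)] dvd_mult2[OF d1(2)]])
    finally show False using b D by (simp add: dvd_mult_iff)
  qed
  have zero: "0 \<notin> R" "0 \<notin> Q" using b by (auto simp: R_def Q_def cong_0_iff cong_sym_eq[of 0])
  have X_disj: "X \<inter> Q = {}" "X \<inter> R = {}" "0 \<notin> X"
    by (auto simp: X_def Q_def R_def g_def cong_0_iff)
  have split: "{0..<int p} = insert 0 (R \<union> (Q \<union> X))"
  proof (intro equalityI subsetI)
    fix x assume x: "x \<in> {0..<int p}"
    show "x \<in> insert 0 (R \<union> (Q \<union> X))"
    proof (cases "int p dvd g x")
      case True
      then show ?thesis using x range_dvd_iff[OF x] by (auto simp: g_def dvd_mult_iff R_def cong_0_iff)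
    next
      case False
      then show ?thesis using x by (auto simp: X_def Q_def)
    qed
  qed (use p_gt_3 in \<open>auto simp: R_def Q_def X_def\<close>)
  have "int (card (sqpoints g)) = (\<Sum>x\<in>insert 0 (R \<union> (Q \<union> X)). h x)"
    unfolding card_sqpoints h_def split ..
  also have "\<dots> = h 0 + (\<Sum>x\<in>R \<union> (Q \<union> X). h x)"
    using zero X_disj fin by (intro sum.insert) auto
  also have "(\<Sum>x\<in>R \<union> (Q \<union> X). h x) = (\<Sum>x\<in>R. h x) + (\<Sum>x\<in>Q \<union> X. h x)"
    using RQ X_disj fin by (intro sum.union_disjoint) auto
  also have "(\<Sum>x\<in>Q \<union> X. h x) = (\<Sum>x\<in>Q. h x) + (\<Sum>x\<in>X. h x)"
    using X_disj fin by (intro sum.union_disjoint) auto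
  also have "h 0 = 1" by (simp add: h_def g_def Legendre_def)
  also have "(\<Sum>x\<in>R. h x) = 1 + Legendre (a ^ 2 - 4 * b) p"
  proof -
    have "h x = 1" if "x \<in> R" for x
    proof -
      have "int p dvd g x" using that by (auto simp: R_def g_def cong_0_iff)
      then show ?thesis by (simp add: h_def Legendre_eq_0_iff)
    qed
    then have "(\<Sum>x\<in>R. h x) = int (card R)" by simp
    then show ?thesis unfolding R_def card_quadratic_roots .
  qed
  also have "(\<Sum>x\<in>X. h x) = int (card {(x, y). x \<in> X \<and> y \<in> {0..<int p} \<and> [y ^ 2 = g x] (mod int p)})"
    unfolding h_def by (rule card_sqpoints_on [symmetric]) (auto simp: X_def)
  finally have count: "int (card (sqpoints g)) = 1 + (1 + Legendre (a ^ 2 - 4 * b) p + ((\<Sum>x\<in>Q. h x) +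
      int (card {(x, y). x \<in> X \<and> y \<in> {0..<int p} \<and> [y ^ 2 = g x] (mod int p)})))" .
  have four: "4 dvd int (card {(x, y). x \<in> X \<and> y \<in> {0..<int p} \<and> [y ^ 2 = g x] (mod int p)})"
    using four_dvd_free_part[OF b, of a] unfolding X_def g_def by presburger
  have main: "4 dvd 3 + Legendre (a ^ 2 - 4 * b) p + (\<Sum>x\<in>Q. h x)"
  proof (cases "Legendre b p = 1")
    case False
    then have "Legendre b p = - 1" using Legendre_nz[OF b] by simp
    then have "int (card Q) = 0" unfolding Q_def card_square_roots by simp
    then have "Q = {}" using fin by simp
    then show ?thesis using sq False by simp
  next
    case True
    then obtain r0 where r0: "[r0 ^ 2 = b] (mod int p)" by (auto simp: QuadRes_Legendre QuadRes_def)
    define r where "r = r0 mod int p"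
    have r: "[r ^ 2 = b] (mod int p)" "r \<in> {0..<int p}"
      using r0 mod_range by (auto simp: r_def unique_euclidean_semiring_class.cong_def power_mod)
    have rnz: "\<not> int p dvd r" using cong_dvd_iff[OF r(1)] b by (simp add: dvd_power_iff)
    then have "r \<noteq> 0" by auto
    define r' where "r' = int p - r"
    have r': "[r' = - r] (mod int p)" "r' \<in> {0..<int p}" using r(2) \<open>r \<noteq> 0\<close> by (auto simp: r'_def cong_iff_dvd_diff)
    have r'2: "[r' ^ 2 = b] (mod int p)" using cong_trans[OF cong_pow[OF r'(1), of 2]] r(1) by simp
    have "r \<noteq> r'"
    proof
      assume "r = r'"
      then have "int p dvd 2 * r" using r'(1) by (simp add: cong_iff_dvd_diff)
      then show False using rnz not_dvd_2 by (simp add: dvd_mult_iff)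
    qed
    have "card Q = 2"
    proof -
      have "int (card Q) = 2" unfolding Q_def card_square_roots using True by simp
      then show ?thesis by simp
    qed
    moreover have "{r, r'} \<subseteq> Q" using r r' r'2 by (simp add: Q_def)
    ultimately have Q: "Q = {r, r'}" using fin \<open>r \<noteq> r'\<close> by (intro card_subset_eq [symmetric]) auto
    have g_val: "Legendre (g s) p = Legendre (a + 2 * s) p" if s: "[s ^ 2 = b] (mod int p)" for s
    proof -
      have "[g s = s * (s ^ 2 + a * s + s ^ 2)] (mod int p)"
        unfolding g_def by (intro cong_mult[OF cong_refl] cong_add cong_refl cong_sym[OF s])
      then have "Legendre (g s) p = Legendre (s * (s ^ 2 + a * s + s ^ 2)) p" by (rule Legendre_cong)
      also have "s * (s ^ 2 + a * s + s ^ 2) = s ^ 2 * (a + 2 * s)" by (simp add: power2_eq_square algebra_simps)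
      also have "Legendre \<dots> p = Legendre (s ^ 2) p * Legendre (a + 2 * s) p" by (rule Legendre_mult[OF prime_p p_gt_2])
      also have "Legendre (s ^ 2) p = 1"
        using cong_dvd_iff[OF s] b by (intro Legendre_square) (simp add: dvd_power_iff)
      finally show ?thesis by simp
    qed
    have L2: "Legendre (g r') p = Legendre (a - 2 * r) p"
    proof -
      have "[a + 2 * r' = a + 2 * (- r)] (mod int p)" by (intro cong_add cong_mult[OF cong_refl] cong_refl r'(1))
      then have "[a + 2 * r' = a - 2 * r] (mod int p)" by simp
      then show ?thesis unfolding g_val[OF r'2] by (rule Legendre_cong)
    qed
    have prod: "Legendre (a + 2 * r) p * Legendre (a - 2 * r) p = Legendre (a ^ 2 - 4 * b) p"
    proof -
      have "[a ^ 2 - 4 * r ^ 2 = a ^ 2 - 4 * b] (mod int p)" by (intro cong_diff cong_mult[OF cong_refl] cong_refl r(1))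
      moreover have "(a + 2 * r) * (a - 2 * r) = a ^ 2 - 4 * r ^ 2" by (simp add: power2_eq_square algebra_simps)
      ultimately have "[(a + 2 * r) * (a - 2 * r) = a ^ 2 - 4 * b] (mod int p)" by simp
      then show ?thesis using Legendre_cong Legendre_mult[OF prime_p p_gt_2] by metis
    qed
    have nz: "Legendre (a ^ 2 - 4 * b) p \<noteq> 0" using D by (simp add: Legendre_eq_0_iff)
    have sumQ: "(\<Sum>x\<in>Q. h x) = 2 + Legendre (a + 2 * r) p + Legendre (a - 2 * r) p"
      unfolding Q using \<open>r \<noteq> r'\<close> by (simp add: h_def g_val[OF r(1)] L2)
    have "4 dvd 3 + d + (2 + l1 + l2)"
      if "l1 * l2 = d" "d \<noteq> 0" "l1 \<in> {-1, 0, 1}" "l2 \<in> {-1, 0, 1}" for d l1 l2 :: int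
      using that by auto
    from this[OF prod nz Legendre_values Legendre_values] show ?thesis unfolding sumQ .
  qed
  have "4 dvd (3 + Legendre (a ^ 2 - 4 * b) p + (\<Sum>x\<in>Q. h x)) +
      int (card {(x, y). x \<in> X \<and> y \<in> {0..<int p} \<and> [y ^ 2 = g x] (mod int p)})"
    by (rule dvd_add[OF main four])
  then have "4 dvd 1 + int (card (sqpoints g))" unfolding count by (simp add: algebra_simps)
  then show ?thesis by presburger
qed

end

section \<open>The family and its rational points of order two\<close>

lemma nine_plus_four_square_nonzero: "9 + 4 * (t :: rat) ^ 2 \<noteq> 0"
proof -
  have "9 + 4 * t ^ 2 > 0" by (intro add_pos_nonneg) simp_all
  then show ?thesis by simp
qed

lemma discriminant_E_fam: "discriminant (E_fam t) = - 432 * t ^ 4 * (9 + 4 * t ^ 2)"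
  unfolding E_fam_def discriminant_def Let_def weierstrass.sel by (simp add: algebra_simps power_numeral_reduce)

lemma discriminant_E_fam_nonzero: "t \<noteq> 0 \<Longrightarrow> discriminant (E_fam t) \<noteq> 0"
  using nine_plus_four_square_nonzero[of t] by (simp add: discriminant_E_fam)

context prime_above_3
begin

text \<open>
  The defining equation of \<open>E_fam t\<close> is itself a good model, but the reduction is formed from an arbitrary one.
  As both discriminants are units, so is the scaling factor \<open>u\<close>. Then the remaining parameters of the change of
  variables are integral because \<open>2\<close> and \<open>3\<close> are invertible, and the whole change of variables can be reduced
  modulo \<open>p\<close>.
\<close>

lemma reduction_card_eq:
  fixes t :: rat
  assumes t: "t \<noteq> 0" and val: "rat_val p (t * (9 + 4 * t ^ 2)) = 0"
  shows "good_reduction (E_fam t) p \<and> (\<exists>\<tau>. res_cong t \<tau> \<and> \<not> int p dvd \<tau> \<and> \<not> int p dvd 9 + 4 * \<tau> ^ 2 \<and>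
    reduction_card t p = 1 + card (sqpoints (\<lambda>x. x ^ 3 + (- 3 * (\<tau> ^ 2 + 1)) * x ^ 2 + 3 * x + (- 1))))"
proof -
  note pos = nine_plus_four_square_nonzero[of t]
  have int_t: "p_integral p t"
  proof -
    obtain n d where nd: "quotient_of t = (n, d)" by (cases "quotient_of t")
    have q: "t * of_int d = of_int n" using quotient_of_mult[of t] nd by simp
    have d: "d > 0" using nd by (rule quotient_of_denom_pos)
    have n: "n \<noteq> 0" using q t d by auto
    have "t * (9 + 4 * t ^ 2) * of_int (d ^ 3) = (t * of_int d) * (9 * (of_int d) ^ 2 + 4 * (t * of_int d) ^ 2)"
      by (simp add: power2_eq_square power3_eq_cube algebra_simps)
    also have "\<dots> = of_int (n * (9 * d ^ 2 + 4 * n ^ 2))" unfolding q by simp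
    finally have eq: "t * (9 + 4 * t ^ 2) * of_int (d ^ 3) = of_int (n * (9 * d ^ 2 + 4 * n ^ 2))" .
    have nz: "t * (9 + 4 * t ^ 2) \<noteq> 0" using t pos by simp
    have "\<not> int p dvd d"
    proof
      assume pd: "int p dvd d"
      have "coprime n d" using nd by (rule quotient_of_coprime)
      then have pn: "\<not> int p dvd n" using pd prime_int_p by (meson coprime_common_divisor not_prime_unit)
      have "\<not> int p dvd 9 * d ^ 2 + 4 * n ^ 2"
      proof
        assume "int p dvd 9 * d ^ 2 + 4 * n ^ 2"
        moreover have "int p dvd 9 * d ^ 2" using pd by (simp add: power2_eq_square)
        ultimately have "int p dvd 2 * 2 * n ^ 2" by (simp add: dvd_add_right_iff)
        then show False using pn not_dvd_2 by (simp only: dvd_mult_iff) (simp add: dvd_power_iff)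
      qed
      then have "\<not> int p dvd n * (9 * d ^ 2 + 4 * n ^ 2)" using pn by (simp add: dvd_mult_iff)
      then have "multiplicity (int p) (n * (9 * d ^ 2 + 4 * n ^ 2)) = 0" by (rule not_dvd_imp_multiplicity_0)
      moreover have "multiplicity (int p) (d ^ 3) > 0"
        using pd d prime_int_p by (simp add: prime_multiplicity_gt_zero_iff dvd_power_iff)
      moreover have "d ^ 3 \<noteq> 0" using d by simp
      ultimately show False using rat_val_eq[OF nz eq] val by simp
    qed
    then show ?thesis using q unfolding p_integral_iff by blast
  qed
  define \<tau> where "\<tau> = rat_mod p t"
  have rt: "res_cong t \<tau>" unfolding \<tau>_def by (rule res_cong_refl[OF int_t])
  have "res_cong (t * (9 + 4 * t ^ 2)) (\<tau> * (9 + 4 * \<tau> ^ 2))" by (intro res_cong_intros rt)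
  then have "\<not> int p dvd \<tau> * (9 + 4 * \<tau> ^ 2)"
    using rat_val_zero_iff[of "t * (9 + 4 * t ^ 2)"] t pos val cong_dvd_iff unfolding res_cong_def by auto
  then have \<tau>: "\<not> int p dvd \<tau>" "\<not> int p dvd 9 + 4 * \<tau> ^ 2" by (auto simp: dvd_mult_iff)
  note disc = discriminant_E_fam[of t] and disc_nz = discriminant_E_fam_nonzero[OF t]
  have val_disc: "rat_val p (discriminant (E_fam t)) = 0"
  proof -
    have r: "res_cong (discriminant (E_fam t)) (- 432 * \<tau> ^ 4 * (9 + 4 * \<tau> ^ 2))"
      unfolding disc by (intro res_cong_intros rt)
    have "(- 432 :: int) = 2 * 2 * 2 * 2 * 3 * 3 * 3 * (- 1)" by simp
    then have "\<not> int p dvd - 432 * \<tau> ^ 4 * (9 + 4 * \<tau> ^ 2)"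
      using \<tau> not_dvd_2 not_dvd_3 not_dvd_small[of 1] p_gt_3
      by (simp only: dvd_mult_iff dvd_minus_iff) (simp add: dvd_power_iff)
    then show ?thesis using rat_val_zero_iff[OF _ disc_nz] r cong_dvd_iff unfolding res_cong_def by blast
  qed
  have "weierstrass_iso (E_fam t) (E_fam t)"
    unfolding weierstrass_iso_def E_fam_def
    by (rule exI[of _ 1], rule exI[of _ 0], rule exI[of _ 0], rule exI[of _ 0]) simp
  moreover have "\<forall>c\<in>set_weierstrass (E_fam t). p_integral p c"
    unfolding E_fam_def weierstrass.set using p_integral_intros int_t
    by (auto intro!: p_integral_intros int_t)
  ultimately have "good_model p (E_fam t) (E_fam t)"
    using disc_nz val_disc unfolding good_model_def by blast
  then have good: "good_reduction (E_fam t) p" unfolding good_reduction_def by blast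
  define W where "W = (SOME W. good_model p (E_fam t) W)"
  have gm: "good_model p (E_fam t) W" unfolding W_def using good unfolding good_reduction_def by (rule someI_ex)
  define A where "A = - 3 * (t ^ 2 + 1)"
  have E: "E_fam t = Weierstrass 0 A 0 3 (- 1)" by (simp add: E_fam_def A_def)
  obtain u r s w where u: "u \<noteq> 0" and h: "u * cf1 W = 2 * s" "u ^ 2 * cf2 W = A + 3 * r - s ^ 2" "u ^ 3 * cf3 W = 2 * w"
      "u ^ 4 * cf4 W = 3 + 2 * r * A + 3 * r ^ 2 - 2 * s * w"
      "u ^ 6 * cf6 W = - 1 + r * 3 + r ^ 2 * A + r ^ 3 - w ^ 2"
      "u ^ 12 * discriminant W = discriminant (E_fam t)"
    using discriminant_iso[of A 3 "- 1" W] gm unfolding good_model_def E by blast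
  have W_disc: "discriminant W \<noteq> 0" "rat_val p (discriminant W) = 0" using gm by (auto simp: good_model_def)
  have W_int: "p_integral p (cf1 W)" "p_integral p (cf2 W)" "p_integral p (cf3 W)" "p_integral p (cf4 W)" "p_integral p (cf6 W)"
    using gm unfolding good_model_def by (cases W; simp)+
  have "int 12 * rat_val p u = 0"
    using rat_val_mult[of "u ^ 12" "discriminant W"] rat_val_power[OF u, of 12] u W_disc val_disc h(6) by simp
  then have u_val: "rat_val p u = 0" by simp
  then have u_int: "p_integral p u" by (simp add: p_integral_def)
  have A_int: "p_integral p A" unfolding A_def by (intro p_integral_intros int_t)
  have s_int: "p_integral p s"
    using p_integral_cancel[OF not_dvd_2, of s] p_integral_mult[OF u_int W_int(1)] h(1) by simp
  have w_int: "p_integral p w"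
    using p_integral_cancel[OF not_dvd_2, of w] p_integral_mult[OF p_integral_power[OF u_int] W_int(3), of 3] h(3) by simp
  have r_int: "p_integral p r"
  proof -
    have "of_int 3 * r = u ^ 2 * cf2 W - A + s ^ 2" unfolding h by simp
    moreover have "p_integral p (u ^ 2 * cf2 W - A + s ^ 2)" by (intro p_integral_intros u_int W_int A_int s_int)
    ultimately show ?thesis using p_integral_cancel[OF not_dvd_3, of r] by simp
  qed
  define U R S T where "U = rat_mod p u" and "R = rat_mod p r" and "S = rat_mod p s" and "T = rat_mod p w"
  define a1 a2 a3 a4 a6 where "a1 = rat_mod p (cf1 W)" and "a2 = rat_mod p (cf2 W)" and "a3 = rat_mod p (cf3 W)"
    and "a4 = rat_mod p (cf4 W)" and "a6 = rat_mod p (cf6 W)"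
  note rc = res_cong_refl[OF u_int, folded U_def] res_cong_refl[OF r_int, folded R_def]
    res_cong_refl[OF s_int, folded S_def] res_cong_refl[OF w_int, folded T_def]
    res_cong_refl[OF W_int(1), folded a1_def] res_cong_refl[OF W_int(2), folded a2_def]
    res_cong_refl[OF W_int(3), folded a3_def] res_cong_refl[OF W_int(4), folded a4_def]
    res_cong_refl[OF W_int(5), folded a6_def]
  have rA: "res_cong A (- 3 * (\<tau> ^ 2 + 1))" unfolding A_def by (intro res_cong_intros rt)
  have U: "\<not> int p dvd U" using rat_val_zero_iff[OF u_int u] u_val by (simp add: U_def)
  have "card (points_mod p (Weierstrass a1 a2 a3 a4 a6)) =
      1 + card (sqpoints (\<lambda>x. x ^ 3 + (- 3 * (\<tau> ^ 2 + 1)) * x ^ 2 + 3 * x + (- 1)))"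
  proof (rule weierstrass_transport[OF U])
    show "[U * a1 = 2 * S] (mod int p)"
      by (rule res_cong_unique[of "u * cf1 W"], intro res_cong_intros rc, unfold h, intro res_cong_intros rc)
    show "[U ^ 2 * a2 = - 3 * (\<tau> ^ 2 + 1) + 3 * R - S ^ 2] (mod int p)"
      by (rule res_cong_unique[of "u ^ 2 * cf2 W"], intro res_cong_intros rc, unfold h, intro res_cong_intros rc rA)
    show "[U ^ 3 * a3 = 2 * T] (mod int p)"
      by (rule res_cong_unique[of "u ^ 3 * cf3 W"], intro res_cong_intros rc, unfold h, intro res_cong_intros rc)
    show "[U ^ 4 * a4 = 3 + 2 * R * (- 3 * (\<tau> ^ 2 + 1)) + 3 * R ^ 2 - 2 * S * T] (mod int p)"
      by (rule res_cong_unique[of "u ^ 4 * cf4 W"], intro res_cong_intros rc, unfold h, intro res_cong_intros rc rA)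
    show "[U ^ 6 * a6 = - 1 + R * 3 + R ^ 2 * (- 3 * (\<tau> ^ 2 + 1)) + R ^ 3 - T ^ 2] (mod int p)"
      by (rule res_cong_unique[of "u ^ 6 * cf6 W"], intro res_cong_intros rc, unfold h, intro res_cong_intros rc rA)
  qed
  moreover have "reduction (E_fam t) p = Weierstrass a1 a2 a3 a4 a6"
    unfolding reduction_def W_def [symmetric] a1_def a2_def a3_def a4_def a6_def by (cases W) simp
  ultimately have "reduction_card t p = 1 + card (sqpoints (\<lambda>x. x ^ 3 + (- 3 * (\<tau> ^ 2 + 1)) * x ^ 2 + 3 * x + (- 1)))"
    by (simp add: reduction_card_def)
  with good rt \<tau> show ?thesis by blast
qed

theorem three_dvd_reduction_card:
  assumes "t \<noteq> 0" "rat_val p (t * (9 + 4 * t ^ 2)) = 0"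
  shows "good_reduction (E_fam t) p \<and> 3 dvd reduction_card t p"
proof -
  obtain \<tau> where good: "good_reduction (E_fam t) p" and \<tau>: "\<not> int p dvd \<tau>" "\<not> int p dvd 9 + 4 * \<tau> ^ 2"
    and card: "reduction_card t p = 1 + card (sqpoints (\<lambda>x. x ^ 3 + (- 3 * (\<tau> ^ 2 + 1)) * x ^ 2 + 3 * x + (- 1)))"
    using reduction_card_eq[OF assms] by blast
  from good three_dvd_points[OF \<tau>] show ?thesis unfolding card ..
qed

end

text \<open>
  For this parameter the number \<open>1 + 3 k\<^sup>2\<close> is a root of \<open>f\<^sub>t(x) = (x - 1)\<^sup>3 - 3 (t x)\<^sup>2\<close>, since
  \<open>t (1 + 3 k\<^sup>2) = 3 k\<^sup>3\<close> and \<open>(3 k\<^sup>2)\<^sup>3 = 3 (3 k\<^sup>3)\<^sup>2\<close>.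
\<close>

definition t_fam :: "int \<Rightarrow> rat" where
  "t_fam k = 3 * of_int k ^ 3 / (1 + 3 * of_int k ^ 2)"

lemma t_fam_denom: "t_fam k * of_int (1 + 3 * k ^ 2) = of_int (3 * k ^ 3)"
proof -
  have "(of_int (1 + 3 * k ^ 2) :: rat) \<noteq> 0"
    by (metis add_pos_nonneg less_irrefl mult_nonneg_nonneg of_int_0_eq_iff zero_le_numeral zero_le_power2 zero_less_one)
  then show ?thesis by (simp add: t_fam_def)
qed

context prime_above_3
begin

text \<open>
  Moving the root \<open>1 + 3 k\<^sup>2\<close> to the origin gives the equation \<open>y\<^sup>2 = x (x\<^sup>2 + a x + b)\<close>. Up to nonzero
  squares, \<open>b\<close> is \<open>3 (1 + k\<^sup>2) (1 + 3 k\<^sup>2)\<close> and \<open>a\<^sup>2 - 4 b\<close> is \<open>- 3 (1 + 4 k\<^sup>2)\<close>, so the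
  hypothesis on Legendre symbols makes the number of points divisible by \<open>4\<close>.
\<close>

lemma twelve_dvd_reduction_card:
  fixes k :: int
  assumes k: "\<not> int p dvd k" and e: "\<not> int p dvd 1 + 3 * k ^ 2" and k1: "\<not> int p dvd 1 + k ^ 2" and k4: "\<not> int p dvd 1 + 4 * k ^ 2"
    and sq: "Legendre (3 * ((1 + k ^ 2) * (1 + 3 * k ^ 2))) p = 1 \<or> Legendre (3 * (- (1 + 4 * k ^ 2))) p = 1"
  shows "good_reduction (E_fam (t_fam k)) p \<and> 12 dvd reduction_card (t_fam k) p"
proof -
  define t where "t = t_fam k"
  define d where "d = 1 + 3 * k ^ 2"
  have td: "t * of_int d = of_int (3 * k ^ 3)" using t_fam_denom[of k] by (simp add: t_def d_def)
  have d: "\<not> int p dvd d" using e by (simp add: d_def)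
  then have d0: "d \<noteq> 0" by auto
  have k0: "k \<noteq> 0" using k by auto
  have t0: "t \<noteq> 0" using td k0 by auto
  have val: "rat_val p (t * (9 + 4 * t ^ 2)) = 0"
  proof -
    have "t * (9 + 4 * t ^ 2) * of_int (d ^ 3) = (t * of_int d) * (9 * (of_int d) ^ 2 + 4 * (t * of_int d) ^ 2)"
      by (simp add: power2_eq_square power3_eq_cube algebra_simps)
    also have "\<dots> = of_int (3 * k ^ 3 * (9 * d ^ 2 + 4 * (3 * k ^ 3) ^ 2))" unfolding td by simp
    also have "9 * d ^ 2 + 4 * (3 * k ^ 3) ^ 2 = 3 * 3 * ((1 + k ^ 2) ^ 2 * (1 + 4 * k ^ 2))"
      by (simp add: d_def algebra_simps power_numeral_reduce)
    finally have eq: "t * (9 + 4 * t ^ 2) * of_int (d ^ 3) = of_int (3 * k ^ 3 * (3 * 3 * ((1 + k ^ 2) ^ 2 * (1 + 4 * k ^ 2))))" .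
    have nd: "\<not> int p dvd 3 * k ^ 3 * (3 * 3 * ((1 + k ^ 2) ^ 2 * (1 + 4 * k ^ 2)))" "\<not> int p dvd d ^ 3"
      using k k1 k4 d not_dvd_3 by (simp_all only: dvd_mult_iff) (simp_all add: dvd_power_iff)
    have "t * (9 + 4 * t ^ 2) \<noteq> 0"
    proof
      assume "t * (9 + 4 * t ^ 2) = 0"
      then have "3 * k ^ 3 * (3 * 3 * ((1 + k ^ 2) ^ 2 * (1 + 4 * k ^ 2))) = 0" using eq by (metis mult_zero_left of_int_eq_0_iff)
      with nd(1) show False by (metis dvd_0_right)
    qed
    from rat_val_eq[OF this eq] d0 not_dvd_imp_multiplicity_0[OF nd(1)] not_dvd_imp_multiplicity_0[OF nd(2)]
    show ?thesis by simp
  qed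
  obtain \<tau> where \<tau>: "res_cong t \<tau>" "\<not> int p dvd \<tau>" "\<not> int p dvd 9 + 4 * \<tau> ^ 2"
    and card: "reduction_card t p = 1 + card (sqpoints (\<lambda>x. x ^ 3 + (- 3 * (\<tau> ^ 2 + 1)) * x ^ 2 + 3 * x + (- 1)))"
    using reduction_card_eq[OF t0 val] by blast
  define f where "f = (\<lambda>x. x ^ 3 + (- 3 * (\<tau> ^ 2 + 1)) * x ^ 2 + 3 * x + (- 1))"
  have \<tau>d: "[\<tau> * d = 3 * k ^ 3] (mod int p)"
  proof (rule res_cong_unique)
    show "res_cong (t * of_int d) (\<tau> * d)" by (intro res_cong_intros \<tau>)
    show "res_cong (t * of_int d) (3 * k ^ 3)" unfolding td by (rule res_cong_of_int)
  qed
  define a b where "a = 9 * k ^ 2 - 3 * \<tau> ^ 2" and "b = 27 * k ^ 4 - 6 * \<tau> ^ 2 * d"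
  have td2: "[(\<tau> * d) ^ 2 = 9 * k ^ 6] (mod int p)"
  proof -
    have "[(\<tau> * d) ^ 2 = (3 * k ^ 3) ^ 2] (mod int p)" by (rule cong_pow[OF \<tau>d])
    moreover have "(3 * k ^ 3) ^ 2 = 9 * k ^ 6" by (simp add: power_mult_distrib flip: power_mult)
    ultimately show ?thesis by simp
  qed
  have bd: "[b * d ^ 2 = (3 * k ^ 2) ^ 2 * (3 * ((1 + k ^ 2) * (1 + 3 * k ^ 2)))] (mod int p)"
  proof -
    have "b * d ^ 2 = 27 * k ^ 4 * d ^ 2 - 6 * d * (\<tau> * d) ^ 2"
      by (simp add: b_def power2_eq_square algebra_simps)
    moreover have "[27 * k ^ 4 * d ^ 2 - 6 * d * (\<tau> * d) ^ 2 = 27 * k ^ 4 * d ^ 2 - 6 * d * (9 * k ^ 6)] (mod int p)"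
      by (rule cong_diff[OF cong_refl cong_mult[OF cong_refl td2]])
    moreover have "27 * k ^ 4 * d ^ 2 - 6 * d * (9 * k ^ 6) = (3 * k ^ 2) ^ 2 * (3 * ((1 + k ^ 2) * (1 + 3 * k ^ 2)))"
      by (simp add: d_def algebra_simps power_numeral_reduce)
    ultimately show ?thesis by simp
  qed
  have Dd: "[(a ^ 2 - 4 * b) * (d ^ 2) ^ 2 = (3 * k ^ 2) ^ 2 * (3 * (- (1 + 4 * k ^ 2)))] (mod int p)"
  proof -
    have "(a ^ 2 - 4 * b) * (d ^ 2) ^ 2 = (9 * k ^ 2 * d ^ 2 - 3 * (\<tau> * d) ^ 2) ^ 2 - 4 * (b * d ^ 2) * d ^ 2"
      by (simp add: a_def power2_eq_square algebra_simps)
    moreover have "[(9 * k ^ 2 * d ^ 2 - 3 * (\<tau> * d) ^ 2) ^ 2 - 4 * (b * d ^ 2) * d ^ 2 =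
        (9 * k ^ 2 * d ^ 2 - 3 * (9 * k ^ 6)) ^ 2 - 4 * ((3 * k ^ 2) ^ 2 * (3 * ((1 + k ^ 2) * (1 + 3 * k ^ 2)))) * d ^ 2] (mod int p)"
      by (rule cong_diff[OF cong_pow[OF cong_diff[OF cong_refl cong_mult[OF cong_refl td2]]]
            cong_mult[OF cong_mult[OF cong_refl bd] cong_refl]])
    moreover have "(9 * k ^ 2 * d ^ 2 - 3 * (9 * k ^ 6)) ^ 2 - 4 * ((3 * k ^ 2) ^ 2 * (3 * ((1 + k ^ 2) * (1 + 3 * k ^ 2)))) * d ^ 2
        = (3 * k ^ 2) ^ 2 * (3 * (- (1 + 4 * k ^ 2)))"
      by (simp add: d_def algebra_simps power_numeral_reduce)
    ultimately show ?thesis by simp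
  qed
  have k2: "\<not> int p dvd 3 * k ^ 2" using k not_dvd_3 by (simp add: dvd_mult_iff dvd_power_iff)
  have strip: "Legendre x p = Legendre y p \<and> (int p dvd x \<longleftrightarrow> int p dvd y)"
    if c: "[x * z ^ 2 = (3 * k ^ 2) ^ 2 * y] (mod int p)" and z: "\<not> int p dvd z" for x y z
  proof -
    have "Legendre x p * Legendre (z ^ 2) p = Legendre ((3 * k ^ 2) ^ 2) p * Legendre y p"
      using Legendre_cong[OF c] unfolding Legendre_mult[OF prime_p p_gt_2] .
    then have "Legendre x p = Legendre y p" unfolding Legendre_square[OF z] Legendre_square[OF k2] by simp
    then show ?thesis using Legendre_eq_0_iff by metis
  qed
  have d2: "\<not> int p dvd d ^ 2" using d by (simp add: dvd_power_iff)
  note sb = strip[OF bd d] and sD = strip[OF Dd d2]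
  have b_nd: "\<not> int p dvd b" using sb k1 e not_dvd_3 by (simp add: dvd_mult_iff)
  have D_nd: "\<not> int p dvd a ^ 2 - 4 * b"
    using sD k4 not_dvd_3 by (simp only: dvd_mult_iff dvd_minus_iff) simp
  have four: "4 dvd 1 + card (sqpoints (\<lambda>x. x * (x ^ 2 + a * x + b)))"
    using sq sb sD by (intro four_dvd_points[OF b_nd D_nd]) auto
  have "card (sqpoints (\<lambda>x. x * (x ^ 2 + a * x + b))) = card (sqpoints f)"
    unfolding sqpoints_def
  proof (rule card_points_transport[where g = "\<lambda>x y. x + d" and h = "\<lambda>x y. y"])
    fix x x' y y' assume c: "[x = x'] (mod int p)" "[y = y'] (mod int p)" and Pxy: "[y ^ 2 = f x] (mod int p)"
    have 1: "[y' ^ 2 = y ^ 2] (mod int p)" by (rule cong_pow[OF cong_sym[OF c(2)]])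
    have 2: "[f x = f x'] (mod int p)"
      unfolding f_def by (intro cong_add cong_mult[OF cong_refl] cong_pow cong_refl c)
    show "[y' ^ 2 = f x'] (mod int p)" by (rule cong_trans[OF cong_trans[OF 1 Pxy] 2])
  next
    fix x y x' y' :: int
    assume "[x + d = x' + d] (mod int p)" "[y = y'] (mod int p)"
    then show "[x = x'] (mod int p) \<and> [y = y'] (mod int p)" by (simp add: cong_add_rcancel)
  next
    fix x y :: int
    have "f (x + d) = x * (x ^ 2 + a * x + b) + (27 * k ^ 6 - 3 * (\<tau> * d) ^ 2)"
      by (simp add: f_def a_def b_def d_def algebra_simps power_numeral_reduce)
    moreover have "[27 * k ^ 6 - 3 * (\<tau> * d) ^ 2 = 27 * k ^ 6 - 3 * (9 * k ^ 6)] (mod int p)"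
      by (rule cong_diff[OF cong_refl cong_mult[OF cong_refl td2]])
    then have "[x * (x ^ 2 + a * x + b) + (27 * k ^ 6 - 3 * (\<tau> * d) ^ 2) = x * (x ^ 2 + a * x + b) + 0] (mod int p)"
      by (intro cong_add[OF cong_refl]) simp
    ultimately have c: "[f (x + d) = x * (x ^ 2 + a * x + b)] (mod int p)" by simp
    show "[y ^ 2 = x * (x ^ 2 + a * x + b)] (mod int p) \<longleftrightarrow> [y ^ 2 = f (x + d)] (mod int p)"
      using c by (meson cong_sym cong_trans)
  qed
  then have "4 dvd reduction_card t p" using four card by (simp add: f_def)
  moreover have "good_reduction (E_fam t) p" "3 dvd reduction_card t p"
    using three_dvd_reduction_card[OF t0 val] by auto
  ultimately have "good_reduction (E_fam t) p" "12 dvd reduction_card t p" by presburger+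
  then show ?thesis by (simp add: t_def)
qed

end

section \<open>The density of the primes in question\<close>

text \<open>
  For even \<open>M\<close> these are the primes prime to \<open>M\<close> that split in at least one of the fields generated by
  \<open>sqrt a\<close> and \<open>sqrt b\<close>.
\<close>

definition biquadratic_primes :: "int \<Rightarrow> int \<Rightarrow> int \<Rightarrow> nat set" where
  "biquadratic_primes M a b = {p. prime p \<and> \<not> int p dvd M \<and> (Legendre a (int p) = 1 \<or> Legendre b (int p) = 1)}"

definition Legendre_mean_zero :: "int \<Rightarrow> bool" where
  "Legendre_mean_zero D \<longleftrightarrow>
    (\<lambda>x. (\<Sum>p | prime p \<and> p \<le> x. real_of_int (Legendre D (int p))) / prime_count x) \<longlonglongrightarrow> 0"

text \<open>
  For signs \<open>\<epsilon>\<close> and \<open>\<delta>\<close> the indicator of \<open>\<epsilon> = 1 \<or> \<delta> = 1\<close> is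
  \<open>3 / 4 + (\<epsilon> + \<delta> - \<epsilon> \<delta>) / 4\<close>. With \<open>\<epsilon>\<close>, \<open>\<delta>\<close> and \<open>\<epsilon> \<delta>\<close> the Legendre symbols
  of \<open>a\<close>, \<open>b\<close> and \<open>c\<close>, the second summand averages to \<open>0\<close>.
\<close>

theorem density_biquadratic_primes:
  fixes a b c M :: int
  assumes mean: "Legendre_mean_zero a" "Legendre_mean_zero b" "Legendre_mean_zero c"
    and M: "M \<noteq> 0"
    and M_a: "\<And>p. prime p \<Longrightarrow> \<not> int p dvd M \<Longrightarrow> \<not> int p dvd a"
    and M_b: "\<And>p. prime p \<Longrightarrow> \<not> int p dvd M \<Longrightarrow> \<not> int p dvd b"
    and M_c: "\<And>p. prime p \<Longrightarrow> \<not> int p dvd M \<Longrightarrow> Legendre c (int p) = Legendre a (int p) * Legendre b (int p)"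
  shows "has_prime_density (biquadratic_primes M a b) (3 / 4)"
proof -
  define L where "L = (\<lambda>D p. real_of_int (Legendre D (int p)))"
  define s where "s = (\<lambda>D x. \<Sum>p | prime p \<and> p \<le> x. L D p)"
  define S where "S = biquadratic_primes M a b"
  define e where "e = (\<lambda>p. of_bool (p \<in> S) - (3 / 4 + (L a p + L b p - L c p) / 4))"
  define F where "F = (\<lambda>x. \<Sum>p | prime p \<and> p \<le> x. e p)"
  define B where "B = {p. prime p \<and> int p dvd M}"
  have fin_B: "finite B"
  proof (rule finite_subset)
    show "B \<subseteq> nat ` {d. d dvd M}"
    proof
      fix p assume "p \<in> B"
      then have "int p \<in> {d. d dvd M}" by (simp add: B_def)
      then have "nat (int p) \<in> nat ` {d. d dvd M}" by (rule imageI)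
      then show "p \<in> nat ` {d. d dvd M}" by simp
    qed
    show "finite (nat ` {d. d dvd M})" using finite_divisors_int[OF M] by (rule finite_imageI)
  qed
  have L_val: "L D p \<in> {-1, 0, 1}" for D p
    using Legendre_values[of D "int p"] unfolding L_def by auto
  have e0: "e p = 0" if p: "prime p" "p \<notin> B" for p
  proof -
    have nd: "\<not> int p dvd M" using p by (simp add: B_def)
    have "L a p \<noteq> 0" "L b p \<noteq> 0"
      using M_a[OF p(1) nd] M_b[OF p(1) nd] by (simp_all add: L_def Legendre_eq_0_iff)
    moreover have "L c p = L a p * L b p" by (simp add: L_def M_c[OF p(1) nd])
    moreover have "p \<in> S \<longleftrightarrow> L a p = 1 \<or> L b p = 1"
      using p nd by (simp add: S_def biquadratic_primes_def L_def)
    ultimately show ?thesis using L_val[of a p] L_val[of b p] by (auto simp: e_def)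
  qed
  have e2: "\<bar>e p\<bar> \<le> 2" for p
    using L_val[of a p] L_val[of b p] L_val[of c p] by (auto simp: e_def)
  have F_bound: "\<bar>F x\<bar> \<le> 2 * real (card B)" for x
  proof -
    have "F x = (\<Sum>p \<in> {p. prime p \<and> p \<le> x} \<inter> B. e p)"
      unfolding F_def using finite_primes_le e0 by (intro sum.mono_neutral_right) auto
    also have "\<bar>\<dots>\<bar> \<le> (\<Sum>p \<in> {p. prime p \<and> p \<le> x} \<inter> B. \<bar>e p\<bar>)" by (rule sum_abs)
    also have "\<dots> \<le> (\<Sum>p \<in> {p. prime p \<and> p \<le> x} \<inter> B. 2)" by (rule sum_mono) (rule e2)
    also have "\<dots> \<le> 2 * real (card B)" using card_mono[OF fin_B, of "{p. prime p \<and> p \<le> x} \<inter> B"] by simp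
    finally show ?thesis .
  qed
  have count: "real (card {p \<in> S \<inter> {p. prime p}. p \<le> x}) = 3 / 4 * prime_count x + (s a x + s b x - s c x) / 4 + F x" for x
  proof -
    have "{p \<in> S \<inter> {p. prime p}. p \<le> x} = {p \<in> {p. prime p \<and> p \<le> x}. p \<in> S}" by auto
    then have "real (card {p \<in> S \<inter> {p. prime p}. p \<le> x}) = (\<Sum>p | prime p \<and> p \<le> x. of_bool (p \<in> S))"
      using finite_primes_le[of x] by (simp add: Int_def)
    also have "\<dots> = (\<Sum>p | prime p \<and> p \<le> x. e p + (3 / 4 + (L a p + L b p - L c p) / 4))"
      by (simp add: e_def)
    also have "\<dots> = F x + (3 / 4 * prime_count x + (s a x + s b x - s c x) / 4)"
      by (simp add: F_def s_def prime_count_def sum.distrib sum_subtractf flip: sum_divide_distrib)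
    finally show ?thesis by simp
  qed
  have lim_s: "(\<lambda>x. s D x / prime_count x) \<longlonglongrightarrow> 0" if "Legendre_mean_zero D" for D
    using that unfolding Legendre_mean_zero_def s_def L_def .
  have lim_F: "(\<lambda>x. F x / prime_count x) \<longlonglongrightarrow> 0"
  proof (rule tendsto_norm_zero_cancel, rule tendsto_sandwich[OF _ _ tendsto_const])
    show "\<forall>\<^sub>F x in sequentially. 0 \<le> norm (F x / prime_count x)" by simp
    show "\<forall>\<^sub>F x in sequentially. norm (F x / prime_count x) \<le> 2 * real (card B) / prime_count x"
      using F_bound by (intro always_eventually) (auto simp: abs_divide prime_count_def intro!: divide_right_mono)
    show "(\<lambda>x. 2 * real (card B) / prime_count x) \<longlonglongrightarrow> 0"
      by (rule real_tendsto_divide_at_top[OF tendsto_const prime_count_at_top])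
  qed
  have "(\<lambda>x. 3 / 4 + (s a x / prime_count x + s b x / prime_count x - s c x / prime_count x) / 4 + F x / prime_count x)
      \<longlonglongrightarrow> 3 / 4 + (0 + 0 - 0) / 4 + 0"
    by (intro tendsto_intros lim_s mean lim_F) simp
  moreover have "\<forall>\<^sub>F x in sequentially. 3 / 4 + (s a x / prime_count x + s b x / prime_count x - s c x / prime_count x) / 4 + F x / prime_count x
      = real (card {p \<in> S \<inter> {p. prime p}. p \<le> x}) / real (card {p \<in> {p. prime p}. p \<le> x})"
    using filterlim_at_top_dense[THEN iffD1, OF prime_count_at_top, rule_format, of 0]
  proof eventually_elim
    case (elim x)
    have "real (card {p \<in> {p. prime p}. p \<le> x}) = prime_count x" by (simp add: prime_count_def)
    then show ?case unfolding count using elim by (simp add: field_simps)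
  qed
  ultimately show ?thesis
    unfolding has_prime_density_def has_relative_density_def S_def
    by (simp add: tendsto_cong)
qed

text \<open>
  Positive density ensures that \<open>S\<close> is nonempty, so that the quotients are eventually \<open>1\<close> rather than
  \<open>0 / 0\<close>.
\<close>

lemma relative_density_self:
  assumes "has_prime_density S d" "d > 0"
  shows "has_relative_density S S 1"
proof -
  have "\<forall>\<^sub>F n in sequentially. 0 < real (card {p \<in> S \<inter> {p. prime p}. p \<le> n}) / real (card {p \<in> {p. prime p}. p \<le> n})"
    using assms unfolding has_prime_density_def has_relative_density_def by (rule order_tendstoD)
  then have "\<forall>\<^sub>F n in sequentially. real (card {p \<in> S \<inter> S. p \<le> n}) / real (card {p \<in> S. p \<le> n}) = 1"
  proof eventually_elim
    case (elim n)
    have "card {p \<in> S \<inter> {p. prime p}. p \<le> n} \<le> card {p \<in> S. p \<le> n}"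
      by (rule card_mono) (auto intro: finite_subset[of _ "{..n}"])
    moreover have "card {p \<in> S \<inter> {p. prime p}. p \<le> n} > 0"
    proof (rule ccontr)
      assume "\<not> card {p \<in> S \<inter> {p. prime p}. p \<le> n} > 0"
      then have "card {p \<in> S \<inter> {p. prime p}. p \<le> n} = 0" by (simp only: not_gr_zero)
      with elim show False by (simp only: of_nat_0 div_0 less_irrefl)
    qed
    ultimately have "card {p \<in> S. p \<le> n} > 0" by linarith
    then have "real (card {p \<in> S. p \<le> n}) \<noteq> 0" by linarith
    then show ?case unfolding Int_absorb by (rule divide_self)
  qed
  then show ?thesis unfolding has_relative_density_def by (rule tendsto_eventually)
qed

lemma not_3_dvd_square_plus_1: "\<not> 3 dvd 1 + (k :: int) ^ 2"
proof
  assume "3 dvd 1 + k ^ 2"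
  moreover obtain r q where "k = 3 * q + r" "r \<in> {-1, 0, 1}"
  proof -
    have "k = 3 * ((k + 1) div 3) + ((k + 1) mod 3 - 1)" by presburger
    moreover have "(k + 1) mod 3 - 1 \<in> {-1, 0, 1}" by (simp; presburger)
    ultimately show ?thesis by (rule that)
  qed
  moreover have "1 + (3 * q + r) ^ 2 = 3 * (3 * q ^ 2 + 2 * q * r) + (1 + r ^ 2)"
    by (simp add: power2_eq_square algebra_simps)
  ultimately have "3 dvd 1 + r ^ 2" by (metis dvd_add_right_iff dvd_triv_left)
  then show False using \<open>r \<in> {-1, 0, 1}\<close> by auto
qed

text \<open>
  Each of the two integers, and their product up to the square \<open>9\<close>, is odd and exactly divisible by some
  prime \<open>l > 2\<close>, which makes the average of its Legendre symbols vanish. The first two are divisible by \<open>3\<close>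
  exactly once for every \<open>k\<close>. In the product the prime \<open>5\<close> serves: since \<open>k\<close> is \<open>2\<close> modulo \<open>25\<close>,
  it divides \<open>1 + k\<^sup>2\<close> exactly once and the other two factors not at all. Oddness needs \<open>k\<close> even, whence the
  modulus \<open>50\<close>.
\<close>

lemma density_twelve_primes:
  fixes j k M :: int
  assumes k: "k = 50 * j + 2"
  defines "M \<equiv> 6 * k * ((1 + 3 * k ^ 2) * ((1 + k ^ 2) * (1 + 4 * k ^ 2)))"
  shows "has_prime_density
    (biquadratic_primes M (3 * ((1 + k ^ 2) * (1 + 3 * k ^ 2))) (3 * (- (1 + 4 * k ^ 2)))) (3 / 4)"
proof (rule density_biquadratic_primes)
  define v where "v = 8 * j + 100 * j ^ 2"
  have k2: "k ^ 2 = 4 + 25 * v" by (simp add: v_def k power2_eq_square algebra_simps)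
  have "even v" by (simp add: v_def)
  have three: "\<not> 3 dvd 1 + k ^ 2" by (rule not_3_dvd_square_plus_1)
  then have "\<not> 3 dvd 1 + 4 * k ^ 2" "\<not> 3 dvd 1 + 3 * k ^ 2" by presburger+
  note three = three this
  show "Legendre_mean_zero (3 * ((1 + k ^ 2) * (1 + 3 * k ^ 2)))"
    unfolding Legendre_mean_zero_def
  proof (rule Legendre_prime_average[of 3 _ "(1 + k ^ 2) * (1 + 3 * k ^ 2)"])
    show "\<not> int 3 dvd (1 + k ^ 2) * (1 + 3 * k ^ 2)" using three by (simp add: prime_dvd_mult_iff)
    show "odd (3 * ((1 + k ^ 2) * (1 + 3 * k ^ 2)))" using \<open>even v\<close> by (simp add: k2)
  qed simp_all
  show "Legendre_mean_zero (3 * (- (1 + 4 * k ^ 2)))"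
    unfolding Legendre_mean_zero_def
  proof (rule Legendre_prime_average[of 3 _ "- (1 + 4 * k ^ 2)"])
    show "\<not> int 3 dvd - (1 + 4 * k ^ 2)" unfolding dvd_minus_iff using three by simp
    show "odd (3 * (- (1 + 4 * k ^ 2)))" by simp
  qed simp_all
  define c where "c = - ((1 + k ^ 2) * ((1 + 3 * k ^ 2) * (1 + 4 * k ^ 2)))"
  show "Legendre_mean_zero c"
    unfolding Legendre_mean_zero_def
  proof (rule Legendre_prime_average[of 5 _ "- ((1 + 5 * v) * ((13 + 75 * v) * (17 + 100 * v)))"])
    show "c = int 5 * (- ((1 + 5 * v) * ((13 + 75 * v) * (17 + 100 * v))))"
      unfolding c_def k2 by simp
    have "\<not> 5 dvd 1 + 5 * v" "\<not> 5 dvd 13 + 75 * v" "\<not> 5 dvd 17 + 100 * v" by presburger+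
    then show "\<not> int 5 dvd - ((1 + 5 * v) * ((13 + 75 * v) * (17 + 100 * v)))"
      by (simp add: prime_dvd_mult_iff)
    show "odd c" unfolding c_def k2 using \<open>even v\<close> by simp
  qed simp_all
  have pos: "1 + k ^ 2 > 0" "1 + 3 * k ^ 2 > 0" "1 + 4 * k ^ 2 > 0" using zero_le_power2[of k] by linarith+
  have "k \<noteq> 0" using k by presburger
  with pos show "M \<noteq> 0" unfolding M_def by simp
  fix p :: nat assume p: "prime p" "\<not> int p dvd M"
  have pp: "prime (int p)" using p by simp
  have "M = 3 * (2 * k * (1 + 3 * k ^ 2) * (1 + k ^ 2) * (1 + 4 * k ^ 2))" by (simp add: M_def)
  then have nd: "\<not> int p dvd 3" "\<not> int p dvd 2" "\<not> int p dvd 1 + 3 * k ^ 2" "\<not> int p dvd 1 + k ^ 2" "\<not> int p dvd 1 + 4 * k ^ 2"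
    using p(2) by (auto simp only: prime_dvd_mult_iff[OF pp])
  show "\<not> int p dvd 3 * ((1 + k ^ 2) * (1 + 3 * k ^ 2))" "\<not> int p dvd 3 * (- (1 + 4 * k ^ 2))"
    using nd unfolding prime_dvd_mult_iff[OF pp] dvd_minus_iff by blast+
  have "p \<noteq> 2" using nd(2) by auto
  then have p2: "p > 2" using prime_ge_2_nat[OF p(1)] by simp
  have "Legendre (3 * ((1 + k ^ 2) * (1 + 3 * k ^ 2))) p * Legendre (3 * (- (1 + 4 * k ^ 2))) p
      = Legendre (3 ^ 2 * c) p"
    unfolding Legendre_mult[OF p(1) p2, symmetric] c_def by (simp add: algebra_simps)
  also have "\<dots> = Legendre (3 ^ 2) p * Legendre c p" by (rule Legendre_mult[OF p(1) p2])
  also have "Legendre (3 ^ 2) p = 1"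
  proof -
    have "Legendre (3 ^ 2) p = Legendre 3 p * Legendre 3 p" unfolding power2_eq_square by (rule Legendre_mult[OF p(1) p2])
    moreover have "Legendre 3 p \<noteq> 0" using nd(1) by (simp add: Legendre_eq_0_iff)
    ultimately show ?thesis using Legendre_values[of 3 p] by auto
  qed
  finally show "Legendre c p = Legendre (3 * ((1 + k ^ 2) * (1 + 3 * k ^ 2))) p * Legendre (3 * (- (1 + 4 * k ^ 2))) p"
    by simp
qed

lemma t_fam_nonzero: "k > 0 \<Longrightarrow> t_fam k \<noteq> 0"
proof
  assume "k > 0" "t_fam k = 0"
  then have "(of_int (3 * k ^ 3) :: rat) = 0" using t_fam_denom[of k] by (simp only: mult_zero_left)
  with \<open>k > 0\<close> show False unfolding of_int_eq_0_iff by simp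
qed

lemma t_fam_inject:
  assumes "k > 0" "l > 0" "t_fam k = t_fam l"
  shows "k = l"
proof -
  have "of_int ((3 * k ^ 3) * (1 + 3 * l ^ 2)) = (of_int ((3 * l ^ 3) * (1 + 3 * k ^ 2)) :: rat)"
  proof -
    have "t_fam k * of_int (1 + 3 * k ^ 2) * of_int (1 + 3 * l ^ 2) = t_fam l * of_int (1 + 3 * l ^ 2) * of_int (1 + 3 * k ^ 2)"
      unfolding assms(3) by (simp only: mult.assoc mult.commute[of "of_int (1 + 3 * k ^ 2)"])
    then show ?thesis unfolding t_fam_denom by (simp only: of_int_mult)
  qed
  then have "(3 * k ^ 3) * (1 + 3 * l ^ 2) = (3 * l ^ 3) * (1 + 3 * k ^ 2)" by (simp only: of_int_eq_iff)
  moreover have "(3 * k ^ 3) * (1 + 3 * l ^ 2) - (3 * l ^ 3) * (1 + 3 * k ^ 2)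
      = 3 * ((k - l) * (k ^ 2 + k * l + l ^ 2 + 3 * k ^ 2 * l ^ 2))"
    by (simp add: power2_eq_square power3_eq_cube algebra_simps)
  ultimately have "3 * ((k - l) * (k ^ 2 + k * l + l ^ 2 + 3 * k ^ 2 * l ^ 2)) = 0" by linarith
  then have "(k - l) * (k ^ 2 + k * l + l ^ 2 + 3 * k ^ 2 * l ^ 2) = 0" by simp
  moreover have "k ^ 2 + k * l + l ^ 2 + 3 * k ^ 2 * l ^ 2 > 0" using assms by (intro add_pos_pos) auto
  ultimately show ?thesis by simp
qed

theorem theorem5p3:
  shows "(\<forall>t :: rat. t \<noteq> 0 \<longrightarrow>
            discriminant (E_fam t) = - 432 * t ^ 4 * (9 + 4 * t ^ 2) \<and>
            discriminant (E_fam t) \<noteq> 0 \<and>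
            (\<forall>p :: nat. prime p \<and> p \<noteq> 2 \<and> p \<noteq> 3 \<and> rat_val p (t * (9 + 4 * t ^ 2)) = 0 \<longrightarrow>
               good_reduction (E_fam t) p \<and> [reduction_card t p = 0] (mod 3)))
       \<and> infinite {t :: rat. t \<noteq> 0 \<and>
            (\<exists>S \<subseteq> {p. prime p}.
               (\<exists>d \<ge> 2 / 3. has_prime_density S d) \<and>
               (\<forall>p \<in> S. good_reduction (E_fam t) p \<and> [reduction_card t p = 0] (mod 6)) \<and>
               (\<exists>d \<ge> 1 / 2. has_relative_density {p \<in> S. [reduction_card t p = 0] (mod 12)} S d))}"
    (is "?part1 \<and> infinite ?T")
proof
  show ?part1
  proof (intro allI impI)
    fix t :: rat assume t: "t \<noteq> 0"
    have "good_reduction (E_fam t) p \<and> [reduction_card t p = 0] (mod 3)"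
      if p: "prime p" "p \<noteq> 2" "p \<noteq> 3" and val: "rat_val p (t * (9 + 4 * t ^ 2)) = 0" for p
    proof -
      have "p > 3" using prime_ge_2_nat[OF p(1)] p by linarith
      then interpret prime_above_3 p using p by unfold_locales
      show ?thesis using three_dvd_reduction_card[OF t val] by (simp add: cong_0_iff)
    qed
    then show "discriminant (E_fam t) = - 432 * t ^ 4 * (9 + 4 * t ^ 2) \<and> discriminant (E_fam t) \<noteq> 0 \<and>
        (\<forall>p :: nat. prime p \<and> p \<noteq> 2 \<and> p \<noteq> 3 \<and> rat_val p (t * (9 + 4 * t ^ 2)) = 0 \<longrightarrow>
           good_reduction (E_fam t) p \<and> [reduction_card t p = 0] (mod 3))"
      using discriminant_E_fam discriminant_E_fam_nonzero[OF t] by blast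
  qed
next
  have "t_fam (50 * int j + 2) \<in> ?T" for j
  proof -
    define k where "k = 50 * int j + 2"
    define M where "M = 6 * k * ((1 + 3 * k ^ 2) * ((1 + k ^ 2) * (1 + 4 * k ^ 2)))"
    define S where "S = biquadratic_primes M (3 * ((1 + k ^ 2) * (1 + 3 * k ^ 2))) (3 * (- (1 + 4 * k ^ 2)))"
    have density: "has_prime_density S (3 / 4)"
      unfolding S_def M_def by (rule density_twelve_primes) (simp add: k_def)
    have twelve: "good_reduction (E_fam (t_fam k)) p \<and> 12 dvd reduction_card (t_fam k) p" if p: "p \<in> S" for p
    proof -
      have pr: "prime p" and nM: "\<not> int p dvd M"
        and sq: "Legendre (3 * ((1 + k ^ 2) * (1 + 3 * k ^ 2))) p = 1 \<or> Legendre (3 * (- (1 + 4 * k ^ 2))) p = 1"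
        using p by (auto simp: S_def biquadratic_primes_def)
      have pp: "prime (int p)" using pr by simp
      have "M = 2 * (3 * (k * ((1 + 3 * k ^ 2) * ((1 + k ^ 2) * (1 + 4 * k ^ 2)))))" by (simp add: M_def)
      then have nd: "\<not> int p dvd 2" "\<not> int p dvd 3" "\<not> int p dvd k" "\<not> int p dvd 1 + 3 * k ^ 2"
          "\<not> int p dvd 1 + k ^ 2" "\<not> int p dvd 1 + 4 * k ^ 2"
        using nM by (auto simp only: prime_dvd_mult_iff[OF pp])
      have "p \<noteq> 2" "p \<noteq> 3" using nd(1,2) by auto
      then have "p > 3" using prime_ge_2_nat[OF pr] by linarith
      then interpret prime_above_3 p using pr by unfold_locales
      show ?thesis by (rule twelve_dvd_reduction_card[OF nd(3-6) sq])
    qed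
    then have "{p \<in> S. [reduction_card (t_fam k) p = 0] (mod 12)} = S" by (auto simp: cong_0_iff)
    then have "has_relative_density {p \<in> S. [reduction_card (t_fam k) p = 0] (mod 12)} S 1"
      using relative_density_self[OF density] by simp
    moreover have "[reduction_card (t_fam k) p = 0] (mod 6)" if "p \<in> S" for p
      using twelve[OF that] dvd_trans[of 6 12 "reduction_card (t_fam k) p"] by (simp add: cong_0_iff)
    moreover have "S \<subseteq> {p. prime p}" by (auto simp: S_def biquadratic_primes_def)
    moreover have "(1 / 2 :: real) \<le> 1" "(2 / 3 :: real) \<le> 3 / 4" by simp_all
    moreover have "t_fam k \<noteq> 0" by (rule t_fam_nonzero) (simp add: k_def)
    ultimately show ?thesis using density twelve unfolding k_def [symmetric] mem_Collect_eq by blast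
  qed
  then have "range (\<lambda>j. t_fam (50 * int j + 2)) \<subseteq> ?T" by (rule image_subsetI)
  moreover have "inj (\<lambda>j. t_fam (50 * int j + 2))"
  proof (rule injI)
    fix i j assume "t_fam (50 * int i + 2) = t_fam (50 * int j + 2)"
    from t_fam_inject[OF _ _ this] show "i = j" by simp
  qed
  then have "infinite (range (\<lambda>j. t_fam (50 * int j + 2)))" by (rule range_inj_infinite)
  ultimately show "infinite ?T" by (rule infinite_super)
qed

end
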